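(* Let $(X^4,g)$ be an oriented asymptotically hyperbolic 4-manifold, let $E\to X$ be an $\mathrm{SU}(2)$ vector bundle, and let $A$ be an $\mathrm{SU}(2)$ $0$-connection on $E$. Suppose that $A$ is adapted to $g$ at infinity, and that $\mathrm{res}_A$ does not vanish identically on any connected component of $\partial X$. Then $A$ satisfies the Nahm pole boundary condition if and only if $A$ is asymptotically self-dual, i.e. if and only if the anti-self-dual part $F_A^-$ of the curvature, as a section of ${}^0\Lambda^-\otimes\mathfrak{su}(E)$, vanishes along $\partial X$.
   Context: $X$ is a compact manifold with boundary $\partial X$ and interior $X^\circ$. A boundary defining function (bdf) is a smooth $x:X\to[0,\infty)$ with $x^{-1}(0)=\partial X$ and $dx\neq 0$ along $\partial X$. A metric $g$ on $X^\circ$ is conformally compact if $x^2g$ extends to a smooth metric on $X$ for some (every) bdf $x$; it is asymptotically hyperbolic if moreover $|dx|^2_{x^2g}\equiv 1$ on $\partial X$. Boundaries are oriented by the outward-normal-first convention. The $0$-tangent bundle ${}^0TX$ is the vector bundle whose smooth sections are the smooth vector fields on $X$ vanishing on $\partial X$ ($0$-vector fields); ${}^0T^*X$ is its dual and ${}^0\Lambda^k=\Lambda^k({}^0T^*X)$ (sections of ${}^0\Lambda^k$ are $x^{-k}\overline\omega$ with $\overline\omega$ a smooth $k$-form). $g$ is a smooth bundle metric on ${}^0TX$. In dimension 4 the Hodge star of $g$ extends to ${}^0\Lambda^2$, with $\pm1$ eigenbundles ${}^0\Lambda^\pm$. A $0$-connection on $E$ is an $\mathbb{R}$-bilinear map $(V,s)\mapsto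 A_Vs$ defined for $0$-vector fields $V$ and $s\in C^\infty(X;E)$, with values in $C^\infty(X;E)$, which is $C^\infty(X)$-linear in $V$ and satisfies the Leibniz rule. It is an $\mathrm{SU}(2)$ $0$-connection if it is compatible with the $\mathrm{SU}(2)$ structure. Its residue is the bundle map $\mathrm{res}_A=(A-D)_{|\partial X}:{}^0TX_{|\partial X}\to\mathfrak{su}(E_{|\partial X})$, where $D$ is any ordinary smooth $\mathrm{SU}(2)$ connection on $E$ (independent of $D$). The curvature extends to $F_A\in C^\infty(X;{}^0\Lambda^2\otimes\mathfrak{su}(E))$, and $F_A=F_A^++F_A^-$ is its decomposition along ${}^0\Lambda^\pm$. Let $K\subset{}^0TX_{|\partial X}$ be the annihilator of $(dx/x)_{|\partial X}$ (independent of the bdf $x$). It has rank 3, inherits a metric from $g$, and an orientation from $\partial X$ via the isomorphism $T\partial X\to K$ induced by $V\mapsto xV$; so it is an $\mathrm{SO}(3)$ bundle, and is a bundle of Lie algebras via the fibrewise cross product ($K\simeq\mathfrak{so}(K)$). $A$ is adapted to $g$ at infinity if $\mathrm{res}_A$ vanishes on $K^\perp$. $A$ satisfies the Nahm pole boundary condition if it is adapted to $g$ at infinity and $\mathrm{res}_A$ restricted to $K$ is an isomorphism of Lie algebra bundles $K\to\mathfrak{su}(E_{|\partial X})$. *)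

theory Defs
  imports "HOL-Analysis.Analysis"
begin

section \<open>Smooth functions\<close>

fun cont_diff_on :: "nat \<Rightarrow> 'v::real_normed_vector set \<Rightarrow> ('v \<Rightarrow> 'b::real_normed_vector) \<Rightarrow> bool" where
  "cont_diff_on 0 S f \<longleftrightarrow> continuous_on S f"
| "cont_diff_on (Suc k) S f \<longleftrightarrow>
     (\<forall>x\<in>S. f differentiable (at x)) \<and>
     (\<forall>v. cont_diff_on k S (\<lambda>x. frechet_derivative f (at x) v))"

text \<open>Smoothness on an arbitrary subset of Euclidean space, in the sense of local smooth
  extensions; it is used on relatively open subsets of the half-space.\<close>

definition smooth_within :: "(real^4) set \<Rightarrow> (real^4 \<Rightarrow> 'b::real_normed_vector) \<Rightarrow> bool" where
  "smooth_within S f \<longleftrightarrow>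
     (\<forall>z\<in>S. \<exists>W h. open W \<and> z \<in> W \<and> (\<forall>k. cont_diff_on k W h) \<and> (\<forall>y\<in>S \<inter> W. h y = f y))"

section \<open>Oriented 4-manifolds with boundary\<close>

text \<open>The manifold is the whole type \<open>'a\<close>, with a smooth structure and an orientation given by
  an atlas \<open>M\<close> whose charts take values in the half-space and whose transition maps are smooth
  and orientation preserving.\<close>

type_synonym 'a chart = "'a set \<times> ('a \<Rightarrow> real^4)"

definition half_space :: "(real^4) set" where
  "half_space = {z. 0 \<le> z $ 1}"

definition oriented_manifold_with_boundary :: "'a::t2_space chart set \<Rightarrow> bool" where
  "oriented_manifold_with_boundary M \<longleftrightarrow>
     (\<Union>(U, \<phi>)\<in>M. U) = UNIV \<and>
     (\<forall>(U, \<phi>)\<in>M. open U \<and> openin (top_of_set half_space) (\<phi> ` U) \<and>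
        homeomorphism U (\<phi> ` U) \<phi> (inv_into U \<phi>)) \<and>
     (\<forall>(U, \<phi>)\<in>M. \<forall>(U', \<phi>')\<in>M.
        smooth_within (\<phi> ` (U \<inter> U')) (\<phi>' \<circ> inv_into U \<phi>) \<and>
        (\<forall>z\<in>\<phi> ` (U \<inter> U').
           det (matrix (frechet_derivative (\<phi>' \<circ> inv_into U \<phi>) (at z within half_space))) > 0))"

definition bdry :: "'a::t2_space chart set \<Rightarrow> 'a set" where
  "bdry M = {p. \<exists>(U, \<phi>)\<in>M. p \<in> U \<and> \<phi> p $ 1 = 0}"

definition smooth_fun_on ::
    "'a::t2_space chart set \<Rightarrow> 'a set \<Rightarrow> ('a \<Rightarrow> 'b::real_normed_vector) \<Rightarrow> bool" where
  "smooth_fun_on M S f \<longleftrightarrow> (\<forall>(U, \<phi>)\<in>M. smooth_within (\<phi> ` (U \<inter> S)) (f \<circ> inv_into U \<phi>))"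

definition smooth_functions :: "'a::t2_space chart set \<Rightarrow> ('a \<Rightarrow> real) set" where
  "smooth_functions M = {f. smooth_fun_on M UNIV f}"

section \<open>Tangent vectors, vector fields, boundary defining functions\<close>

text \<open>Tangent vectors at \<open>p\<close> are the derivations at \<open>p\<close> of the algebra of smooth functions,
  extended by \<open>0\<close> to non-smooth functions so that they are determined by their values on smooth
  ones. The vector space operations on them are pointwise.\<close>

type_synonym 'a tangent = "('a \<Rightarrow> real) \<Rightarrow> real"

type_synonym 'a vfield = "'a \<Rightarrow> 'a tangent"

definition tangent_space :: "'a::t2_space chart set \<Rightarrow> 'a \<Rightarrow> 'a tangent set" where
  "tangent_space M p = {v.
     (\<forall>f\<in>smooth_functions M. \<forall>h\<in>smooth_functions M. \<forall>a b.
        v (\<lambda>q. a * f q + b * h q) = a * v f + b * v h) \<and>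
     (\<forall>f\<in>smooth_functions M. \<forall>h\<in>smooth_functions M.
        v (\<lambda>q. f q * h q) = f p * v h + h p * v f) \<and>
     (\<forall>f. f \<notin> smooth_functions M \<longrightarrow> v f = 0)}"

definition vector_fields :: "'a::t2_space chart set \<Rightarrow> 'a vfield set" where
  "vector_fields M = {V. (\<forall>p. V p \<in> tangent_space M p) \<and>
     (\<forall>f\<in>smooth_functions M. (\<lambda>p. V p f) \<in> smooth_functions M)}"

definition zero_vector_fields :: "'a::t2_space chart set \<Rightarrow> 'a vfield set" where
  "zero_vector_fields M = {V \<in> vector_fields M. \<forall>p\<in>bdry M. V p = (\<lambda>f. 0)}"

definition vf_add :: "'a vfield \<Rightarrow> 'a vfield \<Rightarrow> 'a vfield" where
  "vf_add V W = (\<lambda>p f. V p f + W p f)"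

definition vf_scale :: "('a \<Rightarrow> real) \<Rightarrow> 'a vfield \<Rightarrow> 'a vfield" where
  "vf_scale u V = (\<lambda>p f. u p * V p f)"

definition lie_bracket :: "'a::t2_space chart set \<Rightarrow> 'a vfield \<Rightarrow> 'a vfield \<Rightarrow> 'a vfield" where
  "lie_bracket M V W = (\<lambda>p f. if f \<in> smooth_functions M
     then V p (\<lambda>q. W q f) - W p (\<lambda>q. V q f) else 0)"

text \<open>The local coordinates of a chart are not globally defined functions, so they are replaced
  by globally smooth functions agreeing with them near \<open>p\<close>.\<close>

definition positive_basis :: "'a::t2_space chart set \<Rightarrow> 'a \<Rightarrow> (4 \<Rightarrow> 'a tangent) \<Rightarrow> bool" where
  "positive_basis M p v \<longleftrightarrow> (\<forall>i. v i \<in> tangent_space M p) \<and>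
     (\<exists>(U, \<phi>)\<in>M. p \<in> U \<and> (\<exists>f. (\<forall>i. f i \<in> smooth_functions M \<and>
         (\<forall>\<^sub>F q in nhds p. f i q = \<phi> q $ i)) \<and>
       det ((\<chi> i j. v j (f i)) :: real^4^4) > 0))"

definition bdf :: "'a::t2_space chart set \<Rightarrow> ('a \<Rightarrow> real) \<Rightarrow> bool" where
  "bdf M x \<longleftrightarrow> x \<in> smooth_functions M \<and> (\<forall>p. 0 \<le> x p) \<and> {p. x p = 0} = bdry M \<and>
     (\<forall>p\<in>bdry M. \<exists>v\<in>tangent_space M p. v x \<noteq> 0)"

section \<open>Asymptotically hyperbolic metrics\<close>

type_synonym 'a metric_field = "'a \<Rightarrow> 'a tangent \<Rightarrow> 'a tangent \<Rightarrow> real"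

definition riemannian_metric_on :: "'a::t2_space chart set \<Rightarrow> 'a set \<Rightarrow> 'a metric_field \<Rightarrow> bool" where
  "riemannian_metric_on M S g \<longleftrightarrow>
     (\<forall>p\<in>S. \<forall>v\<in>tangent_space M p. \<forall>w\<in>tangent_space M p.
        g p v w = g p w v \<and>
        (v \<noteq> (\<lambda>f. 0) \<longrightarrow> g p v v > 0) \<and>
        (\<forall>u\<in>tangent_space M p. \<forall>a b.
           g p (\<lambda>f. a * u f + b * v f) w = a * g p u w + b * g p v w)) \<and>
     (\<forall>V\<in>vector_fields M. \<forall>W\<in>vector_fields M. smooth_fun_on M S (\<lambda>p. g p (V p) (W p)))"

text \<open>\<open>h\<close> is a smooth metric up to the boundary extending \<open>x\<^sup>2 g\<close>.\<close>

definition compactification ::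
    "'a::t2_space chart set \<Rightarrow> 'a metric_field \<Rightarrow> ('a \<Rightarrow> real) \<Rightarrow> 'a metric_field \<Rightarrow> bool" where
  "compactification M g x h \<longleftrightarrow> bdf M x \<and> riemannian_metric_on M UNIV h \<and>
     (\<forall>p. p \<notin> bdry M \<longrightarrow> (\<forall>v\<in>tangent_space M p. \<forall>w\<in>tangent_space M p.
        h p v w = (x p)\<^sup>2 * g p v w))"

definition conformally_compact :: "'a::t2_space chart set \<Rightarrow> 'a metric_field \<Rightarrow> bool" where
  "conformally_compact M g \<longleftrightarrow>
     riemannian_metric_on M (- bdry M) g \<and> (\<exists>x h. compactification M g x h)"

definition gradient ::
    "'a::t2_space chart set \<Rightarrow> 'a metric_field \<Rightarrow> 'a \<Rightarrow> ('a \<Rightarrow> real) \<Rightarrow> 'a tangent" where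
  "gradient M h p f = (THE v. v \<in> tangent_space M p \<and> (\<forall>w\<in>tangent_space M p. h p v w = w f))"

definition differential_norm_sq ::
    "'a::t2_space chart set \<Rightarrow> 'a metric_field \<Rightarrow> 'a \<Rightarrow> ('a \<Rightarrow> real) \<Rightarrow> real" where
  "differential_norm_sq M h p f = h p (gradient M h p f) (gradient M h p f)"

definition asymptotically_hyperbolic :: "'a::t2_space chart set \<Rightarrow> 'a metric_field \<Rightarrow> bool" where
  "asymptotically_hyperbolic M g \<longleftrightarrow> conformally_compact M g \<and>
     (\<exists>x h. compactification M g x h \<and> (\<forall>p\<in>bdry M. differential_norm_sq M h p x = 1))"

section \<open>The 0-tangent bundle along the boundary\<close>

text \<open>The fibre of the 0-tangent bundle at \<open>p\<close> is the space of 0-vector fields modulo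
  \<open>zero_null M p\<close>, the submodule generated by products \<open>f W\<close> with \<open>f p = 0\<close>. Elements of the fibre
  are represented by 0-vector fields, and tensors by maps which are linear over the smooth
  functions.\<close>

definition zero_null :: "'a::t2_space chart set \<Rightarrow> 'a \<Rightarrow> 'a vfield set" where
  "zero_null M p = {V. \<exists>(n::nat) f W.
     (\<forall>i<n. f i \<in> smooth_functions M \<and> f i p = 0 \<and> W i \<in> zero_vector_fields M) \<and>
     V = (\<lambda>q h. \<Sum>i<n. f i q * W i q h)}"

text \<open>The bundle metric induced by \<open>g\<close> on the 0-tangent bundle, i.e. the smooth extension to the
  boundary of \<open>g(V, W)\<close>.\<close>

definition zero_metric ::
    "'a::t2_space chart set \<Rightarrow> 'a metric_field \<Rightarrow> 'a vfield \<Rightarrow> 'a vfield \<Rightarrow> 'a \<Rightarrow> real" where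
  "zero_metric M g V W = (THE u. u \<in> smooth_functions M \<and>
     (\<forall>p. p \<notin> bdry M \<longrightarrow> u p = g p (V p) (W p)))"

text \<open>\<open>(dx/x)(V)\<close>, as a smooth function on the whole manifold.\<close>

definition dlog :: "'a::t2_space chart set \<Rightarrow> ('a \<Rightarrow> real) \<Rightarrow> 'a vfield \<Rightarrow> 'a \<Rightarrow> real" where
  "dlog M x V = (THE u. u \<in> smooth_functions M \<and> (\<forall>q. V q x = x q * u q))"

definition K_fibre :: "'a::t2_space chart set \<Rightarrow> 'a \<Rightarrow> 'a vfield set" where
  "K_fibre M p = {V \<in> zero_vector_fields M. \<exists>x. bdf M x \<and> dlog M x V p = 0}"

definition K_perp :: "'a::t2_space chart set \<Rightarrow> 'a metric_field \<Rightarrow> 'a \<Rightarrow> 'a vfield set" where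
  "K_perp M g p = {V \<in> zero_vector_fields M. \<forall>W\<in>K_fibre M p. zero_metric M g V W p = 0}"

text \<open>Positive orthonormal bases of the 0-tangent space at a boundary point. Away from the boundary
  the 0-tangent space is the tangent space; by continuity, \<open>x v\<^sub>1, \<dots>, x v\<^sub>4\<close> is a positive
  basis at \<open>p\<close> iff \<open>v\<^sub>1, \<dots>, v\<^sub>4\<close> is. (The indices \<open>1,2,3,4\<close> exhaust the type \<open>4\<close>,
  in which \<open>4 = 0\<close>; likewise for the type \<open>3\<close>.)\<close>

definition zero_frame ::
    "'a::t2_space chart set \<Rightarrow> 'a metric_field \<Rightarrow> 'a \<Rightarrow> (4 \<Rightarrow> 'a vfield) \<Rightarrow> bool" where
  "zero_frame M g p e \<longleftrightarrow> (\<forall>i. e i \<in> zero_vector_fields M) \<and>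
     (\<forall>i j. zero_metric M g (e i) (e j) p = (if i = j then 1 else 0)) \<and>
     (\<exists>x v. bdf M x \<and> (\<forall>i. v i \<in> vector_fields M \<and> e i = vf_scale x (v i)) \<and>
        positive_basis M p (\<lambda>i. v i p))"

text \<open>Positive orthonormal bases of \<open>K\<close> at \<open>p\<close>, for the orientation induced from the boundary by
  \<open>v \<mapsto> x v\<close>; the boundary has the outward-normal-first orientation, and a tangent vector \<open>n\<close> is
  outward pointing iff \<open>n x < 0\<close>. That the \<open>v i\<close> are tangent to the boundary at \<open>p\<close> follows from
  \<open>e i \<in> K_fibre M p\<close>.\<close>

definition K_frame ::
    "'a::t2_space chart set \<Rightarrow> 'a metric_field \<Rightarrow> 'a \<Rightarrow> (3 \<Rightarrow> 'a vfield) \<Rightarrow> bool" where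
  "K_frame M g p e \<longleftrightarrow> (\<forall>i. e i \<in> K_fibre M p) \<and>
     (\<forall>i j. zero_metric M g (e i) (e j) p = (if i = j then 1 else 0)) \<and>
     (\<exists>x v n. bdf M x \<and> (\<forall>i. v i \<in> vector_fields M \<and> e i = vf_scale x (v i)) \<and>
        n \<in> tangent_space M p \<and> n x < 0 \<and>
        positive_basis M p (\<lambda>i. if i = 1 then n else if i = 2 then v 1 p
                                else if i = 3 then v 2 p else v 3 p))"

definition K_coords ::
    "'a::t2_space chart set \<Rightarrow> 'a metric_field \<Rightarrow> 'a \<Rightarrow> (3 \<Rightarrow> 'a vfield) \<Rightarrow> 'a vfield \<Rightarrow> real^3" where
  "K_coords M g p e V = (\<chi> i. zero_metric M g V (e i) p)"

text \<open>\<open>U\<close> represents the cross product of \<open>V\<close> and \<open>W\<close> in the fibre of \<open>K\<close> at \<open>p\<close>.\<close>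

definition K_cross ::
    "'a::t2_space chart set \<Rightarrow> 'a metric_field \<Rightarrow> 'a \<Rightarrow> 'a vfield \<Rightarrow> 'a vfield \<Rightarrow> 'a vfield \<Rightarrow> bool" where
  "K_cross M g p V W U \<longleftrightarrow> V \<in> K_fibre M p \<and> W \<in> K_fibre M p \<and> U \<in> K_fibre M p \<and>
     (\<exists>e. K_frame M g p e \<and>
        K_coords M g p e U = cross3 (K_coords M g p e V) (K_coords M g p e W))"

section \<open>SU(2) vector bundles\<close>

definition conj_transpose :: "complex^2^2 \<Rightarrow> complex^2^2" where
  "conj_transpose T = (\<chi> i j. cnj (T $ j $ i))"

definition SU2 :: "(complex^2^2) set" where
  "SU2 = {T. conj_transpose T ** T = mat 1 \<and> det T = 1}"

definition su2 :: "(complex^2^2) set" where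
  "su2 = {T. conj_transpose T = - T \<and> trace T = 0}"

text \<open>The fibre at each point is a 2-dimensional Hermitian vector space with a unit complex volume
  form, and we identify it with \<open>complex^2\<close> by an SU(2) isomorphism chosen separately at each point,
  with no continuity in the point. The topology and the smooth structure are carried by the local
  trivialisations \<open>(U, \<tau>)\<close>, where \<open>\<tau> p\<close> maps the fibre at \<open>p\<close> to \<open>complex^2\<close> and need not depend
  continuously on \<open>p\<close>; only the transition functions are smooth. This loses no generality: for an
  arbitrary SU(2) cocycle \<open>g i j\<close> over a cover \<open>U i\<close>, choose \<open>k p\<close> with \<open>p \<in> U (k p)\<close> and take
  \<open>\<tau> i p = g i (k p) p\<close>.\<close>

type_synonym 'a trivialisations = "('a set \<times> ('a \<Rightarrow> complex^2^2)) set"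

type_synonym 'a bsection = "'a \<Rightarrow> complex^2"

definition su2_bundle :: "'a::t2_space chart set \<Rightarrow> 'a trivialisations \<Rightarrow> bool" where
  "su2_bundle M E \<longleftrightarrow>
     (\<Union>(U, \<tau>)\<in>E. U) = UNIV \<and>
     (\<forall>(U, \<tau>)\<in>E. open U \<and> (\<forall>p\<in>U. \<tau> p \<in> SU2)) \<and>
     (\<forall>(U, \<tau>)\<in>E. \<forall>(U', \<tau>')\<in>E.
        smooth_fun_on M (U \<inter> U') (\<lambda>p. \<tau>' p ** matrix_inv (\<tau> p)))"

definition smooth_sections :: "'a::t2_space chart set \<Rightarrow> 'a trivialisations \<Rightarrow> 'a bsection set" where
  "smooth_sections M E = {s. \<forall>(U, \<tau>)\<in>E. smooth_fun_on M U (\<lambda>p. \<tau> p *v s p)}"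

definition hermitian :: "complex^2 \<Rightarrow> complex^2 \<Rightarrow> complex" where
  "hermitian u w = (\<Sum>i\<in>UNIV. u $ i * cnj (w $ i))"

definition complex_volume :: "complex^2 \<Rightarrow> complex^2 \<Rightarrow> complex" where
  "complex_volume u w = u $ 1 * w $ 2 - u $ 2 * w $ 1"

definition complex_derivative :: "'a tangent \<Rightarrow> ('a \<Rightarrow> complex) \<Rightarrow> complex" where
  "complex_derivative v f = Complex (v (\<lambda>q. Re (f q))) (v (\<lambda>q. Im (f q)))"

section \<open>Connections, residue and curvature\<close>

type_synonym 'a connection = "'a vfield \<Rightarrow> 'a bsection \<Rightarrow> 'a bsection"

text \<open>SU(2) connections differentiating along the vector fields in the module \<open>\<V>\<close>: all smooth
  vector fields for ordinary connections, and 0-vector fields for 0-connections.\<close>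

definition su2_connection_along ::
    "'a::t2_space chart set \<Rightarrow> 'a trivialisations \<Rightarrow> 'a vfield set \<Rightarrow> 'a connection \<Rightarrow> bool" where
  "su2_connection_along M E \<V> A \<longleftrightarrow>
     (\<forall>V\<in>\<V>. \<forall>s\<in>smooth_sections M E. A V s \<in> smooth_sections M E) \<and>
     (\<forall>V\<in>\<V>. \<forall>W\<in>\<V>. \<forall>s\<in>smooth_sections M E.
        A (vf_add V W) s = (\<lambda>p. A V s p + A W s p)) \<and>
     (\<forall>V\<in>\<V>. \<forall>f\<in>smooth_functions M. \<forall>s\<in>smooth_sections M E.
        A (vf_scale f V) s = (\<lambda>p. f p *\<^sub>R A V s p)) \<and>
     (\<forall>V\<in>\<V>. \<forall>s\<in>smooth_sections M E. \<forall>t\<in>smooth_sections M E. \<forall>a b.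
        A V (\<lambda>p. a *\<^sub>R s p + b *\<^sub>R t p) = (\<lambda>p. a *\<^sub>R A V s p + b *\<^sub>R A V t p)) \<and>
     (\<forall>V\<in>\<V>. \<forall>f\<in>smooth_functions M. \<forall>s\<in>smooth_sections M E.
        A V (\<lambda>p. f p *\<^sub>R s p) = (\<lambda>p. V p f *\<^sub>R s p + f p *\<^sub>R A V s p)) \<and>
     (\<forall>V\<in>\<V>. \<forall>s\<in>smooth_sections M E.
        A V (\<lambda>p. \<i> *s s p) = (\<lambda>p. \<i> *s A V s p)) \<and>
     (\<forall>V\<in>\<V>. \<forall>s\<in>smooth_sections M E. \<forall>t\<in>smooth_sections M E. \<forall>p.
        complex_derivative (V p) (\<lambda>q. hermitian (s q) (t q)) =
          hermitian (A V s p) (t p) + hermitian (s p) (A V t p) \<and>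
        complex_derivative (V p) (\<lambda>q. complex_volume (s q) (t q)) =
          complex_volume (A V s p) (t p) + complex_volume (s p) (A V t p))"

definition su2_connection :: "'a::t2_space chart set \<Rightarrow> 'a trivialisations \<Rightarrow> 'a connection \<Rightarrow> bool" where
  "su2_connection M E D \<longleftrightarrow> su2_connection_along M E (vector_fields M) D"

definition su2_zero_connection :: "'a::t2_space chart set \<Rightarrow> 'a trivialisations \<Rightarrow> 'a connection \<Rightarrow> bool" where
  "su2_zero_connection M E A \<longleftrightarrow> su2_connection_along M E (zero_vector_fields M) A"

text \<open>\<open>endo_at M E p L\<close> is the endomorphism of the fibre at \<open>p\<close> induced by an operator \<open>L\<close> on
  sections which is linear over the smooth functions.\<close>

definition endo_at ::
    "'a::t2_space chart set \<Rightarrow> 'a trivialisations \<Rightarrow> 'a \<Rightarrow> ('a bsection \<Rightarrow> 'a bsection) \<Rightarrow> complex^2^2" where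
  "endo_at M E p L = (THE T. \<forall>s\<in>smooth_sections M E. L s p = T *v s p)"

definition residue ::
    "'a::t2_space chart set \<Rightarrow> 'a trivialisations \<Rightarrow> 'a connection \<Rightarrow> 'a vfield \<Rightarrow> 'a \<Rightarrow> complex^2^2" where
  "residue M E A V p =
     (let D = (SOME D. su2_connection M E D) in endo_at M E p (\<lambda>s q. A V s q - D V s q))"

text \<open>Since 0-vector fields are closed under the Lie bracket, the usual formula for the curvature
  on 0-vector fields makes sense, and gives the smooth extension, up to the boundary.\<close>

definition curvature ::
    "'a::t2_space chart set \<Rightarrow> 'a trivialisations \<Rightarrow> 'a connection \<Rightarrow> 'a \<Rightarrow> 'a vfield \<Rightarrow> 'a vfield \<Rightarrow> complex^2^2" where
  "curvature M E A p V W =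
     endo_at M E p (\<lambda>s q. A V (A W s) q - A W (A V s) q - A (lie_bracket M V W) s q)"

section \<open>Boundary conditions\<close>

definition adapted_at_infinity ::
    "'a::t2_space chart set \<Rightarrow> 'a metric_field \<Rightarrow> 'a trivialisations \<Rightarrow> 'a connection \<Rightarrow> bool" where
  "adapted_at_infinity M g E A \<longleftrightarrow>
     (\<forall>p\<in>bdry M. \<forall>V\<in>K_perp M g p. residue M E A V p = 0)"

text \<open>The residue is linear on each fibre, so it is injective on \<open>K\<close> at \<open>p\<close> iff only the zero
  element of the fibre, i.e. \<open>zero_null M p\<close>, is mapped to \<open>0\<close>.\<close>

definition nahm_pole ::
    "'a::t2_space chart set \<Rightarrow> 'a metric_field \<Rightarrow> 'a trivialisations \<Rightarrow> 'a connection \<Rightarrow> bool" where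
  "nahm_pole M g E A \<longleftrightarrow> adapted_at_infinity M g E A \<and>
     (\<forall>p\<in>bdry M.
        (\<lambda>V. residue M E A V p) ` K_fibre M p = su2 \<and>
        (\<forall>V\<in>K_fibre M p. residue M E A V p = 0 \<longrightarrow> V \<in> zero_null M p) \<and>
        (\<forall>V W U. K_cross M g p V W U \<longrightarrow>
           residue M E A U p =
             residue M E A V p ** residue M E A W p - residue M E A W p ** residue M E A V p))"

text \<open>The Hodge star on (matrix-valued) 2-forms on the 0-tangent space at a boundary point:
  \<open>\<star>\<omega>(V, W) = 1/2 \<Sum> \<epsilon>\<^sub>i\<^sub>j\<^sub>k\<^sub>l \<omega>(e\<^sub>i, e\<^sub>j) g(e\<^sub>k, V) g(e\<^sub>l, W)\<close> for a positive orthonormal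
  basis, so that \<open>\<star>(e\<^sup>1 \<and> e\<^sup>2) = e\<^sup>3 \<and> e\<^sup>4\<close>.\<close>

definition hodge_star ::
    "'a::t2_space chart set \<Rightarrow> 'a metric_field \<Rightarrow> 'a \<Rightarrow> ('a vfield \<Rightarrow> 'a vfield \<Rightarrow> complex^2^2)
       \<Rightarrow> 'a vfield \<Rightarrow> 'a vfield \<Rightarrow> complex^2^2" where
  "hodge_star M g p \<omega> V W =
     (let e = (SOME e. zero_frame M g p e) in
       (1/2) *\<^sub>R (\<Sum>\<pi> | \<pi> permutes (UNIV :: 4 set).
          (of_int (sign \<pi>) * zero_metric M g (e (\<pi> 3)) V p * zero_metric M g (e (\<pi> 4)) W p)
            *\<^sub>R \<omega> (e (\<pi> 1)) (e (\<pi> 2))))"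

definition curvature_minus ::
    "'a::t2_space chart set \<Rightarrow> 'a metric_field \<Rightarrow> 'a trivialisations \<Rightarrow> 'a connection
       \<Rightarrow> 'a \<Rightarrow> 'a vfield \<Rightarrow> 'a vfield \<Rightarrow> complex^2^2" where
  "curvature_minus M g E A p V W =
     (1/2) *\<^sub>R (curvature M E A p V W - hodge_star M g p (curvature M E A p) V W)"

definition asymptotically_self_dual ::
    "'a::t2_space chart set \<Rightarrow> 'a metric_field \<Rightarrow> 'a trivialisations \<Rightarrow> 'a connection \<Rightarrow> bool" where
  "asymptotically_self_dual M g E A \<longleftrightarrow>
     (\<forall>p\<in>bdry M. \<forall>V\<in>zero_vector_fields M. \<forall>W\<in>zero_vector_fields M.
        curvature_minus M g E A p V W = 0)"

end

theory Submission
  imports Defs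
begin

text \<open>Write a 0-vector field as \<open>V = x V'\<close> with \<open>V'\<close> smooth up to the boundary. At a boundary point
  the 0-connection is the residue \<open>R\<close>, and \<open>[V, W] = (V' x) W - (W' x) V\<close> up to terms that vanish
  there, so the curvature is \<open>F(V, W) = [R V, R W] - (V' x) R W + (W' x) R V\<close>. Let \<open>n\<close> be the
  outward unit normal, so \<open>n' x = -1\<close> and \<open>R n = 0\<close> since \<open>A\<close> is adapted, and let \<open>(n, k\<^sub>1, k\<^sub>2, k\<^sub>3)\<close> be
  a positive orthonormal frame with \<open>k\<^sub>i\<close> in \<open>K\<close>. Then \<open>F(n, k\<^sub>1) = R k\<^sub>1\<close> and
  \<open>F(k\<^sub>2, k\<^sub>3) = [R k\<^sub>2, R k\<^sub>3]\<close>, so \<open>F\<close> is self-dual at the point iff \<open>R\<close> restricted to \<open>K\<close> is a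
  homomorphism of Lie algebras. As \<open>K\<close> is simple, such a homomorphism is zero or an isomorphism, and
  in the second case it is a fixed multiple of an isometry; by continuity the points of the first kind form an
  open and closed subset of the boundary.\<close>

section \<open>Linear algebra in dimension four\<close>

text \<open>The shape of the proof is dictated by choices hidden in the definitions. The Hodge star
  uses an unknown orthonormal frame, while the argument needs one that contains the outward normal.
  The two are related by multiplication with a unit quaternion on the side that fixes the
  anti-self-dual forms, so the three equations expressing \<open>F^- = 0\<close> keep their form,
  and independence of the star from the frame need not be shown. The residue uses an unknown
  ordinary connection, which makes the existence of one part of the proof. The 0-metric and
  \<open>dx/x\<close> are definite descriptions, which rest on division by \<open>x\<close> and on
  density of the interior. Everything at a boundary point is then read through
  \<open>V = x V'\<close>, with ordinary tangent vectors and the compactified metric. The obstacle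
  to the open and closed argument is that a nonzero residue might tend to zero. The bracket
  relations exclude this because they are linear on one side and quadratic on the other, which fixes
  the size of a nonzero solution: \<open>|R V|^2\<close> is half the squared length of the component
  of \<open>V\<close> in \<open>K\<close>.\<close>

lemma sum_permutations_4:
  fixes G :: "4 \<Rightarrow> 4 \<Rightarrow> 4 \<Rightarrow> 4 \<Rightarrow> 'v::real_vector"
  shows "(\<Sum>\<pi> | \<pi> permutes (UNIV :: 4 set). of_int (sign \<pi>) *\<^sub>R G (\<pi> 1) (\<pi> 2) (\<pi> 3) (\<pi> 4)) =
    G 1 2 3 4 - G 1 2 4 3 - G 1 3 2 4 + G 1 3 4 2 + G 1 4 2 3 - G 1 4 3 2
    - G 2 1 3 4 + G 2 1 4 3 + G 2 3 1 4 - G 2 3 4 1 - G 2 4 1 3 + G 2 4 3 1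
    + G 3 1 2 4 - G 3 1 4 2 - G 3 2 1 4 + G 3 2 4 1 + G 3 4 1 2 - G 3 4 2 1
    - G 4 1 2 3 + G 4 1 3 2 + G 4 2 1 3 - G 4 2 3 1 - G 4 3 1 2 + G 4 3 2 1"
proof -
  have f: "finite {2::4, 3, 4}" "1 \<notin> {2::4, 3, 4}" "finite {3::4, 4}" "2 \<notin> {3::4, 4}"
    "finite {4::4}" "3 \<notin> {4::4}" by auto
  show ?thesis
    \<comment> \<open>A permutation is a transposition moving one chosen point, composed with a
      permutation of the others; peeling off 1, 2 and 3 in turn leaves the 24 explicit
      terms.\<close>
    unfolding UNIV_4
    unfolding sum_over_permutations_insert[OF f(1,2)]
    unfolding sum_over_permutations_insert[OF f(3,4)]
    unfolding sum_over_permutations_insert[OF f(5,6)]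
    unfolding permutes_sing
    by (simp add: sign_swap_id permutation_swap_id permutation_compose sign_compose sign_id transpose_def)
qed

lemma det_4:
  fixes A :: "real^4^4"
  shows "det A =
    (let G = (\<lambda>i j k l. A$1$i * A$2$j * A$3$k * A$4$l) in
    G 1 2 3 4 - G 1 2 4 3 - G 1 3 2 4 + G 1 3 4 2 + G 1 4 2 3 - G 1 4 3 2
    - G 2 1 3 4 + G 2 1 4 3 + G 2 3 1 4 - G 2 3 4 1 - G 2 4 1 3 + G 2 4 3 1
    + G 3 1 2 4 - G 3 1 4 2 - G 3 2 1 4 + G 3 2 4 1 + G 3 4 1 2 - G 3 4 2 1
    - G 4 1 2 3 + G 4 1 3 2 + G 4 2 1 3 - G 4 2 3 1 - G 4 3 1 2 + G 4 3 2 1)"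
proof -
  have "prod (\<lambda>i. A $ i $ \<pi> i) UNIV = A$1$\<pi> 1 * A$2$\<pi> 2 * A$3$\<pi> 3 * A$4$\<pi> 4" for \<pi>
    unfolding UNIV_4 by (simp add: mult.assoc)
  then have "det A = (\<Sum>\<pi> | \<pi> permutes UNIV. of_int (sign \<pi>) *\<^sub>R
      (A$1$\<pi> 1 * A$2$\<pi> 2 * A$3$\<pi> 3 * A$4$\<pi> 4))"
    by (simp add: det_def)
  then show ?thesis
    by (simp only: sum_permutations_4[of "\<lambda>i j k l. A$1$i * A$2$j * A$3$k * A$4$l"] Let_def)
qed

text \<open>If \<open>k\<close> and \<open>l\<close> are the coordinates of two vectors in a
  positive orthonormal frame, the left side is a 2-form minus its Hodge star, that is, twice its
  anti-self-dual part. The right side pairs the three anti-self-dual coordinates of the form with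
  those of the bivector of \<open>k\<close> and \<open>l\<close>, so the part vanishes exactly when
  three differences of components do.\<close>

lemma hodge_4:
  fixes F :: "4 \<Rightarrow> 4 \<Rightarrow> 'v::real_vector"
  assumes F: "\<And>i j. F j i = - F i j"
  shows "(\<Sum>i\<in>UNIV. \<Sum>j\<in>UNIV. (k i * l j) *\<^sub>R F i j)
      - (1/2) *\<^sub>R (\<Sum>\<pi> | \<pi> permutes (UNIV :: 4 set). (of_int (sign \<pi>) * k (\<pi> 3) * l (\<pi> 4)) *\<^sub>R F (\<pi> 1) (\<pi> 2)) =
    (k 1 * l 2 - k 2 * l 1 - (k 3 * l 4 - k 4 * l 3)) *\<^sub>R (F 1 2 - F 3 4) +
    (k 1 * l 3 - k 3 * l 1 - (k 4 * l 2 - k 2 * l 4)) *\<^sub>R (F 1 3 - F 4 2) +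
    (k 1 * l 4 - k 4 * l 1 - (k 2 * l 3 - k 3 * l 2)) *\<^sub>R (F 1 4 - F 2 3)"
proof -
  have F0: "F i i = 0" for i
  proof -
    have "2 *\<^sub>R F i i = 0" using F[of i i] by (metis scaleR_2 add.right_inverse)
    then show ?thesis by simp
  qed
  let ?S = "\<Sum>\<pi> | \<pi> permutes (UNIV :: 4 set). (of_int (sign \<pi>) * k (\<pi> 3) * l (\<pi> 4)) *\<^sub>R F (\<pi> 1) (\<pi> 2)"
  \<comment> \<open>Exchanging the values at 1 and 2 changes both the sign of the permutation and
    that of \<open>F\<close>, so the 24 terms coincide in pairs; this is what the factor 1/2 in the
    Hodge star compensates.\<close>
  let ?X = "(k 1 * l 2 - k 2 * l 1) *\<^sub>R F 3 4 + (k 3 * l 4 - k 4 * l 3) *\<^sub>R F 1 2 +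
    (k 1 * l 3 - k 3 * l 1) *\<^sub>R F 4 2 + (k 4 * l 2 - k 2 * l 4) *\<^sub>R F 1 3 +
    (k 1 * l 4 - k 4 * l 1) *\<^sub>R F 2 3 + (k 2 * l 3 - k 3 * l 2) *\<^sub>R F 1 4"
  have "?S = (\<Sum>\<pi> | \<pi> permutes (UNIV :: 4 set). of_int (sign \<pi>) *\<^sub>R
      ((k (\<pi> 3) * l (\<pi> 4)) *\<^sub>R F (\<pi> 1) (\<pi> 2)))"
    by (simp add: mult.assoc)
  also have "\<dots> = ?X + ?X"
    unfolding sum_permutations_4[of "\<lambda>i j m n. (k m * l n) *\<^sub>R F i j"]
    by (simp add: F[of 1 2] F[of 1 3] F[of 1 4] F[of 2 3] F[of 4 2] F[of 3 4] algebra_simps)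
  finally have "(1/2) *\<^sub>R ?S = ?X"
    by (simp flip: scaleR_2)
  then show ?thesis
    by (simp add: sum_4 F0 F[of 1 2] F[of 1 3] F[of 1 4] F[of 2 3] F[of 4 2] F[of 3 4] algebra_simps)
qed

text \<open>\<open>iso_frame n\<close> is multiplication by the unit quaternion \<open>n\<close> on the side which acts trivially on
  anti-self-dual forms; its first vector is \<open>n\<close>.\<close>

definition iso_frame :: "real^4 \<Rightarrow> 4 \<Rightarrow> 4 \<Rightarrow> real" where
  "iso_frame n i j =
    (if i = 1 then n $ j
     else if i = 2 then (if j = 1 then - n$2 else if j = 2 then n$1 else if j = 3 then n$4 else - n$3)
     else if i = 3 then (if j = 1 then - n$3 else if j = 2 then - n$4 else if j = 3 then n$1 else n$2)
     else (if j = 1 then - n$4 else if j = 2 then n$3 else if j = 3 then - n$2 else n$1))"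

lemma norm_4: "(norm (n::real^4))\<^sup>2 = n$1 * n$1 + n$2 * n$2 + n$3 * n$3 + n$4 * n$4"
  by (simp add: power2_norm_eq_inner inner_vec_def sum_4)

lemma iso_frame_orthonormal:
  assumes "norm n = 1"
  shows "(\<Sum>k\<in>UNIV. iso_frame n i k * iso_frame n j k) = (if i = j then 1 else 0)"
proof -
  have 1: "n$1 * n$1 + n$2 * n$2 + n$3 * n$3 + n$4 * n$4 = 1"
    using norm_4[of n] assms by simp
  have "\<forall>i j. (\<Sum>k\<in>UNIV. iso_frame n i k * iso_frame n j k) = (if i = j then 1 else 0)"
    using 1 unfolding forall_4 by (simp add: iso_frame_def sum_4)
  then show ?thesis by blast
qed

text \<open>Multiplication by a quaternion has as determinant the fourth power of its norm.\<close>

lemma iso_frame_det: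
  assumes "norm n = 1"
  shows "det (\<chi> i j. iso_frame n i j) = 1"
proof -
  have 1: "n$1 * n$1 + n$2 * n$2 + n$3 * n$3 + n$4 * n$4 = 1"
    using norm_4[of n] assms by simp
  have "det (\<chi> i j. iso_frame n i j) = (n$1 * n$1 + n$2 * n$2 + n$3 * n$3 + n$4 * n$4)\<^sup>2"
    unfolding det_4 Let_def by (simp add: iso_frame_def) algebra
  then show ?thesis using 1 by simp
qed

text \<open>The rotations of real 4-space are generated by left and right multiplications by unit
  quaternions; one kind acts trivially on self-dual forms, the other on anti-self-dual ones. Hence
  the three anti-self-dual coordinates are literally equal in both frames, not only related by a
  rotation, and the equations found in an arbitrary frame can be copied to the rotated one.\<close>

lemma iso_frame_asd:
  fixes F :: "4 \<Rightarrow> 4 \<Rightarrow> 'v::real_vector"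
  assumes F: "\<And>i j. F j i = - F i j" and n: "norm n = 1"
  defines "G \<equiv> \<lambda>i j. \<Sum>a\<in>UNIV. \<Sum>b\<in>UNIV. (iso_frame n i a * iso_frame n j b) *\<^sub>R F a b"
  shows "G 1 2 - G 3 4 = F 1 2 - F 3 4" "G 1 3 - G 4 2 = F 1 3 - F 4 2" "G 1 4 - G 2 3 = F 1 4 - F 2 3"
proof -
  have F0: "F i i = 0" for i
  proof -
    have "2 *\<^sub>R F i i = 0" using F[of i i] by (metis scaleR_2 add.right_inverse)
    then show ?thesis by simp
  qed
  have 1: "n$1 * n$1 + n$2 * n$2 + n$3 * n$3 + n$4 * n$4 = 1"
    using norm_4[of n] n by simp
  \<comment> \<open>The left sides are quadratic in \<open>n\<close> and the right sides constant;
    inserting the factor \<open>|n|^2 = 1\<close> makes both sides the same polynomial.\<close>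
  have e: "x = (n$1 * n$1 + n$2 * n$2 + n$3 * n$3 + n$4 * n$4) *\<^sub>R x" for x :: 'v using 1 by simp
  show "G 1 2 - G 3 4 = F 1 2 - F 3 4"
    by (subst e[of "F 1 2 - F 3 4"])
      (simp add: G_def iso_frame_def sum_4 F0 F[of 1 2] F[of 1 3] F[of 1 4] F[of 2 3] F[of 4 2] F[of 3 4] algebra_simps)
  show "G 1 3 - G 4 2 = F 1 3 - F 4 2"
    by (subst e[of "F 1 3 - F 4 2"])
      (simp add: G_def iso_frame_def sum_4 F0 F[of 1 2] F[of 1 3] F[of 1 4] F[of 2 3] F[of 4 2] F[of 3 4] algebra_simps)
  show "G 1 4 - G 2 3 = F 1 4 - F 2 3"
    by (subst e[of "F 1 4 - F 2 3"])
      (simp add: G_def iso_frame_def sum_4 F0 F[of 1 2] F[of 1 3] F[of 1 4] F[of 2 3] F[of 4 2] F[of 3 4] algebra_simps)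
qed

text \<open>Three linear conditions on real 4-space always have a common nonzero solution, so a unit
  vector orthogonal to up to three earlier ones exists; vectors not yet chosen may be replaced by
  anything.\<close>

lemma pos_def_orthonormal:
  fixes B :: "real^4 \<Rightarrow> real^4 \<Rightarrow> real"
  assumes B: "bilinear B" and sym: "\<And>u w. B u w = B w u" and pos: "\<And>u. u \<noteq> 0 \<Longrightarrow> B u u > 0"
  obtains C :: "4 \<Rightarrow> real^4" where "\<And>i j. B (C i) (C j) = (if i = j then 1 else 0)"
proof -
  have step: "\<exists>w. B w w = 1 \<and> B w u1 = 0 \<and> B w u2 = 0 \<and> B w u3 = 0" for u1 u2 u3
  proof -
    \<comment> \<open>The zero in the fourth place makes the three conditions an endomorphism that
      is visibly not surjective, hence not injective.\<close>
    define F where "F = (\<lambda>w. (\<chi> i. if i = 1 then B w u1 else if i = 2 then B w u2 else if i = 3 then B w u3 else 0) :: real^4)"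
    have F: "linear F"
      unfolding F_def
      by (rule linearI) (auto simp: vec_eq_iff bilinear_ladd[OF B] bilinear_lmul[OF B])
    have "\<not> surj F"
    proof
      assume "surj F"
      then obtain w where "axis 4 1 = F w" by (metis surjD)
      then have "(1::real) = F w $ 4" by (metis axis_nth)
      then show False by (simp add: F_def)
    qed
    then have "\<not> inj F" using linear_injective_imp_surjective[OF F] by blast
    then obtain w where w: "w \<noteq> 0" "F w = 0" using linear_injective_0[OF F] by blast
    have 0: "B w u1 = 0" "B w u2 = 0" "B w u3 = 0"
      using w(2) by (auto simp: F_def vec_eq_iff forall_4)
    define c where "c = 1 / sqrt (B w w)"
    have p: "B w w > 0" using pos w(1) by blast
    have "c * c * B w w = 1" using p by (simp add: c_def field_simps)
    then have "B (c *\<^sub>R w) (c *\<^sub>R w) = 1"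
      by (simp add: bilinear_lmul[OF B] bilinear_rmul[OF B])
    moreover have "B (c *\<^sub>R w) u1 = 0" "B (c *\<^sub>R w) u2 = 0" "B (c *\<^sub>R w) u3 = 0"
      using 0 by (simp_all add: bilinear_lmul[OF B])
    ultimately show ?thesis by blast
  qed
  obtain w1 where 1: "B w1 w1 = 1" using step by blast
  obtain w2 where 2: "B w2 w2 = 1" "B w2 w1 = 0" using step by blast
  obtain w3 where 3: "B w3 w3 = 1" "B w3 w1 = 0" "B w3 w2 = 0" using step by blast
  obtain w4 where 4: "B w4 w4 = 1" "B w4 w1 = 0" "B w4 w2 = 0" "B w4 w3 = 0" using step by blast
  define C where "C = (\<lambda>i::4. if i = 1 then w1 else if i = 2 then w2 else if i = 3 then w3 else w4)"
  have "\<forall>i j. B (C i) (C j) = (if i = j then 1 else 0)"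
    unfolding forall_4 by (simp add: C_def 1 2 3 4 sym[of w1 w2] sym[of w1 w3] sym[of w1 w4] sym[of w2 w3] sym[of w2 w4] sym[of w3 w4])
  then show ?thesis using that by blast
qed

text \<open>The standard basis goes to \<open>i\<close> times the Pauli matrices in the order 3, 2,
  1. With this order and sign the commutator is twice the cross product, and the entrywise squared
  norm is twice the Euclidean one.\<close>

definition su2_of :: "real^3 \<Rightarrow> complex^2^2" where
  "su2_of u = (\<chi> i j. if i = 1 then (if j = 1 then Complex 0 (u$1) else Complex (u$2) (u$3))
     else (if j = 1 then Complex (- u$2) (u$3) else Complex 0 (- u$1)))"

lemma su2_of_linear: "su2_of (u + w) = su2_of u + su2_of w" "su2_of (c *\<^sub>R u) = c *\<^sub>R su2_of u"
  by (auto simp: su2_of_def vec_eq_iff complex_eq_iff)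

lemma su2_of_0: "su2_of 0 = 0"
  by (simp add: su2_of_def vec_eq_iff complex_eq_iff)

lemma su2_of_inj: "su2_of u = su2_of w \<longleftrightarrow> u = w"
  by (auto simp: su2_of_def vec_eq_iff complex_eq_iff forall_2 forall_3)

lemma su2_of_surj:
  assumes "T \<in> su2"
  obtains u where "T = su2_of u"
proof
  have T: "cnj (T$j$i) = - T$i$j" "T$1$1 + T$2$2 = 0" for i j
    using assms by (auto simp: su2_def conj_transpose_def trace_def sum_2 vec_eq_iff)
  show "T = su2_of (vector [Im (T$1$1), Re (T$1$2), Im (T$1$2)])"
    using T(1)[of 1 1] T(1)[of 1 2] T(1)[of 2 2] T(2)
    by (auto simp: su2_of_def vec_eq_iff complex_eq_iff forall_2)
qed

lemma su2_of_commutator: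
  "su2_of u ** su2_of w - su2_of w ** su2_of u = su2_of (2 *\<^sub>R cross3 u w)"
  by (simp add: su2_of_def vec_eq_iff forall_2 matrix_matrix_mult_def sum_2 complex_eq_iff cross3_simps)

lemma norm_su2_of: "(norm (su2_of u))\<^sup>2 = 2 * (norm u)\<^sup>2"
proof -
  have n: "(norm v)\<^sup>2 = (\<Sum>i\<in>UNIV. (norm (v $ i))\<^sup>2)" for v :: "'b::real_normed_vector^'n::finite"
    by (simp add: norm_vec_def L2_set_def sum_nonneg)
  show ?thesis
    by (simp add: n sum_2 sum_3 su2_of_def cmod_power2)
qed

text \<open>In real 3-space the relations read \<open>t1 = 2 (t2 x t3)\<close> and cyclically. They
  force the three vectors to be orthogonal and of equal length. Comparing the lengths of both sides
  then leaves only length 0 or 1/2: the relations have no small nonzero solutions. In the nonzero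
  case the triple is, up to a scale factor, an orthonormal basis of su(2).\<close>

lemma su2_triple:
  assumes T: "T 1 \<in> su2" "T 2 \<in> su2" "T 3 \<in> su2"
    and c: "T 1 = T 2 ** T 3 - T 3 ** T 2" "T 2 = T 3 ** T 1 - T 1 ** T 3" "T 3 = T 1 ** T 2 - T 2 ** T 1"
    and ne: "\<exists>i::3. T i \<noteq> 0"
  shows "(norm (\<Sum>i\<in>UNIV. (c$i) *\<^sub>R T i))\<^sup>2 = (norm c)\<^sup>2 / 2"
    and "S \<in> su2 \<Longrightarrow> \<exists>c. S = (\<Sum>i\<in>UNIV. (c$i) *\<^sub>R T i)"
proof -
  obtain t1 t2 t3 where t: "T 1 = su2_of t1" "T 2 = su2_of t2" "T 3 = su2_of t3"
    using su2_of_surj T by metis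
  note x = c[unfolded t su2_of_commutator su2_of_inj]
  \<comment> \<open>The triple product is invariant under cyclic permutation, so it expresses all
    three squared lengths at once, each being \<open>2 * D\<close>.\<close>
  define D where "D = t1 \<bullet> cross3 t2 t3"
  have "t1 \<bullet> t2 = 0" by (simp add: x(1) dot_cross_self)
  moreover have "t1 \<bullet> t3 = 0" by (simp add: x(1) dot_cross_self)
  moreover have "t2 \<bullet> t3 = 0" by (simp add: x(2) dot_cross_self)
  ultimately have o: "t1 \<bullet> t2 = 0" "t1 \<bullet> t3 = 0" "t2 \<bullet> t3 = 0" by blast+
  have n: "t1 \<bullet> t1 = 2 * D" "t2 \<bullet> t2 = 2 * D" "t3 \<bullet> t3 = 2 * D"
  proof -
    show "t1 \<bullet> t1 = 2 * D" unfolding D_def by (subst (2) x(1)) simp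
    show "t2 \<bullet> t2 = 2 * D" unfolding D_def by (subst (2) x(2)) (simp add: cross3_simps)
    show "t3 \<bullet> t3 = 2 * D" unfolding D_def by (subst (2) x(3)) (simp add: cross3_simps)
  qed
  have "t1 \<bullet> t1 = 4 * (norm (cross3 t2 t3))\<^sup>2"
    by (subst (1 2) x(1)) (simp add: power2_norm_eq_inner)
  also have "\<dots> = 4 * ((t2 \<bullet> t2) * (t3 \<bullet> t3))"
    using norm_cross_dot[of t2 t3] o by (simp add: power_mult_distrib power2_norm_eq_inner)
  finally have "2 * D = 4 * (2 * D * (2 * D))" using n by simp
  then have "D = 0 \<or> D = 1 / 8" by (simp add: field_simps)
  moreover have "D \<noteq> 0"
  proof
    assume "D = 0"
    then have "t1 = 0" "t2 = 0" "t3 = 0" using n by auto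
    then have "T i = 0" for i using t su2_of_0 exhaust_3[of i] by auto
    then show False using ne by blast
  qed
  ultimately have D: "D = 1 / 8" by blast
  \<comment> \<open>For \<open>D = 1 / 8\<close> each vector has length 1/2, so the doubled vectors
    are the rows of an orthogonal matrix.\<close>
  define Q :: "real^3^3" where "Q = (\<chi> i. if i = 1 then 2 *\<^sub>R t1 else if i = 2 then 2 *\<^sub>R t2 else 2 *\<^sub>R t3)"
  have QQ: "Q ** transpose Q = mat 1"
    using o n D by (simp add: vec_eq_iff forall_3 matrix_matrix_mult_def transpose_def mat_def Q_def inner_vec_def sum_3 algebra_simps)
  then have Q: "transpose Q ** Q = mat 1"
    by (simp add: matrix_left_right_inverse)
  have comb: "(\<Sum>i\<in>UNIV. (c$i) *\<^sub>R T i) = su2_of ((1/2) *\<^sub>R (transpose Q *v c))" for c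
  proof -
    have "(\<Sum>i\<in>UNIV. (c$i) *\<^sub>R T i) = su2_of ((c$1) *\<^sub>R t1 + (c$2) *\<^sub>R t2 + (c$3) *\<^sub>R t3)"
      by (simp add: sum_3 t su2_of_linear)
    also have "(c$1) *\<^sub>R t1 + (c$2) *\<^sub>R t2 + (c$3) *\<^sub>R t3 = (1/2) *\<^sub>R (transpose Q *v c)"
      by (simp add: vec_eq_iff matrix_vector_mult_def transpose_def Q_def sum_3)
    finally show ?thesis .
  qed
  have "(transpose Q *v c) \<bullet> (transpose Q *v c) = c \<bullet> (Q *v (transpose Q *v c))"
    by (subst (1) transpose_matrix_vector) (rule dot_lmul_matrix)
  then have "norm (transpose Q *v c) = norm c"
    by (simp only: norm_eq matrix_vector_mul_assoc QQ matrix_vector_mul_lid)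
  then show "(norm (\<Sum>i\<in>UNIV. (c$i) *\<^sub>R T i))\<^sup>2 = (norm c)\<^sup>2 / 2"
    unfolding comb norm_su2_of by (simp add: power_mult_distrib power_divide)
  assume "S \<in> su2"
  then obtain u where u: "S = su2_of u" by (rule su2_of_surj)
  have "u = (1/2) *\<^sub>R (transpose Q *v (Q *v (2 *\<^sub>R u)))"
    using Q by (simp add: matrix_vector_mul_assoc matrix_vector_mult_scaleR)
  then show "\<exists>c. S = (\<Sum>i\<in>UNIV. (c$i) *\<^sub>R T i)"
    unfolding comb u by metis
qed

section \<open>Calculus of smooth functions\<close>

definition smooth_on :: "'v::real_normed_vector set \<Rightarrow> ('v \<Rightarrow> 'b::real_normed_vector) \<Rightarrow> bool" where
  "smooth_on S f \<longleftrightarrow> (\<forall>k. cont_diff_on k S f)"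

lemma cont_diff_on_SucI:
  assumes "open S" "\<And>x. x \<in> S \<Longrightarrow> (f has_derivative f' x) (at x)"
    and "\<And>v. cont_diff_on k S (\<lambda>x. frechet_derivative f (at x) v)"
  shows "cont_diff_on (Suc k) S f"
  using assms by (auto simp: differentiable_def)

lemma cont_diff_on_cong:
  assumes "open S" "\<And>x. x \<in> S \<Longrightarrow> f x = g x" "cont_diff_on k S f"
  shows "cont_diff_on k S g"
  using assms(2,3)
proof (induction k arbitrary: f g)
  case 0
  then show ?case by (simp cong: continuous_on_cong)
next
  case (Suc k)
  have d: "f differentiable (at x)" if "x \<in> S" for x
    using Suc.prems(2) that by simp
  have dg: "g differentiable (at x)" if "x \<in> S" for x
    using d[OF that] Suc.prems(1) assms(1) that
    unfolding differentiable_def by (metis has_derivative_transform_within_open)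
  have eq: "frechet_derivative f (at x) = frechet_derivative g (at x)" if "x \<in> S" for x
    using frechet_derivative_transform_within_open[OF d[OF that] assms(1) that] Suc.prems(1) by blast
  have "cont_diff_on k S (\<lambda>x. frechet_derivative g (at x) v)" for v
    by (rule Suc.IH[of "\<lambda>x. frechet_derivative f (at x) v"]) (use Suc.prems(2) eq in simp_all)
  then show ?case
    using dg by simp
qed

text \<open>Lets an explicit formula for the derivative take the place of
  \<open>frechet_derivative\<close>, so that the inductions below work with the usual rules of
  calculus.\<close>

lemma cont_diff_on_SucI':
  assumes "open S" "\<And>x. x \<in> S \<Longrightarrow> (f has_derivative f' x) (at x)"
    and "\<And>v. cont_diff_on k S (\<lambda>x. f' x v)"
  shows "cont_diff_on (Suc k) S f"
proof (rule cont_diff_on_SucI[OF assms(1,2)])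
  fix v
  show "cont_diff_on k S (\<lambda>x. frechet_derivative f (at x) v)"
    by (rule cont_diff_on_cong[OF assms(1) _ assms(3)]) (simp add: frechet_derivative_at[OF assms(2)])
qed

lemma cont_diff_on_SucD: "cont_diff_on (Suc k) S f \<Longrightarrow> cont_diff_on k S f"
proof (induction k arbitrary: f)
  case 0
  then show ?case
    by (auto intro!: continuous_at_imp_continuous_on differentiable_imp_continuous_within)
next
  case (Suc k)
  then show ?case by auto
qed

lemma cont_diff_on_has_derivative:
  "cont_diff_on (Suc k) S f \<Longrightarrow> x \<in> S \<Longrightarrow> (f has_derivative frechet_derivative f (at x)) (at x)"
  by (simp add: frechet_derivative_works)

lemma cont_diff_on_subset: "cont_diff_on k S f \<Longrightarrow> T \<subseteq> S \<Longrightarrow> cont_diff_on k T f"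
  by (induction k arbitrary: f) (auto intro: continuous_on_subset)

lemma cont_diff_on_const: "open S \<Longrightarrow> cont_diff_on k S (\<lambda>x. c)"
proof (induction k arbitrary: c)
  case (Suc k)
  show ?case by (rule cont_diff_on_SucI'[OF Suc.prems, of _ "\<lambda>x v. 0"]) (auto intro: Suc)
qed auto

lemma cont_diff_on_add:
  "open S \<Longrightarrow> cont_diff_on k S f \<Longrightarrow> cont_diff_on k S g \<Longrightarrow> cont_diff_on k S (\<lambda>x. f x + g x)"
proof (induction k arbitrary: f g)
  case (Suc k)
  show ?case
  proof (rule cont_diff_on_SucI'[OF Suc.prems(1)
        has_derivative_add[OF cont_diff_on_has_derivative[OF Suc.prems(2)] cont_diff_on_has_derivative[OF Suc.prems(3)]]])
    fix v
    show "cont_diff_on k S (\<lambda>x. frechet_derivative f (at x) v + frechet_derivative g (at x) v)"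
      using Suc.prems by (intro Suc.IH) simp_all
  qed
qed (simp add: continuous_on_add)

lemma cont_diff_on_bounded_bilinear:
  assumes B: "bounded_bilinear B" and S: "open S"
  shows "cont_diff_on k S f \<Longrightarrow> cont_diff_on k S g \<Longrightarrow> cont_diff_on k S (\<lambda>x. B (f x) (g x))"
proof (induction k arbitrary: f g)
  case 0
  then show ?case by (auto intro: bounded_bilinear.continuous_on[OF B])
next
  case (Suc k)
  show ?case
  proof (rule cont_diff_on_SucI'[OF S bounded_bilinear.FDERIV[OF B cont_diff_on_has_derivative[OF Suc.prems(1)] cont_diff_on_has_derivative[OF Suc.prems(2)]]])
    fix v
    show "cont_diff_on k S (\<lambda>x. B (f x) (frechet_derivative g (at x) v) + B (frechet_derivative f (at x) v) (g x))"
      using Suc.prems by (intro cont_diff_on_add[OF S] Suc.IH) (auto intro: cont_diff_on_SucD)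
  qed
qed

lemma cont_diff_on_bounded_linear:
  assumes B: "bounded_linear B" and S: "open S"
  shows "cont_diff_on k S f \<Longrightarrow> cont_diff_on k S (\<lambda>x. B (f x))"
proof (induction k arbitrary: f)
  case 0
  then show ?case by (auto intro: bounded_linear.continuous_on[OF B])
next
  case (Suc k)
  show ?case
  proof (rule cont_diff_on_SucI'[OF S bounded_linear.has_derivative[OF B cont_diff_on_has_derivative[OF Suc.prems(1)]]])
    fix v
    show "cont_diff_on k S (\<lambda>x. B (frechet_derivative f (at x) v))"
      using Suc.prems by (intro Suc.IH) simp_all
  qed
qed

lemma cont_diff_on_sum:
  "open S \<Longrightarrow> (\<And>i. i \<in> I \<Longrightarrow> cont_diff_on k S (f i)) \<Longrightarrow> cont_diff_on k S (\<lambda>x. \<Sum>i\<in>I. f i x)"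
  by (induction I rule: infinite_finite_induct) (auto intro: cont_diff_on_const cont_diff_on_add)

lemma cont_diff_on_ident: "open S \<Longrightarrow> cont_diff_on k S (\<lambda>x. x)"
proof (cases k)
  case (Suc j)
  assume "open S"
  show ?thesis unfolding Suc
    by (rule cont_diff_on_SucI'[OF \<open>open S\<close>, of _ "\<lambda>x v. v"]) (auto intro: cont_diff_on_const \<open>open S\<close>)
qed auto

text \<open>The chain rule is written as a sum over a basis of the intermediate space. The
  derivative in a fixed direction is then a sum of products of real functions with functions of the
  form \<open>f' (g x)\<close>, for which the product rule and the induction hypothesis suffice;
  operator-valued derivatives never occur.\<close>

lemma cont_diff_on_compose:
  fixes g :: "'v::real_normed_vector \<Rightarrow> 'w::euclidean_space"
  assumes S: "open S" and T: "open T" and gST: "\<And>x. x \<in> S \<Longrightarrow> g x \<in> T"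
  shows "cont_diff_on k T f \<Longrightarrow> cont_diff_on k S g \<Longrightarrow> cont_diff_on k S (\<lambda>x. f (g x))"
proof (induction k arbitrary: f)
  case 0
  then show ?case using gST by (auto intro: continuous_on_compose2)
next
  case (Suc k)
  have der: "((\<lambda>x. f (g x)) has_derivative
      (\<lambda>v. \<Sum>b\<in>Basis. (frechet_derivative g (at x) v \<bullet> b) *\<^sub>R frechet_derivative f (at (g x)) b)) (at x)"
    if x: "x \<in> S" for x
  proof -
    have f': "(f has_derivative frechet_derivative f (at (g x))) (at (g x))"
      using cont_diff_on_has_derivative[OF Suc.prems(1)] gST x by blast
    have lin: "linear (frechet_derivative f (at (g x)))"
      using f' has_derivative_linear by blast
    have "frechet_derivative f (at (g x)) w = (\<Sum>b\<in>Basis. (w \<bullet> b) *\<^sub>R frechet_derivative f (at (g x)) b)" for w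
      by (subst euclidean_representation[symmetric, of w]) (simp only: linear_sum[OF lin] linear_scale[OF lin])
    then show ?thesis
      by (intro has_derivative_eq_rhs[OF has_derivative_compose[OF cont_diff_on_has_derivative[OF Suc.prems(2) x] f']] ext)
  qed
  show ?case
  proof (rule cont_diff_on_SucI'[OF S der])
    fix v
    show "cont_diff_on k S (\<lambda>x. \<Sum>b\<in>Basis. (frechet_derivative g (at x) v \<bullet> b) *\<^sub>R frechet_derivative f (at (g x)) b)"
    proof (intro cont_diff_on_sum[OF S] cont_diff_on_bounded_bilinear[OF bounded_bilinear_scaleR S])
      fix b :: 'w
      show "cont_diff_on k S (\<lambda>x. frechet_derivative g (at x) v \<bullet> b)"
        using Suc.prems(2) by (intro cont_diff_on_bounded_linear[OF bounded_linear_inner_left S]) auto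
      show "cont_diff_on k S (\<lambda>x. frechet_derivative f (at (g x)) b)"
        using Suc.prems by (intro Suc.IH) (auto intro: cont_diff_on_SucD)
    qed
  qed auto
qed

lemma smooth_on_frechet_derivative:
  "smooth_on S f \<Longrightarrow> smooth_on S (\<lambda>x. frechet_derivative f (at x) v)"
  unfolding smooth_on_def by (metis cont_diff_on.simps(2))

lemma smooth_on_has_derivative:
  "smooth_on S f \<Longrightarrow> x \<in> S \<Longrightarrow> (f has_derivative frechet_derivative f (at x)) (at x)"
  unfolding smooth_on_def using cont_diff_on_has_derivative by blast

lemma smooth_on_continuous: "smooth_on S f \<Longrightarrow> continuous_on S f"
  unfolding smooth_on_def by (metis cont_diff_on.simps(1))

lemma smooth_on_subset: "smooth_on S f \<Longrightarrow> T \<subseteq> S \<Longrightarrow> smooth_on T f"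
  unfolding smooth_on_def using cont_diff_on_subset by blast

lemma smooth_on_const: "open S \<Longrightarrow> smooth_on S (\<lambda>x. c)"
  unfolding smooth_on_def using cont_diff_on_const by blast

lemma smooth_on_add: "open S \<Longrightarrow> smooth_on S f \<Longrightarrow> smooth_on S g \<Longrightarrow> smooth_on S (\<lambda>x. f x + g x)"
  unfolding smooth_on_def using cont_diff_on_add by blast

lemma smooth_on_bounded_bilinear:
  "bounded_bilinear B \<Longrightarrow> open S \<Longrightarrow> smooth_on S f \<Longrightarrow> smooth_on S g \<Longrightarrow> smooth_on S (\<lambda>x. B (f x) (g x))"
  unfolding smooth_on_def using cont_diff_on_bounded_bilinear by blast

lemma smooth_on_bounded_linear:
  "bounded_linear B \<Longrightarrow> open S \<Longrightarrow> smooth_on S f \<Longrightarrow> smooth_on S (\<lambda>x. B (f x))"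
  unfolding smooth_on_def using cont_diff_on_bounded_linear by blast

lemma smooth_on_ident: "open S \<Longrightarrow> smooth_on S (\<lambda>x. x)"
  unfolding smooth_on_def using cont_diff_on_ident by blast

lemma smooth_on_compose:
  fixes g :: "'v::real_normed_vector \<Rightarrow> 'w::euclidean_space"
  shows "open S \<Longrightarrow> open T \<Longrightarrow> (\<And>x. x \<in> S \<Longrightarrow> g x \<in> T) \<Longrightarrow> smooth_on T f \<Longrightarrow> smooth_on S g
    \<Longrightarrow> smooth_on S (\<lambda>x. f (g x))"
  unfolding smooth_on_def using cont_diff_on_compose by blast

text \<open>The derivative is minus the square of the function itself, so the induction closes under
  products.\<close>

lemma smooth_on_inverse: "smooth_on {0<..} (inverse :: real \<Rightarrow> real)"
proof -
  have "cont_diff_on k {0<..} (inverse :: real \<Rightarrow> real)" for k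
  proof (induction k)
    case 0
    then show ?case by (auto intro!: continuous_intros)
  next
    case (Suc k)
    show ?case
    proof (rule cont_diff_on_SucI')
      show "(inverse has_derivative (\<lambda>v. - (inverse x * v * inverse x))) (at x)" if "x \<in> {0<..}" for x :: real
        using that by (intro has_derivative_inverse') auto
      show "cont_diff_on k {0<..} (\<lambda>x::real. - (inverse x * v * inverse x))" for v
        using cont_diff_on_bounded_linear[OF bounded_linear_mult_right _ cont_diff_on_bounded_bilinear[OF bounded_bilinear_mult _ Suc Suc], of "-v"]
        by (simp add: algebra_simps)
    qed auto
  qed
  then show ?thesis by (simp add: smooth_on_def)
qed

text \<open>Hadamard's lemma is needed for two kinds of contraction \<open>z \<mapsto> P z + t (z - P z)\<close>: towards a
  point and towards a hyperplane.\<close>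

lemma smooth_on_contraction_integral:
  fixes H :: "'v::euclidean_space \<Rightarrow> real" and L :: "'v \<Rightarrow> 'v" and c :: 'v
  assumes W: "open W" "convex W" and L: "linear L" and P: "\<And>z. z \<in> W \<Longrightarrow> c + L z \<in> W"
    and H: "smooth_on W H"
  shows "smooth_on W (\<lambda>z. integral {0..1} (\<lambda>t. H (c + L z + t *\<^sub>R (z - (c + L z)))))"
proof -
  define S where "S = (\<lambda>t z. c + L z + t *\<^sub>R (z - (c + L z)))"
  define S' where "S' = (\<lambda>t v. L v + t *\<^sub>R (v - L v))"
  have bl: "bounded_linear L" using L linear_conv_bounded_linear by blast
  have S_in: "S t z \<in> W" if "z \<in> W" "t \<in> {0..1}" for t z
  proof -
    have "S t z = (1 - t) *\<^sub>R (c + L z) + t *\<^sub>R z" by (simp add: S_def algebra_simps)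
    then show ?thesis using W(2) P[OF that(1)] that by (simp add: convexD)
  qed
  have S_der: "(S t has_derivative S' t) (at z)" for t z
    unfolding S_def S'_def
    by (auto intro!: derivative_eq_intros bounded_linear.has_derivative[OF bl] simp: algebra_simps)
  have S_cont: "continuous_on (W \<times> {0..1}) (\<lambda>(z, t). S t z)"
    unfolding S_def case_prod_unfold
    by (intro continuous_intros bounded_linear.continuous_on[OF bl])
  have S_cont1: "continuous_on {0..1} (\<lambda>t. S t z)" for z
    unfolding S_def by (intro continuous_intros)
  \<comment> \<open>The weight \<open>t ^ m\<close> has to be part of the induction: differentiating
    \<open>S t\<close> in direction \<open>v\<close> gives \<open>L v + t (v - L v)\<close>, which
    raises the exponent in one of the two resulting integrals.\<close>
  have "cont_diff_on k W (\<lambda>z. integral {0..1} (\<lambda>t. t ^ m * H (S t z)))" if "smooth_on W H" for k m H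
    using that
  proof (induction k arbitrary: H m)
    case (0 H m)
    have "continuous_on (W \<times> cbox 0 1) (\<lambda>(z, t). t ^ m * H (S t z))"
      unfolding case_prod_unfold
      by (intro continuous_intros continuous_on_compose2[OF smooth_on_continuous[OF 0]])
        (use S_cont S_in in \<open>auto simp: case_prod_unfold\<close>)
    then show ?case
      using integral_continuous_on_param[of W 0 "1::real" "\<lambda>z t. t ^ m * H (S t z)"] by simp
  next
    case (Suc k H m)
    define D where "D = (\<lambda>t z. frechet_derivative H (at (S t z)))"
    have H': "(H has_derivative frechet_derivative H (at z)) (at z)" if "z \<in> W" for z
      using smooth_on_has_derivative[OF Suc.prems that] .
    have linD: "linear (D t z)" if "z \<in> W" "t \<in> {0..1}" for t z
      unfolding D_def using H'[OF S_in[OF that]] has_derivative_linear by blast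
    \<comment> \<open>Differentiation under the integral needs the derivative as a bounded linear
      map depending continuously on both variables. In finite dimension this can be checked for each
      direction separately.\<close>
    define fx where "fx = (\<lambda>z t. Blinfun (\<lambda>v. t ^ m * D t z (S' t v)))"
    have der: "((\<lambda>z. t ^ m * H (S t z)) has_derivative (\<lambda>v. t ^ m * D t z (S' t v))) (at z)"
      if "z \<in> W" "t \<in> {0..1}" for t z
      unfolding D_def
      by (intro has_derivative_mult_right has_derivative_compose[OF S_der H'] S_in that)
    have fx: "blinfun_apply (fx z t) = (\<lambda>v. t ^ m * D t z (S' t v))" if "z \<in> W" "t \<in> {0..1}" for t z
      unfolding fx_def using der[OF that] by (simp add: bounded_linear_Blinfun_apply has_derivative_bounded_linear)
    have contD: "continuous_on (W \<times> {0..1}) (\<lambda>(z, t). D t z v)" for v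
      unfolding D_def case_prod_unfold
      by (intro continuous_on_compose2[OF smooth_on_continuous[OF smooth_on_frechet_derivative[OF Suc.prems]]])
        (use S_cont S_in in \<open>auto simp: case_prod_unfold\<close>)
    have Dexp: "t ^ m * D t z (S' t v) = t ^ m * D t z (L v) + t ^ Suc m * D t z (v - L v)"
      if "z \<in> W" "t \<in> {0..1}" for t z v
      using linD[OF that] by (simp add: S'_def linear_add linear_scale linear_diff algebra_simps)
    have contfx: "continuous_on (W \<times> cbox 0 1) (\<lambda>(z, t). fx z t)"
    proof (rule continuous_on_blinfun_componentwise)
      fix v :: 'v
      have "continuous_on (W \<times> {0..1}) (\<lambda>q. (snd q) ^ m * (\<lambda>(z, t). D t z (L v)) q
          + (snd q) ^ Suc m * (\<lambda>(z, t). D t z (v - L v)) q)"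
        by (intro continuous_intros contD)
      then show "continuous_on (W \<times> cbox 0 1) (\<lambda>q. blinfun_apply (case q of (z, t) \<Rightarrow> fx z t) v)"
        unfolding cbox_interval by (rule continuous_on_eq) (auto simp: fx Dexp simp del: power_Suc)
    qed
    have contm: "continuous_on {0..1} (\<lambda>t. t ^ j * H' (S t z))" if "z \<in> W" "continuous_on W H'" for z j H'
      by (intro continuous_intros continuous_on_compose2[OF that(2) S_cont1]) (use S_in that in auto)
    have intD: "(\<lambda>t. t ^ j * D t z v) integrable_on {0..1}" if "z \<in> W" for z j v
      unfolding D_def
      by (intro integrable_continuous_interval contm[OF that, of "\<lambda>y. frechet_derivative H (at y) v"]
          smooth_on_continuous[OF smooth_on_frechet_derivative[OF Suc.prems]])
    have int: "(integral (cbox 0 1) (fx z)) v =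
        integral {0..1} (\<lambda>t. t ^ m * D t z (L v)) + integral {0..1} (\<lambda>t. t ^ Suc m * D t z (v - L v))"
      if z: "z \<in> W" for z v
    proof -
      have "continuous_on (cbox 0 1) (\<lambda>t. case (z, t) of (z, t) \<Rightarrow> fx z t)"
        by (rule continuous_on_compose2[OF contfx continuous_on_Pair[OF continuous_on_const continuous_on_id]])
          (use z in auto)
      then have "continuous_on (cbox 0 1) (fx z)"
        by simp
      then have "(integral (cbox 0 1) (fx z)) v = integral (cbox 0 1) (\<lambda>t. fx z t v)"
        by (intro blinfun_apply_integral integrable_continuous)
      also have "\<dots> = integral {0..1} (\<lambda>t. t ^ m * D t z (L v) + t ^ Suc m * D t z (v - L v))"
        using z by (auto intro!: integral_cong simp: fx Dexp simp del: power_Suc)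
      also have "\<dots> = integral {0..1} (\<lambda>t. t ^ m * D t z (L v)) + integral {0..1} (\<lambda>t. t ^ Suc m * D t z (v - L v))"
        by (intro integral_add intD z)
      finally show ?thesis .
    qed
    show ?case
    proof (rule cont_diff_on_SucI'[OF W(1)])
      fix z assume z: "z \<in> W"
      have "((\<lambda>z. integral (cbox 0 1) (\<lambda>t. t ^ m * H (S t z))) has_derivative
          blinfun_apply (integral (cbox 0 1) (fx z))) (at z within W)"
      proof (rule leibniz_rule[OF _ _ contfx z W(2)])
        show "((\<lambda>x. t ^ m * H (S t x)) has_derivative blinfun_apply (fx x t)) (at x within W)"
          if "x \<in> W" "t \<in> cbox 0 1" for x t
          using der[of x t] that fx[of x t] by (auto intro: has_derivative_at_withinI)
        show "(\<lambda>t. t ^ m * H (S t x)) integrable_on cbox 0 1" if "x \<in> W" for x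
          using contm[OF that smooth_on_continuous[OF Suc.prems], of m]
          by (auto intro: integrable_continuous_interval)
      qed
      then show "((\<lambda>z. integral {0..1} (\<lambda>t. t ^ m * H (S t z))) has_derivative
          blinfun_apply (integral (cbox 0 1) (fx z))) (at z)"
        by (simp only: at_within_open[OF z W(1)] cbox_interval)
    next
      fix v
      have "cont_diff_on k W (\<lambda>z. integral {0..1} (\<lambda>t. t ^ m * D t z (L v)) + integral {0..1} (\<lambda>t. t ^ Suc m * D t z (v - L v)))"
        unfolding D_def
        by (intro cont_diff_on_add[OF W(1)]
            Suc.IH[of "\<lambda>y. frechet_derivative H (at y) w" for w] smooth_on_frechet_derivative[OF Suc.prems])
      then show "cont_diff_on k W (\<lambda>z. (integral (cbox 0 1) (fx z)) v)"
        by (rule cont_diff_on_cong[OF W(1), rotated]) (simp only: int)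
    qed
  qed
  from this[OF H, of _ 0] show ?thesis by (simp add: smooth_on_def S_def)
qed

text \<open>Integrate the derivative of \<open>f\<close> along the segment from
  \<open>c + L z\<close> to \<open>z\<close>; \<open>G b\<close> is the mean of the partial
  derivative over it. \<open>L = 0\<close> contracts to the point \<open>c\<close>, which yields the
  coordinate form of derivations; \<open>c = 0\<close> with \<open>L\<close> a projection contracts
  to a hyperplane, which yields division by a boundary coordinate.\<close>

lemma smooth_on_Hadamard:
  fixes f :: "'v::euclidean_space \<Rightarrow> real" and L :: "'v \<Rightarrow> 'v" and c :: 'v
  assumes W: "open W" "convex W" and L: "linear L" and P: "\<And>z. z \<in> W \<Longrightarrow> c + L z \<in> W"
    and f: "smooth_on W f"
  obtains G where "\<And>b. b \<in> Basis \<Longrightarrow> smooth_on W (G b)"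
    "\<And>z. z \<in> W \<Longrightarrow> f z = f (c + L z) + (\<Sum>b\<in>Basis. ((z - (c + L z)) \<bullet> b) * G b z)"
    "\<And>z b. z \<in> W \<Longrightarrow> c + L z = z \<Longrightarrow> G b z = frechet_derivative f (at z) b"
proof
  define G where "G = (\<lambda>b z. integral {0..1} (\<lambda>t. frechet_derivative f (at (c + L z + t *\<^sub>R (z - (c + L z)))) b))"
  show "smooth_on W (G b)" for b
    unfolding G_def
    by (rule smooth_on_contraction_integral[OF W L P smooth_on_frechet_derivative[OF f]])
  show "G b z = frechet_derivative f (at z) b" if "z \<in> W" "c + L z = z" for z b
    unfolding G_def by (simp add: that)
  fix z assume z: "z \<in> W"
  define S where "S = (\<lambda>t. c + L z + t *\<^sub>R (z - (c + L z)))"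
  have S_in: "S t \<in> W" if "t \<in> {0..1}" for t
  proof -
    have "S t = (1 - t) *\<^sub>R (c + L z) + t *\<^sub>R z" by (simp add: S_def algebra_simps)
    then show ?thesis using W(2) P[OF z] z that by (simp add: convexD)
  qed
  have Sd: "(S has_vector_derivative (z - (c + L z))) (at t within {0..1})" for t
    unfolding S_def by (auto intro!: derivative_eq_intros)
  have "((\<lambda>t. frechet_derivative f (at (S t)) (z - (c + L z))) has_integral f (S 1) - f (S 0)) {0..1}"
  proof (rule fundamental_theorem_of_calculus)
    fix t :: real assume t: "t \<in> {0..1}"
    have f': "(f has_derivative frechet_derivative f (at (S t))) (at (S t))"
      using smooth_on_has_derivative[OF f S_in[OF t]] .
    show "((\<lambda>t. f (S t)) has_vector_derivative frechet_derivative f (at (S t)) (z - (c + L z))) (at t within {0..1})"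
      using vector_derivative_diff_chain_within[OF Sd has_derivative_at_withinI[OF f']]
      by (simp add: o_def)
  qed auto
  then have "f z - f (c + L z) = integral {0..1} (\<lambda>t. frechet_derivative f (at (S t)) (z - (c + L z)))"
    by (simp add: integral_unique S_def)
  also have "\<dots> = integral {0..1} (\<lambda>t. \<Sum>b\<in>Basis. ((z - (c + L z)) \<bullet> b) * frechet_derivative f (at (S t)) b)"
  proof (rule integral_cong)
    fix t :: real assume t: "t \<in> {0..1}"
    have lin: "linear (frechet_derivative f (at (S t)))"
      using smooth_on_has_derivative[OF f S_in[OF t]] has_derivative_linear by blast
    show "frechet_derivative f (at (S t)) (z - (c + L z)) =
        (\<Sum>b\<in>Basis. ((z - (c + L z)) \<bullet> b) * frechet_derivative f (at (S t)) b)"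
      by (subst euclidean_representation[symmetric, of "z - (c + L z)"])
        (simp only: linear_sum[OF lin] linear_scale[OF lin] real_scaleR_def)
  qed
  also have "\<dots> = (\<Sum>b\<in>Basis. ((z - (c + L z)) \<bullet> b) * G b z)"
  proof -
    have c: "continuous_on {0..1} (\<lambda>t. frechet_derivative f (at (S t)) b)" for b
    proof (rule continuous_on_compose2[OF smooth_on_continuous[OF smooth_on_frechet_derivative[OF f]]])
      show "continuous_on {0..1} S" unfolding S_def by (intro continuous_intros)
    qed (use S_in in auto)
    show ?thesis
      unfolding G_def S_def[THEN fun_cong, symmetric]
      by (subst integral_sum)
        (auto intro!: integrable_continuous_interval continuous_intros c)
  qed
  finally show "f z = f (c + L z) + (\<Sum>b\<in>Basis. ((z - (c + L z)) \<bullet> b) * G b z)" by simp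
qed

section \<open>Bump functions\<close>

lemma exp_neg_inverse_poly_tendsto_0:
  fixes p :: "real poly"
  shows "((\<lambda>t. poly p (1 / t) * exp (- (1 / t))) \<longlongrightarrow> 0) (at_right 0)"
proof -
  have m: "((\<lambda>x::real. x ^ n * exp (- x)) \<longlongrightarrow> 0) at_top" for n
    using tendsto_power_div_exp_0[of n] by (simp add: exp_minus field_simps)
  have "((\<lambda>x. poly p x * exp (- x)) \<longlongrightarrow> (\<Sum>i\<le>degree p. coeff p i * 0)) at_top"
    unfolding poly_altdef sum_distrib_right mult.assoc
    by (intro tendsto_sum tendsto_mult_left m)
  then have "((\<lambda>x. poly p x * exp (- x)) \<longlongrightarrow> 0) at_top" by simp
  from filterlim_compose[OF this filterlim_inverse_at_top_right]
  show ?thesis by (simp add: inverse_eq_divide)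
qed

text \<open>The polynomial is a parameter because the derivative of \<open>p(1/t) exp(-1/t)\<close>
  is again of this kind, with \<open>X^2 (p - p')\<close> in place of \<open>p\<close>. One
  induction over all polynomials then gives derivatives of every order, including at the
  origin.\<close>

definition flat_fun :: "real poly \<Rightarrow> real \<Rightarrow> real" where
  "flat_fun p t = (if t > 0 then poly p (1 / t) * exp (- (1 / t)) else 0)"

lemma flat_fun_has_derivative:
  "(flat_fun p has_field_derivative flat_fun ([:0, 0, 1:] * (p - pderiv p)) t) (at t)"
proof -
  consider "t > 0" | "t < 0" | "t = 0" by linarith
  then show ?thesis
  proof cases
    case 1
    have "((\<lambda>t. poly p (1 / t) * exp (- (1 / t))) has_field_derivative
        flat_fun ([:0, 0, 1:] * (p - pderiv p)) t) (at t)"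
      using 1 unfolding flat_fun_def
      by (auto intro!: derivative_eq_intros poly_DERIV[THEN DERIV_chain2] simp: field_simps power2_eq_square)
    then show ?thesis
      by (rule has_field_derivative_transform_within_open[of _ _ _ "{0<..}"]) (use 1 in \<open>auto simp: flat_fun_def\<close>)
  next
    case 2
    have "((\<lambda>t. 0) has_field_derivative flat_fun ([:0, 0, 1:] * (p - pderiv p)) t) (at t)"
      using 2 by (simp add: flat_fun_def)
    then show ?thesis
      by (rule has_field_derivative_transform_within_open[of _ _ _ "{..<0}"]) (use 2 in \<open>auto simp: flat_fun_def\<close>)
  next
    case 3
    have "((\<lambda>h. (flat_fun p (0 + h) - flat_fun p 0) / h) \<longlongrightarrow> 0) (at_left 0)"
      by (rule tendsto_eventually) (auto simp: flat_fun_def eventually_at_left_field intro!: exI[of _ "-1"])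
    moreover have "((\<lambda>h. (flat_fun p (0 + h) - flat_fun p 0) / h) \<longlongrightarrow> 0) (at_right 0)"
      using exp_neg_inverse_poly_tendsto_0[of "[:0, 1:] * p"]
      by (rule Lim_transform_eventually) (auto simp: flat_fun_def eventually_at_right_field intro!: exI[of _ 1])
    ultimately show ?thesis
      using 3 by (simp add: DERIV_def flat_fun_def filterlim_split_at)
  qed
qed

lemma smooth_on_flat_fun: "smooth_on UNIV (flat_fun p)"
proof -
  have "cont_diff_on k UNIV (flat_fun p)" for k
  proof (induction k arbitrary: p)
    case 0
    then show ?case
      using flat_fun_has_derivative by (auto intro!: continuous_at_imp_continuous_on DERIV_isCont)
  next
    case (Suc k)
    show ?case
    proof (rule cont_diff_on_SucI'[OF open_UNIV])
      show "(flat_fun p has_derivative (*) (flat_fun ([:0, 0, 1:] * (p - pderiv p)) t)) (at t)" for t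
        using flat_fun_has_derivative[of p t] by (simp only: has_field_derivative_def)
      show "cont_diff_on k UNIV (\<lambda>t. flat_fun ([:0, 0, 1:] * (p - pderiv p)) t * v)" for v
        by (intro cont_diff_on_bounded_linear[OF bounded_linear_mult_left] Suc) auto
    qed
  qed
  then show ?thesis by (simp add: smooth_on_def)
qed

lemma smooth_step_exists:
  obtains \<sigma> :: "real \<Rightarrow> real" where "smooth_on UNIV \<sigma>" "\<And>t. 0 \<le> \<sigma> t" "\<And>t. t \<le> 0 \<Longrightarrow> \<sigma> t = 0"
    "\<And>t. 1 \<le> t \<Longrightarrow> \<sigma> t = 1"
proof
  define e where "e = flat_fun 1"
  have e: "e t = (if t > 0 then exp (- (1 / t)) else 0)" for t by (simp add: e_def flat_fun_def)
  have e0: "e t \<ge> 0" for t by (simp add: e)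
  \<comment> \<open>\<open>t\<close> and \<open>1 - t\<close> are never both nonpositive, so the
    denominator is positive everywhere.\<close>
  define d where "d = (\<lambda>t. e t + e (1 - t))"
  have d0: "d t > 0" for t by (auto simp: d_def e add_pos_pos)
  define \<sigma> where "\<sigma> = (\<lambda>t. e t * inverse (d t))"
  have se: "smooth_on UNIV e" unfolding e_def by (rule smooth_on_flat_fun)
  have "smooth_on UNIV (\<lambda>t::real. 1 + (- 1) *\<^sub>R t)"
    by (intro smooth_on_add smooth_on_const smooth_on_bounded_linear[OF bounded_linear_scaleR_right] smooth_on_ident) auto
  then have "smooth_on UNIV (\<lambda>t. e (1 - t))"
    using smooth_on_compose[of UNIV UNIV _ e] se by simp
  then have sd: "smooth_on UNIV d"
    unfolding d_def using smooth_on_add se by blast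
  have "smooth_on UNIV (\<lambda>t. inverse (d t))"
    by (rule smooth_on_compose[OF _ _ _ smooth_on_inverse sd]) (use d0 in auto)
  then show "smooth_on UNIV \<sigma>"
    unfolding \<sigma>_def using smooth_on_bounded_bilinear[OF bounded_bilinear_mult open_UNIV se] by blast
  show "0 \<le> \<sigma> t" for t using e0 d0[of t] by (simp add: \<sigma>_def less_imp_le)
  show "\<sigma> t = 0" if "t \<le> 0" for t using that by (simp add: \<sigma>_def e)
  show "\<sigma> t = 1" if "1 \<le> t" for t using that by (simp add: \<sigma>_def d_def e)
qed

lemma smooth_bump_exists:
  fixes p :: "'v::euclidean_space"
  assumes "r > 0"
  obtains \<beta> :: "'v \<Rightarrow> real" where "smooth_on UNIV \<beta>" "\<And>z. 0 \<le> \<beta> z"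
    "\<And>z. dist p z \<le> r / 2 \<Longrightarrow> \<beta> z = 1" "\<And>z. r \<le> dist p z \<Longrightarrow> \<beta> z = 0"
proof -
  obtain \<sigma> :: "real \<Rightarrow> real" where \<sigma>: "smooth_on UNIV \<sigma>" "\<And>t. 0 \<le> \<sigma> t" "\<And>t. t \<le> 0 \<Longrightarrow> \<sigma> t = 0"
    "\<And>t. 1 \<le> t \<Longrightarrow> \<sigma> t = 1" by (rule smooth_step_exists) blast
  define q where "q = (\<lambda>z. (z - p) \<bullet> (z - p))"
  have q: "q z = (dist p z)\<^sup>2" for z by (subst dist_commute) (simp add: q_def dist_norm power2_norm_eq_inner)
  have 1: "smooth_on UNIV (\<lambda>z. z + (- p))" by (intro smooth_on_add smooth_on_const smooth_on_ident) auto
  then have "smooth_on UNIV q"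
    unfolding q_def using smooth_on_bounded_bilinear[OF bounded_bilinear_inner open_UNIV 1 1] by simp
  \<comment> \<open>The affine function of the squared distance that equals 1 at distance
    \<open>r / 2\<close> and 0 at distance \<open>r\<close>; the distance itself would not be smooth
    at the centre.\<close>
  then have 2: "smooth_on UNIV (\<lambda>z. 4 / 3 + (- (4 / (3 * r\<^sup>2))) *\<^sub>R q z)"
    by (intro smooth_on_add smooth_on_const smooth_on_bounded_linear[OF bounded_linear_scaleR_right]) auto
  show ?thesis
  proof
    show "smooth_on UNIV (\<lambda>z. \<sigma> (4 / 3 + (- (4 / (3 * r\<^sup>2))) *\<^sub>R q z))"
      by (rule smooth_on_compose[OF _ _ _ \<sigma>(1) 2]) auto
    fix z :: 'v
    show "0 \<le> \<sigma> (4 / 3 + (- (4 / (3 * r\<^sup>2))) *\<^sub>R q z)" by (rule \<sigma>)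
    show "\<sigma> (4 / 3 + (- (4 / (3 * r\<^sup>2))) *\<^sub>R q z) = 1" if "dist p z \<le> r / 2"
    proof (rule \<sigma>(4))
      have "(dist p z)\<^sup>2 \<le> (r / 2)\<^sup>2" using that by (intro power_mono) auto
      then show "1 \<le> 4 / 3 + - (4 / (3 * r\<^sup>2)) *\<^sub>R q z"
        using assms by (simp add: q field_simps power2_eq_square)
    qed
    show "\<sigma> (4 / 3 + (- (4 / (3 * r\<^sup>2))) *\<^sub>R q z) = 0" if "r \<le> dist p z"
    proof (rule \<sigma>(3))
      have "r\<^sup>2 \<le> (dist p z)\<^sup>2" using that assms by (intro power_mono) auto
      then show "4 / 3 + - (4 / (3 * r\<^sup>2)) *\<^sub>R q z \<le> 0"
        using assms by (simp add: q field_simps power2_eq_square)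
    qed
  qed
qed

section \<open>Smooth functions on manifolds\<close>

text \<open>One chart is enough, since transition maps carry the extension \<open>h\<close> to every
  other chart. As \<open>W\<close> is open in the whole of real 4-space, \<open>h\<close> extends
  the function beyond the half-space at boundary points.\<close>

definition smooth_at :: "'a::t2_space chart set \<Rightarrow> ('a \<Rightarrow> 'b::real_normed_vector) \<Rightarrow> 'a \<Rightarrow> bool" where
  "smooth_at M f p \<longleftrightarrow> (\<exists>(U, \<phi>)\<in>M. \<exists>W h. p \<in> U \<and> open W \<and> \<phi> p \<in> W \<and> smooth_on W h \<and>
     (\<forall>q\<in>U. \<phi> q \<in> W \<longrightarrow> f q = h (\<phi> q)))"

locale compact_manifold =
  fixes M :: "'a::t2_space chart set"
  assumes compact_UNIV: "compact (UNIV :: 'a set)"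
    and manifold: "oriented_manifold_with_boundary M"
begin

lemma chart_exists: obtains U \<phi> where "(U, \<phi>) \<in> M" "p \<in> U"
  using manifold unfolding oriented_manifold_with_boundary_def by (metis (no_types, lifting) UNIV_I UN_E case_prod_conv surj_pair)

context
  fixes U \<phi>
  assumes chart: "(U, \<phi>) \<in> M"
begin

lemma chart_open: "open U"
  and chart_openin: "openin (top_of_set half_space) (\<phi> ` U)"
  and chart_homeomorphism: "homeomorphism U (\<phi> ` U) \<phi> (inv_into U \<phi>)"
  using manifold chart unfolding oriented_manifold_with_boundary_def by auto

lemma chart_continuous: "continuous_on U \<phi>"
  and chart_inverse_continuous: "continuous_on (\<phi> ` U) (inv_into U \<phi>)"
  and chart_inverse: "q \<in> U \<Longrightarrow> inv_into U \<phi> (\<phi> q) = q"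
  using chart_homeomorphism by (auto simp: homeomorphism_def)

lemma chart_inj: "inj_on \<phi> U"
  using chart_inverse by (metis inj_onI)

lemma chart_half_space: "q \<in> U \<Longrightarrow> \<phi> q \<in> half_space"
  using chart_openin by (auto simp: openin_euclidean_subtopology_iff)

lemma chart_isCont: "p \<in> U \<Longrightarrow> isCont \<phi> p"
  using chart_continuous chart_open by (simp add: continuous_on_eq_continuous_at)

lemma chart_nhd:
  assumes "p \<in> U" "open N" "p \<in> N"
  obtains W where "open W" "\<phi> p \<in> W" "\<And>q. q \<in> U \<Longrightarrow> \<phi> q \<in> W \<Longrightarrow> q \<in> N"
proof -
  obtain W where W: "open W" "\<phi> ` U \<inter> inv_into U \<phi> -` N = W \<inter> \<phi> ` U"
    using continuous_openin_preimage_gen[OF chart_inverse_continuous assms(2)]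
    unfolding openin_open by (metis inf_commute)
  show ?thesis
  proof (rule that[OF W(1)])
    have "\<phi> p \<in> \<phi> ` U \<inter> inv_into U \<phi> -` N" using assms chart_inverse by auto
    then show "\<phi> p \<in> W" unfolding W(2) by blast
    show "q \<in> N" if "q \<in> U" "\<phi> q \<in> W" for q
    proof -
      have "\<phi> q \<in> \<phi> ` U \<inter> inv_into U \<phi> -` N" unfolding W(2) using that by blast
      then show ?thesis using chart_inverse that by simp
    qed
  qed
qed

text \<open>A small ball intersected with the half-space lies in the image of the chart; in this
  form interior and boundary points need no separate treatment.\<close>

lemma chart_ball:
  assumes "p \<in> U" "open N" "p \<in> N"
  obtains r where "r > 0" "\<And>z. z \<in> half_space \<Longrightarrow> dist (\<phi> p) z < r \<Longrightarrow> z \<in> \<phi> ` (U \<inter> N)"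
proof -
  obtain W where W: "open W" "\<phi> p \<in> W" "\<And>q. q \<in> U \<Longrightarrow> \<phi> q \<in> W \<Longrightarrow> q \<in> N"
    using chart_nhd[OF assms] by metis
  obtain W' where W': "open W'" "\<phi> ` U = half_space \<inter> W'"
    using chart_openin by (auto simp: openin_open)
  have "open (W \<inter> W')" "\<phi> p \<in> W \<inter> W'" using W W' assms(1) by auto
  then obtain r where r: "r > 0" "ball (\<phi> p) r \<subseteq> W \<inter> W'" by (meson open_contains_ball)
  have "z \<in> \<phi> ` (U \<inter> N)" if "z \<in> half_space" "dist (\<phi> p) z < r" for z
  proof -
    have "z \<in> W \<inter> W'" using r that by auto
    then have "z \<in> \<phi> ` U" using W' that by blast
    then show ?thesis using W(3) \<open>z \<in> W \<inter> W'\<close> by auto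
  qed
  with r(1) show ?thesis using that by blast
qed

end

lemma chart_transition:
  assumes c: "(U, \<phi>) \<in> M" "(U', \<phi>') \<in> M" and p: "p \<in> U" "p \<in> U'"
  obtains W T where "open W" "\<phi> p \<in> W" "smooth_on W T"
    "\<And>q. q \<in> U \<Longrightarrow> \<phi> q \<in> W \<Longrightarrow> q \<in> U' \<and> \<phi>' q = T (\<phi> q)"
proof -
  have "smooth_within (\<phi> ` (U \<inter> U')) (\<phi>' \<circ> inv_into U \<phi>)"
    using manifold c unfolding oriented_manifold_with_boundary_def by fastforce
  then obtain W T where W: "open W" "\<phi> p \<in> W" "smooth_on W T"
    "\<And>y. y \<in> \<phi> ` (U \<inter> U') \<inter> W \<Longrightarrow> T y = (\<phi>' \<circ> inv_into U \<phi>) y"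
    unfolding smooth_within_def smooth_on_def using p by (metis IntI imageI)
  obtain W' where W': "open W'" "\<phi> p \<in> W'" "\<And>q. q \<in> U \<Longrightarrow> \<phi> q \<in> W' \<Longrightarrow> q \<in> U'"
    using chart_nhd[OF c(1) p(1) chart_open[OF c(2)] p(2)] by metis
  show ?thesis
  proof (rule that[of "W \<inter> W'" T])
    show "smooth_on (W \<inter> W') T" using W(3) by (rule smooth_on_subset) auto
    show "q \<in> U' \<and> \<phi>' q = T (\<phi> q)" if "q \<in> U" "\<phi> q \<in> W \<inter> W'" for q
      using W(4)[of "\<phi> q"] W'(3) that chart_inverse[OF c(1)] by auto
  qed (use W W' in auto)
qed

lemma smooth_at_chartI:
  assumes "(U, \<phi>) \<in> M" "p \<in> U" "open W" "\<phi> p \<in> W" "smooth_on W h"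
    "\<And>q. q \<in> U \<Longrightarrow> \<phi> q \<in> W \<Longrightarrow> f q = h (\<phi> q)"
  shows "smooth_at M f p"
  unfolding smooth_at_def using assms by blast

lemma smooth_at_chartE:
  assumes "smooth_at M f p" "(U, \<phi>) \<in> M" "p \<in> U"
  obtains W h where "open W" "\<phi> p \<in> W" "smooth_on W h" "\<And>q. q \<in> U \<Longrightarrow> \<phi> q \<in> W \<Longrightarrow> f q = h (\<phi> q)"
proof -
  obtain U' \<phi>' W' h' where 1: "(U', \<phi>') \<in> M" "p \<in> U'" "open W'" "\<phi>' p \<in> W'" "smooth_on W' h'"
    "\<And>q. q \<in> U' \<Longrightarrow> \<phi>' q \<in> W' \<Longrightarrow> f q = h' (\<phi>' q)"
    using assms(1) unfolding smooth_at_def by blast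
  obtain W T where 2: "open W" "\<phi> p \<in> W" "smooth_on W T"
    "\<And>q. q \<in> U \<Longrightarrow> \<phi> q \<in> W \<Longrightarrow> q \<in> U' \<and> \<phi>' q = T (\<phi> q)"
    using chart_transition[OF assms(2) 1(1) assms(3) 1(2)] by metis
  define V where "V = W \<inter> T -` W'"
  have V: "open V"
    unfolding V_def using continuous_open_preimage[OF smooth_on_continuous[OF 2(3)] 2(1) 1(3)] .
  show ?thesis
  proof (rule that[OF V])
    show "\<phi> p \<in> V" using 1(4) 2(2,4) assms(3) by (auto simp: V_def)
    show "smooth_on V (\<lambda>z. h' (T z))"
      by (rule smooth_on_compose[OF V 1(3) _ 1(5)]) (use smooth_on_subset[OF 2(3)] in \<open>auto simp: V_def\<close>)
    show "f q = h' (T (\<phi> q))" if "q \<in> U" "\<phi> q \<in> V" for q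
      using that 1(6) 2(4) by (auto simp: V_def)
  qed
qed

lemma smooth_at_eventually:
  assumes "smooth_at M f p"
  shows "\<forall>\<^sub>F q in nhds p. smooth_at M f q"
proof -
  obtain U \<phi> where c: "(U, \<phi>) \<in> M" "p \<in> U" by (rule chart_exists)
  obtain W h where W: "open W" "\<phi> p \<in> W" "smooth_on W h" "\<And>q. q \<in> U \<Longrightarrow> \<phi> q \<in> W \<Longrightarrow> f q = h (\<phi> q)"
    using smooth_at_chartE[OF assms c] by metis
  have "open (U \<inter> \<phi> -` W)"
    using continuous_open_preimage[OF chart_continuous[OF c(1)] chart_open[OF c(1)] W(1)] .
  then show ?thesis
    unfolding eventually_nhds
    using c W smooth_at_chartI[OF c(1) _ W(1) _ W(3,4)] by (intro exI[of _ "U \<inter> \<phi> -` W"]) auto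
qed

lemma smooth_at_cong:
  assumes "smooth_at M f p" "\<forall>\<^sub>F q in nhds p. f q = g q"
  shows "smooth_at M g p"
proof -
  obtain U \<phi> where c: "(U, \<phi>) \<in> M" "p \<in> U" by (rule chart_exists)
  obtain W h where W: "open W" "\<phi> p \<in> W" "smooth_on W h" "\<And>q. q \<in> U \<Longrightarrow> \<phi> q \<in> W \<Longrightarrow> f q = h (\<phi> q)"
    using smooth_at_chartE[OF assms(1) c] by metis
  obtain N where N: "open N" "p \<in> N" "\<And>q. q \<in> N \<Longrightarrow> f q = g q"
    using assms(2) by (auto simp: eventually_nhds)
  obtain W' where W': "open W'" "\<phi> p \<in> W'" "\<And>q. q \<in> U \<Longrightarrow> \<phi> q \<in> W' \<Longrightarrow> q \<in> N"
    using chart_nhd[OF c N(1,2)] by metis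
  show ?thesis
    by (rule smooth_at_chartI[OF c, of "W \<inter> W'" h])
      (use W W' N smooth_on_subset[OF W(3)] in \<open>auto simp: N(3)[symmetric]\<close>)
qed

lemma smooth_at_isCont:
  assumes "smooth_at M f p"
  shows "isCont f p"
proof -
  obtain U \<phi> where c: "(U, \<phi>) \<in> M" "p \<in> U" by (rule chart_exists)
  obtain W h where W: "open W" "\<phi> p \<in> W" "smooth_on W h" "\<And>q. q \<in> U \<Longrightarrow> \<phi> q \<in> W \<Longrightarrow> f q = h (\<phi> q)"
    using smooth_at_chartE[OF assms c] by metis
  have "isCont h (\<phi> p)"
    using smooth_on_continuous[OF W(3)] W(1,2) continuous_on_eq_continuous_at by blast
  then have "isCont (\<lambda>q. h (\<phi> q)) p"
    using chart_isCont[OF c] isCont_o2 by blast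
  moreover have "\<forall>\<^sub>F q in nhds p. h (\<phi> q) = f q"
    using continuous_open_preimage[OF chart_continuous[OF c(1)] chart_open[OF c(1)] W(1)] c W
    unfolding eventually_nhds by (intro exI[of _ "U \<inter> \<phi> -` W"]) auto
  ultimately show ?thesis using isCont_cong[of "\<lambda>q. h (\<phi> q)" f p] by simp
qed

lemma smooth_fun_on_iff:
  assumes "open S"
  shows "smooth_fun_on M S f \<longleftrightarrow> (\<forall>p\<in>S. smooth_at M f p)"
proof (intro iffI ballI)
  fix p assume f: "smooth_fun_on M S f" and p: "p \<in> S"
  obtain U \<phi> where c: "(U, \<phi>) \<in> M" "p \<in> U" by (rule chart_exists)
  have "smooth_within (\<phi> ` (U \<inter> S)) (f \<circ> inv_into U \<phi>)"
    using f c(1) unfolding smooth_fun_on_def by blast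
  then obtain W h where W: "open W" "\<phi> p \<in> W" "smooth_on W h"
    "\<And>y. y \<in> \<phi> ` (U \<inter> S) \<inter> W \<Longrightarrow> h y = (f \<circ> inv_into U \<phi>) y"
    unfolding smooth_within_def smooth_on_def using p c by (metis IntI imageI)
  obtain W' where W': "open W'" "\<phi> p \<in> W'" "\<And>q. q \<in> U \<Longrightarrow> \<phi> q \<in> W' \<Longrightarrow> q \<in> S"
    using chart_nhd[OF c assms p] by metis
  show "smooth_at M f p"
  proof (rule smooth_at_chartI[OF c, of "W \<inter> W'" h])
    show "smooth_on (W \<inter> W') h" using W(3) by (rule smooth_on_subset) auto
    show "f q = h (\<phi> q)" if "q \<in> U" "\<phi> q \<in> W \<inter> W'" for q
      using W(4)[of "\<phi> q"] W'(3) that chart_inverse[OF c(1)] by auto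
  qed (use W W' in auto)
next
  assume f: "\<forall>p\<in>S. smooth_at M f p"
  show "smooth_fun_on M S f"
    unfolding smooth_fun_on_def
  proof (intro ballI, clarify)
    fix U \<phi> assume c: "(U, \<phi>) \<in> M"
    show "smooth_within (\<phi> ` (U \<inter> S)) (f \<circ> inv_into U \<phi>)"
      unfolding smooth_within_def smooth_on_def[symmetric]
    proof
      fix z assume "z \<in> \<phi> ` (U \<inter> S)"
      then obtain p where p: "p \<in> U" "p \<in> S" "z = \<phi> p" by auto
      obtain W h where W: "open W" "\<phi> p \<in> W" "smooth_on W h" "\<And>q. q \<in> U \<Longrightarrow> \<phi> q \<in> W \<Longrightarrow> f q = h (\<phi> q)"
        using smooth_at_chartE[OF _ c p(1)] f p(2) by metis
      then show "\<exists>W h. open W \<and> z \<in> W \<and> smooth_on W h \<and> (\<forall>y\<in>\<phi> ` (U \<inter> S) \<inter> W. h y = (f \<circ> inv_into U \<phi>) y)"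
        using p(3) chart_inverse[OF c] by (intro exI[of _ W] exI[of _ h]) auto
    qed
  qed
qed

lemma smooth_functions_iff: "f \<in> smooth_functions M \<longleftrightarrow> (\<forall>p. smooth_at M f p)"
  by (simp add: smooth_functions_def smooth_fun_on_iff)

lemma smooth_at_const: "smooth_at M (\<lambda>q. c) p"
proof -
  obtain U \<phi> where c: "(U, \<phi>) \<in> M" "p \<in> U" by (rule chart_exists)
  show ?thesis by (rule smooth_at_chartI[OF c open_UNIV _ smooth_on_const]) auto
qed

lemma smooth_at_chart: "(U, \<phi>) \<in> M \<Longrightarrow> p \<in> U \<Longrightarrow> smooth_at M \<phi> p"
  by (rule smooth_at_chartI[OF _ _ open_UNIV _ smooth_on_ident]) auto

lemma smooth_at_bounded_linear:
  assumes "bounded_linear B" "smooth_at M f p"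
  shows "smooth_at M (\<lambda>q. B (f q)) p"
proof -
  obtain U \<phi> where c: "(U, \<phi>) \<in> M" "p \<in> U" by (rule chart_exists)
  obtain W h where W: "open W" "\<phi> p \<in> W" "smooth_on W h" "\<And>q. q \<in> U \<Longrightarrow> \<phi> q \<in> W \<Longrightarrow> f q = h (\<phi> q)"
    using smooth_at_chartE[OF assms(2) c] by metis
  show ?thesis
    by (rule smooth_at_chartI[OF c W(1,2) smooth_on_bounded_linear[OF assms(1) W(1,3)]]) (simp add: W(4))
qed

lemma smooth_at_bounded_bilinear:
  assumes "bounded_bilinear B" "smooth_at M f p" "smooth_at M g p"
  shows "smooth_at M (\<lambda>q. B (f q) (g q)) p"
proof -
  obtain U \<phi> where c: "(U, \<phi>) \<in> M" "p \<in> U" by (rule chart_exists)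
  obtain W h where W: "open W" "\<phi> p \<in> W" "smooth_on W h" "\<And>q. q \<in> U \<Longrightarrow> \<phi> q \<in> W \<Longrightarrow> f q = h (\<phi> q)"
    using smooth_at_chartE[OF assms(2) c] by metis
  obtain W' h' where W': "open W'" "\<phi> p \<in> W'" "smooth_on W' h'" "\<And>q. q \<in> U \<Longrightarrow> \<phi> q \<in> W' \<Longrightarrow> g q = h' (\<phi> q)"
    using smooth_at_chartE[OF assms(3) c] by metis
  have "open (W \<inter> W')" "\<phi> p \<in> W \<inter> W'" using W W' by auto
  moreover have "smooth_on (W \<inter> W') (\<lambda>z. B (h z) (h' z))"
    using W W' by (intro smooth_on_bounded_bilinear[OF assms(1)]) (auto elim: smooth_on_subset)
  ultimately show ?thesis
    by (rule smooth_at_chartI[OF c]) (use W W' in auto)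
qed

lemma smooth_at_add:
  assumes "smooth_at M f p" "smooth_at M g p"
  shows "smooth_at M (\<lambda>q. f q + g q) p"
proof -
  obtain U \<phi> where c: "(U, \<phi>) \<in> M" "p \<in> U" by (rule chart_exists)
  obtain W h where W: "open W" "\<phi> p \<in> W" "smooth_on W h" "\<And>q. q \<in> U \<Longrightarrow> \<phi> q \<in> W \<Longrightarrow> f q = h (\<phi> q)"
    using smooth_at_chartE[OF assms(1) c] by metis
  obtain W' h' where W': "open W'" "\<phi> p \<in> W'" "smooth_on W' h'" "\<And>q. q \<in> U \<Longrightarrow> \<phi> q \<in> W' \<Longrightarrow> g q = h' (\<phi> q)"
    using smooth_at_chartE[OF assms(2) c] by metis
  have "open (W \<inter> W')" "\<phi> p \<in> W \<inter> W'" using W W' by auto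
  moreover have "smooth_on (W \<inter> W') (\<lambda>z. h z + h' z)"
    using W W' by (intro smooth_on_add) (auto elim: smooth_on_subset)
  ultimately show ?thesis
    by (rule smooth_at_chartI[OF c]) (use W W' in auto)
qed

lemmas smooth_at_mult = smooth_at_bounded_bilinear[OF bounded_bilinear_mult]
  and smooth_at_scaleR = smooth_at_bounded_bilinear[OF bounded_bilinear_scaleR]
  and smooth_at_minus = smooth_at_bounded_linear[OF bounded_linear_minus[OF bounded_linear_ident]]

lemma smooth_at_diff: "smooth_at M f p \<Longrightarrow> smooth_at M g p \<Longrightarrow> smooth_at M (\<lambda>q. f q - g q) p"
  using smooth_at_add[OF _ smooth_at_minus, of f p g] by simp

lemma smooth_at_sum: "(\<And>i. i \<in> I \<Longrightarrow> smooth_at M (f i) p) \<Longrightarrow> smooth_at M (\<lambda>q. \<Sum>i\<in>I. f i q) p"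
  by (induction I rule: infinite_finite_induct) (auto intro: smooth_at_const smooth_at_add)

lemma smooth_at_compose:
  fixes f :: "'a \<Rightarrow> 'w::euclidean_space"
  assumes F: "open T" "smooth_on T F" and f: "f p \<in> T" "smooth_at M f p"
  shows "smooth_at M (\<lambda>q. F (f q)) p"
proof -
  obtain U \<phi> where c: "(U, \<phi>) \<in> M" "p \<in> U" by (rule chart_exists)
  obtain W h where W: "open W" "\<phi> p \<in> W" "smooth_on W h" "\<And>q. q \<in> U \<Longrightarrow> \<phi> q \<in> W \<Longrightarrow> f q = h (\<phi> q)"
    using smooth_at_chartE[OF f(2) c] by metis
  define V where "V = W \<inter> h -` T"
  have V: "open V"
    unfolding V_def using continuous_open_preimage[OF smooth_on_continuous[OF W(3)] W(1) F(1)] .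
  have "smooth_on V (\<lambda>z. F (h z))"
    by (rule smooth_on_compose[OF V F(1) _ F(2)]) (use smooth_on_subset[OF W(3)] in \<open>auto simp: V_def\<close>)
  moreover have "\<phi> p \<in> V" using W c f by (auto simp: V_def)
  ultimately show ?thesis
    by (intro smooth_at_chartI[OF c V]) (auto simp: V_def W(4))
qed

lemma smooth_at_inverse:
  fixes f :: "'a \<Rightarrow> real"
  shows "f p > 0 \<Longrightarrow> smooth_at M f p \<Longrightarrow> smooth_at M (\<lambda>q. inverse (f q)) p"
  by (rule smooth_at_compose[OF _ smooth_on_inverse]) auto

lemma smooth_at_vec_iff:
  fixes f :: "'a \<Rightarrow> 'b::real_normed_vector ^ 'n::finite"
  shows "smooth_at M f p \<longleftrightarrow> (\<forall>i. smooth_at M (\<lambda>q. f q $ i) p)"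
proof
  assume "smooth_at M f p"
  then show "\<forall>i. smooth_at M (\<lambda>q. f q $ i) p"
    using smooth_at_bounded_linear[OF bounded_linear_vec_nth] by blast
next
  assume *: "\<forall>i. smooth_at M (\<lambda>q. f q $ i) p"
  have "bounded_linear (axis i :: 'b \<Rightarrow> 'b ^ 'n)" for i
  proof (rule bounded_linear_intro[where K=1])
    show "norm (axis i x :: 'b ^ 'n) \<le> norm x * 1" for x :: 'b
      unfolding norm_vec_def by (rule order_trans[OF L2_set_le_sum]) (auto simp: axis_def if_distrib cong: if_cong)
  qed (auto simp: axis_def vec_eq_iff)
  then have "smooth_at M (\<lambda>q. \<Sum>i\<in>UNIV. axis i (f q $ i)) p"
    using * by (intro smooth_at_sum smooth_at_bounded_linear[of "axis i" for i]) auto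
  moreover have "(\<Sum>i\<in>UNIV. axis i (f q $ i)) = f q" for q
    by (simp add: vec_eq_iff axis_def if_distrib cong: if_cong)
  ultimately show "smooth_at M f p" by simp
qed

text \<open>The closed set \<open>K\<close> is part of the conclusion because a product with
  \<open>\<beta>\<close> is smooth everywhere as soon as the other factor is smooth on
  \<open>K\<close>: the complement of \<open>K\<close> is open and the product vanishes
  there.\<close>

lemma bump_exists:
  assumes "open N" "p \<in> N"
  obtains \<beta> K where "\<beta> \<in> smooth_functions M" "\<And>q. 0 \<le> \<beta> q" "closed K" "K \<subseteq> N"
    "\<And>q. q \<notin> K \<Longrightarrow> \<beta> q = 0" "\<forall>\<^sub>F q in nhds p. \<beta> q = 1"
proof -
  obtain U \<phi> where c: "(U, \<phi>) \<in> M" "p \<in> U" by (rule chart_exists)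
  obtain r where r: "r > 0" "\<And>z. z \<in> half_space \<Longrightarrow> dist (\<phi> p) z < r \<Longrightarrow> z \<in> \<phi> ` (U \<inter> N)"
    using chart_ball[OF c assms] by metis
  \<comment> \<open>Half the radius, so that the closed ball still lies in the image of the chart.
    Its part in the half-space is compact, and therefore its preimage is closed in the Hausdorff
    space itself and not merely in \<open>U\<close>.\<close>
  define s where "s = r / 2"
  have s: "s > 0" "\<And>z. z \<in> half_space \<Longrightarrow> dist (\<phi> p) z \<le> s \<Longrightarrow> z \<in> \<phi> ` (U \<inter> N)"
    using r by (auto simp: s_def)
  obtain b :: "real^4 \<Rightarrow> real" where b: "smooth_on UNIV b" "\<And>z. 0 \<le> b z"
    "\<And>z. dist (\<phi> p) z \<le> s / 2 \<Longrightarrow> b z = 1" "\<And>z. s \<le> dist (\<phi> p) z \<Longrightarrow> b z = 0"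
    using smooth_bump_exists[OF s(1)] by metis
  define B where "B = cball (\<phi> p) s \<inter> half_space"
  define K where "K = inv_into U \<phi> ` B"
  have B: "B \<subseteq> \<phi> ` (U \<inter> N)" using s(2) by (auto simp: B_def)
  have "closed half_space"
    unfolding half_space_def by (intro closed_Collect_le continuous_intros)
  then have "compact B" unfolding B_def by (intro compact_Int_closed) auto
  then have "compact K"
    unfolding K_def using B by (intro compact_continuous_image continuous_on_subset[OF chart_inverse_continuous[OF c(1)]]) auto
  then have K: "closed K" by (rule compact_imp_closed)
  have KN: "K \<subseteq> U \<inter> N" using B chart_inverse[OF c(1)] by (auto simp: K_def)
  define \<beta> where "\<beta> = (\<lambda>q. if q \<in> U then b (\<phi> q) else 0)"
  have \<beta>0: "\<beta> q = 0" if "q \<notin> K" for q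
  proof (cases "q \<in> U")
    case True
    have "\<phi> q \<notin> B" using that True chart_inverse[OF c(1)] by (metis K_def imageI)
    then have "s \<le> dist (\<phi> p) (\<phi> q)" using chart_half_space[OF c(1) True] by (auto simp: B_def)
    then show ?thesis using b(4) by (simp add: \<beta>_def)
  qed (simp add: \<beta>_def)
  show ?thesis
  proof (rule that[OF _ _ K _ \<beta>0])
    show "\<beta> \<in> smooth_functions M"
      unfolding smooth_functions_iff
    proof
      fix q
      show "smooth_at M \<beta> q"
      proof (cases "q \<in> U")
        case True
        show ?thesis
          by (rule smooth_at_chartI[OF c(1) True open_UNIV _ b(1)]) (auto simp: \<beta>_def)
      next
        case False
        have "\<forall>\<^sub>F q in nhds q. 0 = \<beta> q"
          unfolding eventually_nhds using K KN \<beta>0 False by (intro exI[of _ "- K"]) auto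
        then show ?thesis by (rule smooth_at_cong[OF smooth_at_const])
      qed
    qed
    show "\<forall>\<^sub>F q in nhds p. \<beta> q = 1"
      unfolding eventually_nhds
    proof (intro exI[of _ "U \<inter> \<phi> -` ball (\<phi> p) (s/2)"] conjI)
      show "open (U \<inter> \<phi> -` ball (\<phi> p) (s/2))"
        using continuous_open_preimage[OF chart_continuous[OF c(1)] chart_open[OF c(1)]] by blast
    qed (use c s b in \<open>auto simp: \<beta>_def\<close>)
  qed (use KN b in \<open>auto simp: \<beta>_def\<close>)
qed

text \<open>\<open>T\<close> allows for a factor that makes sense only on part of the manifold, such
  as a transition function between two trivialisations.\<close>

lemma smooth_at_bump_scaleR:
  fixes f :: "'a \<Rightarrow> 'b::real_normed_vector"
  assumes \<beta>: "\<beta> \<in> smooth_functions M" "closed K" "\<And>q. q \<notin> K \<Longrightarrow> \<beta> q = 0"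
    and f: "\<And>q. q \<in> K \<Longrightarrow> q \<in> T \<Longrightarrow> smooth_at M f q" and T: "open T" "q \<in> T"
  shows "smooth_at M (\<lambda>q. \<beta> q *\<^sub>R f q) q"
proof (cases "q \<in> K")
  case True
  then show ?thesis using f T \<beta>(1) by (auto intro: smooth_at_scaleR simp: smooth_functions_iff)
next
  case False
  then have "\<forall>\<^sub>F q in nhds q. 0 = \<beta> q *\<^sub>R f q"
    unfolding eventually_nhds using \<beta> by (intro exI[of _ "- K"]) auto
  then show ?thesis by (rule smooth_at_cong[OF smooth_at_const])
qed

text \<open>Tangent vectors act on globally smooth functions only, so every local function has to be
  replaced by a global one with the same germ.\<close>

lemma local_extension:
  fixes f :: "'a \<Rightarrow> real"
  assumes "smooth_at M f p"
  obtains f' where "f' \<in> smooth_functions M" "\<forall>\<^sub>F q in nhds p. f' q = f q"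
proof -
  obtain N where N: "open N" "p \<in> N" "\<And>q. q \<in> N \<Longrightarrow> smooth_at M f q"
    using smooth_at_eventually[OF assms] by (auto simp: eventually_nhds)
  obtain \<beta> K where \<beta>: "\<beta> \<in> smooth_functions M" "\<And>q. 0 \<le> \<beta> q" "closed K" "K \<subseteq> N"
    "\<And>q. q \<notin> K \<Longrightarrow> \<beta> q = 0" "\<forall>\<^sub>F q in nhds p. \<beta> q = 1"
    using bump_exists[OF N(1,2)] by metis
  have "(\<lambda>q. \<beta> q *\<^sub>R f q) \<in> smooth_functions M"
    unfolding smooth_functions_iff
    using smooth_at_bump_scaleR[OF \<beta>(1,3,5), of UNIV f] \<beta>(4) N(3) by auto
  moreover have "\<forall>\<^sub>F q in nhds p. \<beta> q *\<^sub>R f q = f q"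
    using \<beta>(6) by eventually_elim auto
  ultimately show ?thesis using that by blast
qed

end

section \<open>Tangent vectors in charts\<close>

text \<open>A step in a positive coordinate direction never leaves the half-space, so derivatives
  within it are unique at boundary points too.\<close>

lemma half_space_frechet_derivative:
  assumes "z \<in> half_space" "(F has_derivative D) (at z within half_space)"
  shows "frechet_derivative F (at z within half_space) = D"
proof (rule frechet_derivative_unique_within)
  show "(F has_derivative frechet_derivative F (at z within half_space)) (at z within half_space)"
    using assms(2) frechet_derivative_works differentiable_def by blast
  fix i :: "real^4" and e :: real assume i: "i \<in> Basis" and e: "e > 0"
  have "0 \<le> i $ 1" using i by (auto simp: Basis_vec_def axis_def)
  then have "z + (e / 2) *\<^sub>R i \<in> half_space" using assms(1) e by (simp add: half_space_def)
  then show "\<exists>d. 0 < \<bar>d\<bar> \<and> \<bar>d\<bar> < e \<and> z + d *\<^sub>R i \<in> half_space"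
    using e by (intro exI[of _ "e / 2"]) auto
qed (rule assms)

lemma sum_Basis_cart: "(\<Sum>b\<in>Basis. F b) = (\<Sum>i\<in>UNIV. F (axis i 1))" for F :: "real^'n \<Rightarrow> real"
proof -
  have "bij_betw (\<lambda>i. axis i 1) UNIV (Basis :: (real^'n) set)"
    by (auto simp: bij_betw_def inj_on_def axis_eq_axis Basis_vec_def)
  then show ?thesis by (rule sum.reindex_bij_betw[symmetric])
qed

text \<open>The partial derivative is taken within the half-space and is thus meaningful on the
  boundary; it agrees with the derivative of any smooth extension.\<close>

definition pd :: "'a set \<Rightarrow> ('a \<Rightarrow> real^4) \<Rightarrow> 4 \<Rightarrow> ('a \<Rightarrow> real) \<Rightarrow> 'a \<Rightarrow> real" where
  "pd U \<phi> i f q = frechet_derivative (f \<circ> inv_into U \<phi>) (at (\<phi> q) within half_space) (axis i 1)"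

context compact_manifold begin

lemma chart_frechet_derivative:
  assumes c: "(U, \<phi>) \<in> M" "q \<in> U" and W: "open W" "\<phi> q \<in> W" "(h has_derivative D) (at (\<phi> q))"
    "\<And>r. r \<in> U \<Longrightarrow> \<phi> r \<in> W \<Longrightarrow> f r = h (\<phi> r)"
  shows "frechet_derivative (f \<circ> inv_into U \<phi>) (at (\<phi> q) within half_space) = D"
proof (rule half_space_frechet_derivative[OF chart_half_space[OF c]])
  obtain r where r: "r > 0" "\<And>z. z \<in> half_space \<Longrightarrow> dist (\<phi> q) z < r \<Longrightarrow> z \<in> \<phi> ` (U \<inter> U)"
    using chart_ball[OF c chart_open[OF c(1)] c(2)] by metis
  obtain r' where r': "r' > 0" "ball (\<phi> q) r' \<subseteq> W" using W(1,2) by (meson open_contains_ball)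
  show "(f \<circ> inv_into U \<phi> has_derivative D) (at (\<phi> q) within half_space)"
  proof (rule has_derivative_transform_within[OF has_derivative_at_withinI[OF W(3)], of "min r r'"])
    fix z assume "z \<in> half_space" "dist z (\<phi> q) < min r r'"
    then have "z \<in> \<phi> ` U" "z \<in> W" using r r' by (auto simp: dist_commute)
    then show "h z = (f \<circ> inv_into U \<phi>) z" using W(4) chart_inverse[OF c(1)] by auto
  qed (use r r' chart_half_space[OF c] in auto)
qed

lemma pd_eq:
  assumes "(U, \<phi>) \<in> M" "q \<in> U" "open W" "\<phi> q \<in> W" "(h has_derivative D) (at (\<phi> q))"
    "\<And>r. r \<in> U \<Longrightarrow> \<phi> r \<in> W \<Longrightarrow> f r = h (\<phi> r)"
  shows "pd U \<phi> i f q = D (axis i 1)"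
  unfolding pd_def by (simp add: chart_frechet_derivative[OF assms])

lemma smooth_at_pd:
  assumes c: "(U, \<phi>) \<in> M" "p \<in> U" and f: "smooth_at M f p"
  shows "smooth_at M (pd U \<phi> i f) p"
proof -
  obtain W h where W: "open W" "\<phi> p \<in> W" "smooth_on W h" "\<And>q. q \<in> U \<Longrightarrow> \<phi> q \<in> W \<Longrightarrow> f q = h (\<phi> q)"
    using smooth_at_chartE[OF f c] by metis
  show ?thesis
  proof (rule smooth_at_chartI[OF c W(1,2) smooth_on_frechet_derivative[OF W(3)]])
    show "pd U \<phi> i f q = frechet_derivative h (at (\<phi> q)) (axis i 1)" if "q \<in> U" "\<phi> q \<in> W" for q
      by (rule pd_eq[OF c(1) that(1) W(1) that(2) smooth_on_has_derivative[OF W(3) that(2)] W(4)])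
  qed
qed

lemma pd_linear:
  assumes c: "(U, \<phi>) \<in> M" "p \<in> U" and "smooth_at M f p" "smooth_at M g p"
  shows "pd U \<phi> i (\<lambda>q. a * f q + b * g q) p = a * pd U \<phi> i f p + b * pd U \<phi> i g p"
    and "pd U \<phi> i (\<lambda>q. f q * g q) p = f p * pd U \<phi> i g p + g p * pd U \<phi> i f p"
proof -
  obtain W h where W: "open W" "\<phi> p \<in> W" "smooth_on W h" "\<And>q. q \<in> U \<Longrightarrow> \<phi> q \<in> W \<Longrightarrow> f q = h (\<phi> q)"
    using smooth_at_chartE[OF assms(3) c] by metis
  obtain W' h' where W': "open W'" "\<phi> p \<in> W'" "smooth_on W' h'" "\<And>q. q \<in> U \<Longrightarrow> \<phi> q \<in> W' \<Longrightarrow> g q = h' (\<phi> q)"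
    using smooth_at_chartE[OF assms(4) c] by metis
  note h = smooth_on_has_derivative[OF W(3,2)] and h' = smooth_on_has_derivative[OF W'(3,2)]
  have WW: "open (W \<inter> W')" "\<phi> p \<in> W \<inter> W'" using W W' by auto
  have f: "pd U \<phi> i f p = frechet_derivative h (at (\<phi> p)) (axis i 1)"
    by (rule pd_eq[OF c W(1,2) h W(4)])
  have g: "pd U \<phi> i g p = frechet_derivative h' (at (\<phi> p)) (axis i 1)"
    by (rule pd_eq[OF c W'(1,2) h' W'(4)])
  have "pd U \<phi> i (\<lambda>q. a * f q + b * g q) p =
      a * frechet_derivative h (at (\<phi> p)) (axis i 1) + b * frechet_derivative h' (at (\<phi> p)) (axis i 1)"
    by (rule pd_eq[OF c WW has_derivative_add[OF has_derivative_mult_right[OF h] has_derivative_mult_right[OF h']]])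
      (use W W' in auto)
  then show "pd U \<phi> i (\<lambda>q. a * f q + b * g q) p = a * pd U \<phi> i f p + b * pd U \<phi> i g p"
    using f g by simp
  have "pd U \<phi> i (\<lambda>q. f q * g q) p =
      h (\<phi> p) * frechet_derivative h' (at (\<phi> p)) (axis i 1) + frechet_derivative h (at (\<phi> p)) (axis i 1) * h' (\<phi> p)"
    by (rule pd_eq[OF c WW has_derivative_mult[OF h h']]) (use W W' in auto)
  then show "pd U \<phi> i (\<lambda>q. f q * g q) p = f p * pd U \<phi> i g p + g p * pd U \<phi> i f p"
    using f g W(2,4) W'(2,4) c by simp
qed

lemma pd_cong:
  assumes c: "(U, \<phi>) \<in> M" "p \<in> U" and f: "smooth_at M f p" and eq: "\<forall>\<^sub>F q in nhds p. f q = g q"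
  shows "pd U \<phi> i f p = pd U \<phi> i g p"
proof -
  obtain W h where W: "open W" "\<phi> p \<in> W" "smooth_on W h" "\<And>q. q \<in> U \<Longrightarrow> \<phi> q \<in> W \<Longrightarrow> f q = h (\<phi> q)"
    using smooth_at_chartE[OF f c] by metis
  obtain N where N: "open N" "p \<in> N" "\<And>q. q \<in> N \<Longrightarrow> f q = g q"
    using eq by (auto simp: eventually_nhds)
  obtain W' where W': "open W'" "\<phi> p \<in> W'" "\<And>q. q \<in> U \<Longrightarrow> \<phi> q \<in> W' \<Longrightarrow> q \<in> N"
    using chart_nhd[OF c N(1,2)] by metis
  note h = smooth_on_has_derivative[OF W(3,2)]
  have "pd U \<phi> i f p = frechet_derivative h (at (\<phi> p)) (axis i 1)"
    by (rule pd_eq[OF c W(1,2) h W(4)])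
  moreover have "pd U \<phi> i g p = frechet_derivative h (at (\<phi> p)) (axis i 1)"
    by (rule pd_eq[OF c, of "W \<inter> W'", OF _ _ h]) (use W W' N in \<open>auto simp: N(3)[symmetric]\<close>)
  ultimately show ?thesis by simp
qed

lemma pd_coord:
  assumes c: "(U, \<phi>) \<in> M" "p \<in> U"
  shows "pd U \<phi> i (\<lambda>q. \<phi> q $ j) p = (if i = j then 1 else 0)"
proof -
  have "pd U \<phi> i (\<lambda>q. \<phi> q $ j) p = axis i 1 $ j"
    by (rule pd_eq[OF c open_UNIV]) (auto intro!: bounded_linear_imp_has_derivative bounded_linear_vec_nth)
  then show ?thesis by (simp add: axis_def)
qed

section \<open>Tangent vectors as derivations\<close>

lemma smooth_functions_const: "(\<lambda>q. c) \<in> smooth_functions M"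
  and smooth_functions_add: "f \<in> smooth_functions M \<Longrightarrow> g \<in> smooth_functions M \<Longrightarrow> (\<lambda>q. f q + g q) \<in> smooth_functions M"
  and smooth_functions_diff: "f \<in> smooth_functions M \<Longrightarrow> g \<in> smooth_functions M \<Longrightarrow> (\<lambda>q. f q - g q) \<in> smooth_functions M"
  and smooth_functions_mult: "f \<in> smooth_functions M \<Longrightarrow> g \<in> smooth_functions M \<Longrightarrow> (\<lambda>q. f q * g q) \<in> smooth_functions M"
  by (auto simp: smooth_functions_iff intro: smooth_at_const smooth_at_add smooth_at_diff smooth_at_mult)

lemma smooth_functions_sum:
  "(\<And>i. i \<in> I \<Longrightarrow> f i \<in> smooth_functions M) \<Longrightarrow> (\<lambda>q. \<Sum>i\<in>I. f i q) \<in> smooth_functions M"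
  by (auto simp: smooth_functions_iff intro: smooth_at_sum)

lemma tangent_nonsmooth: "v \<in> tangent_space M p \<Longrightarrow> f \<notin> smooth_functions M \<Longrightarrow> v f = 0"
  by (simp add: tangent_space_def)

lemma tangent_linear:
  "v \<in> tangent_space M p \<Longrightarrow> f \<in> smooth_functions M \<Longrightarrow> g \<in> smooth_functions M \<Longrightarrow>
    v (\<lambda>q. a * f q + b * g q) = a * v f + b * v g"
  by (simp add: tangent_space_def)

lemma tangent_mult:
  "v \<in> tangent_space M p \<Longrightarrow> f \<in> smooth_functions M \<Longrightarrow> g \<in> smooth_functions M \<Longrightarrow>
    v (\<lambda>q. f q * g q) = f p * v g + g p * v f"
  by (simp add: tangent_space_def)

lemma tangent_add:
  "v \<in> tangent_space M p \<Longrightarrow> f \<in> smooth_functions M \<Longrightarrow> g \<in> smooth_functions M \<Longrightarrow>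
    v (\<lambda>q. f q + g q) = v f + v g"
  using tangent_linear[of v p f g 1 1] by simp

lemma tangent_diff:
  "v \<in> tangent_space M p \<Longrightarrow> f \<in> smooth_functions M \<Longrightarrow> g \<in> smooth_functions M \<Longrightarrow>
    v (\<lambda>q. f q - g q) = v f - v g"
  using tangent_linear[of v p f g 1 "-1"] by simp

lemma tangent_const: 
  assumes "v \<in> tangent_space M p"
  shows "v (\<lambda>q. c) = 0"
  using tangent_mult[OF assms smooth_functions_const smooth_functions_const, of 1 1]
    tangent_linear[OF assms smooth_functions_const smooth_functions_const, of c 1 0 1] by simp

lemma tangent_sum:
  assumes "v \<in> tangent_space M p"
  shows "(\<And>i. i \<in> I \<Longrightarrow> f i \<in> smooth_functions M) \<Longrightarrow> v (\<lambda>q. \<Sum>i\<in>I. f i q) = (\<Sum>i\<in>I. v (f i))"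
  by (induction I rule: infinite_finite_induct)
    (auto simp: tangent_const[OF assms] tangent_add[OF assms] smooth_functions_sum)

text \<open>Derivations are local: with a bump function supported where \<open>f\<close> and
  \<open>g\<close> agree, \<open>\<beta> (f - g)\<close> is identically zero, and the product rule
  at \<open>p\<close> leaves only \<open>v (f - g)\<close>.\<close>

lemma tangent_cong:
  assumes v: "v \<in> tangent_space M p" and fg: "f \<in> smooth_functions M" "g \<in> smooth_functions M"
    and eq: "\<forall>\<^sub>F q in nhds p. f q = g q"
  shows "v f = v g"
proof -
  obtain N where N: "open N" "p \<in> N" "\<And>q. q \<in> N \<Longrightarrow> f q = g q"
    using eq by (auto simp: eventually_nhds)
  obtain \<beta> K where \<beta>: "\<beta> \<in> smooth_functions M" "\<And>q. 0 \<le> \<beta> q" "closed K" "K \<subseteq> N"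
    "\<And>q. q \<notin> K \<Longrightarrow> \<beta> q = 0" "\<forall>\<^sub>F q in nhds p. \<beta> q = 1"
    using bump_exists[OF N(1,2)] by metis
  have "(\<lambda>q. \<beta> q * (f q - g q)) = (\<lambda>q. 0)" using N(3) \<beta>(4,5) by fastforce
  moreover have "v (\<lambda>q. \<beta> q * (f q - g q)) = \<beta> p * v (\<lambda>q. f q - g q) + (f p - g p) * v \<beta>"
    by (rule tangent_mult[OF v \<beta>(1) smooth_functions_diff[OF fg]])
  moreover have "\<beta> p = 1" using eventually_nhds_x_imp_x[OF \<beta>(6)] .
  ultimately show ?thesis
    using tangent_const[OF v, of 0] tangent_diff[OF v fg] N by simp
qed

lemma tangent_space_linear:
  assumes "v \<in> tangent_space M p" "w \<in> tangent_space M p"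
  shows "(\<lambda>f. a * v f + b * w f) \<in> tangent_space M p"
  using assms unfolding tangent_space_def by (auto simp: algebra_simps)

lemma tangent_space_zero: "(\<lambda>f. 0) \<in> tangent_space M p"
  by (simp add: tangent_space_def)

lemma tangent_space_scale: "v \<in> tangent_space M p \<Longrightarrow> (\<lambda>f. a * v f) \<in> tangent_space M p"
  using tangent_space_linear[of v p v a 0] by simp

lemma tangent_space_sum:
  "(\<And>i. i \<in> I \<Longrightarrow> v i \<in> tangent_space M p) \<Longrightarrow> (\<lambda>f. \<Sum>i\<in>I. c i * v i f) \<in> tangent_space M p"
proof (induction I rule: infinite_finite_induct)
  case (insert j I)
  then show ?case using tangent_space_linear[of "v j" p "\<lambda>f. \<Sum>i\<in>I. c i * v i f" "c j" 1] by simp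
qed (auto simp: tangent_space_zero)

lemma coordinate_functions_exist:
  assumes c: "(U, \<phi>) \<in> M" "p \<in> U"
  obtains x where "\<And>i. x i \<in> smooth_functions M" "\<And>i. \<forall>\<^sub>F q in nhds p. x i q = \<phi> q $ i"
proof -
  have "\<exists>y. y \<in> smooth_functions M \<and> (\<forall>\<^sub>F q in nhds p. y q = \<phi> q $ i)" for i
    using local_extension[of "\<lambda>q. \<phi> q $ i" p] smooth_at_chart[OF c] smooth_at_vec_iff by metis
  then show ?thesis using that by metis
qed

text \<open>By Hadamard's lemma \<open>f\<close> is, near \<open>p\<close>, a constant plus a sum of
  products \<open>(x i - x i p) * g i\<close> where \<open>g i p\<close> is a partial derivative. A
  derivation kills the constant and keeps only \<open>v (x i) * g i p\<close>. The lemma is applied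
  to an extension of \<open>f\<close> on a full ball, which at a boundary point reaches beyond the
  half-space.\<close>

lemma tangent_expansion:
  assumes c: "(U, \<phi>) \<in> M" "p \<in> U" and v: "v \<in> tangent_space M p"
    and x: "\<And>i. x i \<in> smooth_functions M" "\<And>i. \<forall>\<^sub>F q in nhds p. x i q = \<phi> q $ i"
    and f: "f \<in> smooth_functions M"
  shows "v f = (\<Sum>i\<in>UNIV. v (x i) * pd U \<phi> i f p)"
proof -
  obtain W h where W: "open W" "\<phi> p \<in> W" "smooth_on W h" "\<And>q. q \<in> U \<Longrightarrow> \<phi> q \<in> W \<Longrightarrow> f q = h (\<phi> q)"
    using smooth_at_chartE[OF _ c] f smooth_functions_iff by metis
  obtain r where r: "r > 0" "ball (\<phi> p) r \<subseteq> W" using W(1,2) by (meson open_contains_ball)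
  define B where "B = ball (\<phi> p) r"
  have B: "open B" "convex B" "\<phi> p \<in> B" using r(1) by (auto simp: B_def)
  have P: "\<phi> p + 0 \<in> B" if "z \<in> B" for z using B(3) by simp
  have hB: "smooth_on B h" using smooth_on_subset[OF W(3)] r(2) B_def by blast
  obtain G where G: "\<And>b. b \<in> Basis \<Longrightarrow> smooth_on B (G b)"
    "\<And>z. z \<in> B \<Longrightarrow> h z = h (\<phi> p + 0) + (\<Sum>b\<in>Basis. ((z - (\<phi> p + 0)) \<bullet> b) * G b z)"
    "\<And>z b. z \<in> B \<Longrightarrow> \<phi> p + 0 = z \<Longrightarrow> G b z = frechet_derivative h (at z) b"
    by (rule smooth_on_Hadamard[OF B(1,2) linear_zero _ hB, of "\<phi> p"]) (use P in simp, blast)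
  have G_at: "smooth_at M (\<lambda>q. G (axis i 1) (\<phi> q)) p" for i
    by (rule smooth_at_compose[OF B(1) G(1) B(3) smooth_at_chart[OF c]]) (simp add: axis_in_Basis_iff)
  have "\<exists>g. g \<in> smooth_functions M \<and> (\<forall>\<^sub>F q in nhds p. g q = G (axis i 1) (\<phi> q))" for i
    using local_extension[OF G_at] by metis
  then obtain g where g: "\<And>i. g i \<in> smooth_functions M" "\<And>i. \<forall>\<^sub>F q in nhds p. g i q = G (axis i 1) (\<phi> q)"
    by metis
  have gp: "g i p = pd U \<phi> i f p" for i
  proof -
    have "g i p = G (axis i 1) (\<phi> p)" using eventually_nhds_x_imp_x[OF g(2)] .
    also have "\<dots> = frechet_derivative h (at (\<phi> p)) (axis i 1)" using G(3) B(3) by simp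
    also have "\<dots> = pd U \<phi> i f p"
      by (rule pd_eq[OF c W(1,2) smooth_on_has_derivative[OF W(3,2)] W(4), symmetric])
    finally show ?thesis .
  qed
  have xp: "x i p = \<phi> p $ i" for i using eventually_nhds_x_imp_x[OF x(2)] .
  define F where "F = (\<lambda>i q. (x i q - x i p) * g i q)"
  have F: "F i \<in> smooth_functions M" for i
    unfolding F_def using x(1) g(1) by (intro smooth_functions_mult smooth_functions_diff smooth_functions_const)
  have "\<forall>\<^sub>F q in nhds p. q \<in> U \<inter> \<phi> -` B"
    using continuous_open_preimage[OF chart_continuous[OF c(1)] chart_open[OF c(1)] B(1)] c B(3)
    by (intro eventually_nhds_in_open) auto
  moreover have "\<forall>\<^sub>F q in nhds p. \<forall>i\<in>UNIV. x i q = \<phi> q $ i \<and> g i q = G (axis i 1) (\<phi> q)"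
    using x(2) g(2) by (intro eventually_ball_finite) (auto intro: eventually_conj)
  ultimately have "\<forall>\<^sub>F q in nhds p. f q = f p + (\<Sum>i\<in>UNIV. F i q)"
  proof eventually_elim
    case (elim q)
    then have "f q = h (\<phi> q)" using W(4) r(2) B_def by auto
    also have "\<dots> = h (\<phi> p) + (\<Sum>i\<in>UNIV. ((\<phi> q - \<phi> p) \<bullet> axis i 1) * G (axis i 1) (\<phi> q))"
      using G(2)[of "\<phi> q"] elim(1) by (simp add: sum_Basis_cart)
    also have "\<dots> = f p + (\<Sum>i\<in>UNIV. F i q)"
      using W(2,4) c(2) elim(2) by (simp add: F_def xp inner_axis)
    finally show ?case .
  qed
  then have "v f = v (\<lambda>q. f p + (\<Sum>i\<in>UNIV. F i q))"
    by (intro tangent_cong[OF v f] smooth_functions_add smooth_functions_const smooth_functions_sum F)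
  also have "\<dots> = (\<Sum>i\<in>UNIV. v (F i))"
    by (simp add: tangent_add[OF v] tangent_const[OF v] tangent_sum[OF v] smooth_functions_const smooth_functions_sum F)
  also have "\<dots> = (\<Sum>i\<in>UNIV. v (x i) * pd U \<phi> i f p)"
  proof (rule sum.cong)
    fix i
    have "v (F i) = (x i p - x i p) * v (g i) + g i p * v (\<lambda>q. x i q - x i p)"
      unfolding F_def by (rule tangent_mult[OF v smooth_functions_diff[OF x(1) smooth_functions_const] g(1)])
    also have "v (\<lambda>q. x i q - x i p) = v (x i)"
      using tangent_diff[OF v x(1) smooth_functions_const] tangent_const[OF v] by simp
    finally show "v (F i) = v (x i) * pd U \<phi> i f p" by (simp add: gp)
  qed simp
  finally show ?thesis .
qed

lemma vector_field_tangent: "V \<in> vector_fields M \<Longrightarrow> V p \<in> tangent_space M p"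
  and vector_field_smooth: "V \<in> vector_fields M \<Longrightarrow> f \<in> smooth_functions M \<Longrightarrow> (\<lambda>p. V p f) \<in> smooth_functions M"
  by (auto simp: vector_fields_def)

text \<open>The coordinate fields of the chart, cut off by a bump function so that they are fields
  on the whole manifold. On \<open>N\<close> the bump is 1 and they form a basis dual to the
  differentials of \<open>x i\<close>.\<close>

lemma local_frame:
  assumes c: "(U, \<phi>) \<in> M" "p \<in> U"
  obtains X x N where "open N" "p \<in> N" "N \<subseteq> U" "\<And>i. X i \<in> vector_fields M" "\<And>i. x i \<in> smooth_functions M"
    "\<And>i q. q \<in> N \<Longrightarrow> \<forall>\<^sub>F q' in nhds q. x i q' = \<phi> q' $ i"
    "\<And>i f q. f \<in> smooth_functions M \<Longrightarrow> q \<in> N \<Longrightarrow> X i q f = pd U \<phi> i f q"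
    "\<And>q v. q \<in> N \<Longrightarrow> v \<in> tangent_space M q \<Longrightarrow> v = (\<lambda>f. \<Sum>i\<in>UNIV. v (x i) * X i q f)"
    "\<And>i j q. q \<in> N \<Longrightarrow> X i q (x j) = (if i = j then 1 else 0)"
proof -
  obtain x where x: "\<And>i. x i \<in> smooth_functions M" "\<And>i. \<forall>\<^sub>F q in nhds p. x i q = \<phi> q $ i"
    using coordinate_functions_exist[OF c] by metis
  obtain \<beta> K where \<beta>: "\<beta> \<in> smooth_functions M" "\<And>q. 0 \<le> \<beta> q" "closed K" "K \<subseteq> U"
    "\<And>q. q \<notin> K \<Longrightarrow> \<beta> q = 0" "\<forall>\<^sub>F q in nhds p. \<beta> q = 1"
    using bump_exists[OF chart_open[OF c(1)] c(2)] by metis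
  have "\<forall>\<^sub>F q in nhds p. q \<in> U \<and> \<beta> q = 1 \<and> (\<forall>i\<in>UNIV. x i q = \<phi> q $ i)"
    using x(2) \<beta>(6) c(2) chart_open[OF c(1)]
    by (intro eventually_conj eventually_ball_finite eventually_nhds_in_open) auto
  then obtain N where N: "open N" "p \<in> N" "\<And>q. q \<in> N \<Longrightarrow> q \<in> U \<and> \<beta> q = 1 \<and> (\<forall>i. x i q = \<phi> q $ i)"
    unfolding eventually_nhds by auto
  \<comment> \<open>The value 0 on non-smooth functions is required of tangent vectors by
    convention; outside the chart the bump annihilates the meaningless \<open>pd\<close>.\<close>
  define X where "X = (\<lambda>i q f. if f \<in> smooth_functions M then \<beta> q * pd U \<phi> i f q else 0)"
  have X_tangent: "X i q \<in> tangent_space M q" for i q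
  proof (cases "q \<in> U")
    case True
    then show ?thesis
      using pd_linear[OF c(1)] smooth_functions_mult smooth_functions_add[OF smooth_functions_mult smooth_functions_mult]
        smooth_functions_const
      by (auto simp: tangent_space_def X_def smooth_functions_iff algebra_simps)
  next
    case False
    then have "\<beta> q = 0" using \<beta> by blast
    then have "X i q = (\<lambda>f. 0)" by (simp add: X_def fun_eq_iff)
    then show ?thesis by (simp add: tangent_space_zero)
  qed
  have x_ev: "\<forall>\<^sub>F q' in nhds q. x i q' = \<phi> q' $ i" if "q \<in> N" for i q
    unfolding eventually_nhds using N that by blast
  have X_pd: "X i q f = pd U \<phi> i f q" if "f \<in> smooth_functions M" "q \<in> N" for i f q
    using that N by (simp add: X_def)
  show ?thesis
  proof (rule that[OF N(1,2)])
    show "N \<subseteq> U" using N by auto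
    show "X i \<in> vector_fields M" for i
      unfolding vector_fields_def
    proof (intro CollectI conjI allI ballI X_tangent)
      fix f assume f: "f \<in> smooth_functions M"
      have "(\<lambda>q. X i q f) = (\<lambda>q. \<beta> q *\<^sub>R pd U \<phi> i f q)" using f by (simp add: X_def)
      moreover have "\<dots> \<in> smooth_functions M"
        unfolding smooth_functions_iff
        using smooth_at_bump_scaleR[OF \<beta>(1,3,5), of UNIV "pd U \<phi> i f"] \<beta>(4) smooth_at_pd[OF c(1)] f smooth_functions_iff
        by blast
      ultimately show "(\<lambda>q. X i q f) \<in> smooth_functions M" by simp
    qed
    show "v = (\<lambda>f. \<Sum>i\<in>UNIV. v (x i) * X i q f)" if "q \<in> N" "v \<in> tangent_space M q" for q v
    proof
      fix f
      show "v f = (\<Sum>i\<in>UNIV. v (x i) * X i q f)"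
      proof (cases "f \<in> smooth_functions M")
        case True
        then show ?thesis
          using tangent_expansion[OF c(1) _ that(2) x(1) x_ev[OF that(1)] True] X_pd[OF True that(1)] N(3)[OF that(1)] by simp
      next
        case False
        then show ?thesis using tangent_nonsmooth[OF that(2) False] by (simp add: X_def)
      qed
    qed
    show "X i q (x j) = (if i = j then 1 else 0)" if "q \<in> N" for i j q
    proof -
      have q: "q \<in> U" using N that by blast
      have "pd U \<phi> i (x j) q = pd U \<phi> i (\<lambda>q. \<phi> q $ j) q"
        by (rule pd_cong[OF c(1) q _ x_ev[OF that]]) (use x(1) smooth_functions_iff in blast)
      then show ?thesis using X_pd[OF x(1) that] pd_coord[OF c(1) q] by simp
    qed
  qed (use x x_ev X_pd in auto)
qed

end

section \<open>The boundary\<close>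

lemma isCont_tendsto_nhds: "isCont f p \<Longrightarrow> (f \<longlongrightarrow> f p) (nhds p)"
  by (simp add: isCont_def tendsto_at_iff_tendsto_nhds)

context compact_manifold begin

text \<open>Invariance of domain. If \<open>p\<close> were interior in the second chart, the change
  of charts would map a small ball injectively and continuously onto an open set around
  \<open>\<phi> p\<close> inside the half-space, although \<open>\<phi> p\<close> lies on its
  bounding hyperplane.\<close>

lemma boundary_chart_aux:
  assumes c: "(U, \<phi>) \<in> M" "p \<in> U" and c': "(U', \<phi>') \<in> M" "p \<in> U'" and p: "\<phi> p $ 1 = 0"
  shows "\<phi>' p $ 1 = 0"
proof (rule ccontr)
  assume "\<phi>' p $ 1 \<noteq> 0"
  then have pos: "\<phi>' p $ 1 > 0" using chart_half_space[OF c'] by (simp add: half_space_def)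
  obtain r where r: "r > 0" "\<And>z. z \<in> half_space \<Longrightarrow> dist (\<phi>' p) z < r \<Longrightarrow> z \<in> \<phi>' ` (U' \<inter> U)"
    using chart_ball[OF c' chart_open[OF c(1)] c(2)] by metis
  define B where "B = ball (\<phi>' p) (min r (\<phi>' p $ 1))"
  have B: "B \<subseteq> \<phi>' ` (U' \<inter> U)"
  proof
    fix z assume z: "z \<in> B"
    have "\<bar>\<phi>' p $ 1 - z $ 1\<bar> \<le> dist (\<phi>' p) z"
      using component_le_norm_cart[of "\<phi>' p - z" 1] by (simp add: dist_norm)
    then have "z \<in> half_space" using z by (auto simp: B_def half_space_def)
    then show "z \<in> \<phi>' ` (U' \<inter> U)" using r z by (auto simp: B_def)
  qed
  define F where "F = (\<lambda>z. \<phi> (inv_into U' \<phi>' z))"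
  have inv: "inv_into U' \<phi>' z \<in> U' \<inter> U" "\<phi>' (inv_into U' \<phi>' z) = z" if z: "z \<in> B" for z
  proof -
    obtain q where "q \<in> U' \<inter> U" "z = \<phi>' q" using B z by blast
    then show "inv_into U' \<phi>' z \<in> U' \<inter> U" "\<phi>' (inv_into U' \<phi>' z) = z" using chart_inverse[OF c'(1)] by auto
  qed
  have "continuous_on B F"
    unfolding F_def
    by (rule continuous_on_compose2[OF chart_continuous[OF c(1)] continuous_on_subset[OF chart_inverse_continuous[OF c'(1)]]])
      (use B inv in auto)
  moreover have "inj_on F B"
  proof (rule inj_onI)
    fix z w assume *: "z \<in> B" "w \<in> B" "F z = F w"
    then have "inv_into U' \<phi>' z = inv_into U' \<phi>' w"
      using inj_onD[OF chart_inj[OF c(1)]] inv(1) by (auto simp: F_def)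
    then show "z = w" using inv(2) * by metis
  qed
  ultimately have op: "open (F ` B)" by (intro invariance_of_domain) (auto simp: B_def)
  have "\<phi>' p \<in> B" using pos r by (simp add: B_def)
  then have "F (\<phi>' p) \<in> F ` B" by blast
  then have "\<phi> p \<in> F ` B" using chart_inverse[OF c'] by (simp add: F_def)
  then obtain e where e: "e > 0" "ball (\<phi> p) e \<subseteq> F ` B" using op by (meson open_contains_ball)
  have "\<phi> p - (e / 2) *\<^sub>R axis 1 1 \<in> ball (\<phi> p) e" using e(1) by (simp add: dist_norm)
  then obtain z where "z \<in> B" "\<phi> p - (e / 2) *\<^sub>R axis 1 1 = F z" using e(2) by blast
  then have "\<phi> p - (e / 2) *\<^sub>R axis 1 1 \<in> half_space"
    using inv(1)[of z] chart_half_space[OF c(1)] by (simp add: F_def)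
  then show False using e(1) p by (simp add: half_space_def)
qed

lemma boundary_iff:
  assumes "(U, \<phi>) \<in> M" "p \<in> U"
  shows "p \<in> bdry M \<longleftrightarrow> \<phi> p $ 1 = 0"
  using boundary_chart_aux assms unfolding bdry_def by blast

lemma interior_dense:
  assumes "open N" "p \<in> N"
  obtains q where "q \<in> N" "q \<notin> bdry M"
proof -
  obtain U \<phi> where c: "(U, \<phi>) \<in> M" "p \<in> U" by (rule chart_exists)
  obtain r where r: "r > 0" "\<And>z. z \<in> half_space \<Longrightarrow> dist (\<phi> p) z < r \<Longrightarrow> z \<in> \<phi> ` (U \<inter> N)"
    using chart_ball[OF c assms] by metis
  define z where "z = \<phi> p + (r / 2) *\<^sub>R axis 1 1"
  have z1: "z $ 1 > 0" using chart_half_space[OF c] r(1) by (simp add: z_def half_space_def)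
  then have "z \<in> \<phi> ` (U \<inter> N)" using r by (auto simp: z_def half_space_def dist_norm)
  then obtain q where "q \<in> U" "q \<in> N" "z = \<phi> q" by auto
  then show ?thesis using that boundary_iff[OF c(1)] z1 by auto
qed

text \<open>The uniqueness behind \<open>zero_metric\<close> and \<open>dlog\<close>: the interior
  is dense, so a continuous function is determined by its values there.\<close>

lemma isCont_eq_from_interior:
  fixes u w :: "'a \<Rightarrow> real"
  assumes "isCont u p" "isCont w p" "\<forall>\<^sub>F q in nhds p. q \<notin> bdry M \<longrightarrow> u q = w q"
  shows "u p = w p"
proof (rule ccontr)
  assume "u p \<noteq> w p"
  moreover have "((\<lambda>q. u q - w q) \<longlongrightarrow> u p - w p) (nhds p)"
    using assms(1,2) by (intro tendsto_diff isCont_tendsto_nhds)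
  ultimately have "\<forall>\<^sub>F q in nhds p. u q - w q \<noteq> 0"
    by (intro tendsto_imp_eventually_ne[of _ "u p - w p"]) auto
  with assms(3) have "\<forall>\<^sub>F q in nhds p. q \<in> bdry M" by eventually_elim auto
  then show False unfolding eventually_nhds using interior_dense by metis
qed

lemma smooth_functions_eqI:
  assumes "u \<in> smooth_functions M" "w \<in> smooth_functions M" "\<And>q. q \<notin> bdry M \<Longrightarrow> u q = w q"
  shows "u = w"
  by (intro ext isCont_eq_from_interior)
    (use assms in \<open>auto simp: smooth_functions_iff intro: smooth_at_isCont\<close>)

text \<open>Reduces partial derivatives to functions of one variable. \<open>F\<close> comes from an
  extension and so has a two-sided derivative even when half of the coordinate line leaves the
  half-space; only its values on the remaining half are tied to \<open>f\<close>.\<close>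

lemma pd_directional:
  assumes c: "(U, \<phi>) \<in> M" "p \<in> U" and f: "smooth_at M f p"
  obtains F d where "(F has_real_derivative pd U \<phi> i f p) (at 0)" "d > 0"
    "\<And>t. \<bar>t\<bar> < d \<Longrightarrow> \<phi> p + t *\<^sub>R axis i 1 \<in> half_space \<Longrightarrow>
      \<exists>q\<in>U. \<phi> q = \<phi> p + t *\<^sub>R axis i 1 \<and> F t = f q"
proof -
  obtain W h where W: "open W" "\<phi> p \<in> W" "smooth_on W h" "\<And>q. q \<in> U \<Longrightarrow> \<phi> q \<in> W \<Longrightarrow> f q = h (\<phi> q)"
    using smooth_at_chartE[OF f c] by metis
  obtain r where r: "r > 0" "\<And>z. z \<in> half_space \<Longrightarrow> dist (\<phi> p) z < r \<Longrightarrow> z \<in> \<phi> ` (U \<inter> U)"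
    using chart_ball[OF c chart_open[OF c(1)] c(2)] by metis
  obtain r' where r': "r' > 0" "ball (\<phi> p) r' \<subseteq> W" using W(1,2) by (meson open_contains_ball)
  have D: "(h has_derivative frechet_derivative h (at (\<phi> p))) (at (\<phi> p))"
    using smooth_on_has_derivative[OF W(3,2)] .
  have "((\<lambda>t. \<phi> p + t *\<^sub>R axis i 1) has_vector_derivative axis i 1) (at (0::real))"
    by (auto intro!: derivative_eq_intros)
  then have "((h \<circ> (\<lambda>t. \<phi> p + t *\<^sub>R axis i 1)) has_vector_derivative frechet_derivative h (at (\<phi> p)) (axis i 1)) (at (0::real))"
    by (rule vector_derivative_diff_chain_within) (use D in \<open>auto intro: has_derivative_at_withinI\<close>)
  then have 1: "((h \<circ> (\<lambda>t. \<phi> p + t *\<^sub>R axis i 1)) has_real_derivative pd U \<phi> i f p) (at 0)"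
    by (simp add: has_real_derivative_iff_has_vector_derivative pd_eq[OF c W(1,2) D W(4)])
  show ?thesis
  proof (rule that[OF 1, of "min r r'"])
    fix t :: real assume t: "\<bar>t\<bar> < min r r'" "\<phi> p + t *\<^sub>R axis i 1 \<in> half_space"
    have "dist (\<phi> p) (\<phi> p + t *\<^sub>R axis i 1) = \<bar>t\<bar>" by (simp add: dist_norm)
    then show "\<exists>q\<in>U. \<phi> q = \<phi> p + t *\<^sub>R axis i 1 \<and> (h \<circ> (\<lambda>t. \<phi> p + t *\<^sub>R axis i 1)) t = f q"
      using r(2)[OF t(2)] t(1) W(4) r'(2) by (fastforce simp: subset_iff)
  qed (use r r' in auto)
qed

lemma pd_tangential_eq_0:
  assumes c: "(U, \<phi>) \<in> M" "p \<in> U" "p \<in> bdry M" and f: "smooth_at M f p" "\<And>q. q \<in> bdry M \<Longrightarrow> f q = 0"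
    and i: "i \<noteq> 1"
  shows "pd U \<phi> i f p = 0"
proof -
  obtain F d where F: "(F has_real_derivative pd U \<phi> i f p) (at 0)" "d > 0"
    "\<And>t. \<bar>t\<bar> < d \<Longrightarrow> \<phi> p + t *\<^sub>R axis i 1 \<in> half_space \<Longrightarrow>
      \<exists>q\<in>U. \<phi> q = \<phi> p + t *\<^sub>R axis i 1 \<and> F t = f q"
    using pd_directional[OF c(1,2) f(1), of i] by blast
  have p1: "\<phi> p $ 1 = 0" using boundary_iff[OF c(1,2)] c(3) by simp
  have "F t = 0" if t: "\<bar>t\<bar> < d" for t
  proof -
    have z1: "(\<phi> p + t *\<^sub>R axis i 1) $ 1 = 0" using p1 i by (simp add: axis_def)
    then obtain q where "q \<in> U" "\<phi> q = \<phi> p + t *\<^sub>R axis i 1" "F t = f q"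
      using F(3)[OF t] by (auto simp: half_space_def)
    then show ?thesis using boundary_iff[OF c(1)] f(2) z1 by metis
  qed
  then have "((\<lambda>t. 0) has_real_derivative pd U \<phi> i f p) (at 0)"
    by (intro has_field_derivative_transform_within[OF F(1,2)]) (auto simp: dist_real_def)
  then show ?thesis using DERIV_unique DERIV_const by blast
qed

section \<open>Boundary defining functions and division by them\<close>

lemma bdf_smooth: "bdf M x \<Longrightarrow> x \<in> smooth_functions M"
  and bdf_nonneg: "bdf M x \<Longrightarrow> 0 \<le> x p"
  and bdf_zero_iff: "bdf M x \<Longrightarrow> x p = 0 \<longleftrightarrow> p \<in> bdry M"
  by (auto simp: bdf_def)

lemma bdf_tangent_expansion:
  assumes x: "bdf M x" and p: "p \<in> bdry M" and c: "(U, \<phi>) \<in> M" "p \<in> U" and v: "v \<in> tangent_space M p"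
    and y: "\<And>i. y i \<in> smooth_functions M" "\<And>i. \<forall>\<^sub>F q in nhds p. y i q = \<phi> q $ i"
  shows "v x = v (y 1) * pd U \<phi> 1 x p"
proof -
  have "v x = (\<Sum>i\<in>UNIV. v (y i) * pd U \<phi> i x p)"
    by (rule tangent_expansion[OF c v y bdf_smooth[OF x]])
  also have "\<dots> = (\<Sum>i\<in>(UNIV::4 set). if i = 1 then v (y 1) * pd U \<phi> 1 x p else 0)"
  proof (rule sum.cong)
    fix i
    have "pd U \<phi> i x p = 0" if "i \<noteq> 1"
      by (rule pd_tangential_eq_0[OF c p _ _ that]) (use x bdf_smooth bdf_zero_iff smooth_functions_iff in blast)+
    then show "v (y i) * pd U \<phi> i x p = (if i = 1 then v (y 1) * pd U \<phi> 1 x p else 0)" by simp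
  qed simp
  finally show ?thesis by simp
qed

text \<open>The tangential derivatives of \<open>x\<close> vanish at the boundary, so the normal one
  cannot vanish as well; and it cannot be negative, since \<open>x\<close> would then become
  negative just inside.\<close>

lemma bdf_pd_pos:
  assumes x: "bdf M x" and p: "p \<in> bdry M" and c: "(U, \<phi>) \<in> M" "p \<in> U"
  shows "pd U \<phi> 1 x p > 0"
proof -
  obtain y where y: "\<And>i. y i \<in> smooth_functions M" "\<And>i. \<forall>\<^sub>F q in nhds p. y i q = \<phi> q $ i"
    using coordinate_functions_exist[OF c] by metis
  obtain v where v: "v \<in> tangent_space M p" "v x \<noteq> 0" using x p unfolding bdf_def by blast
  have "v x = v (y 1) * pd U \<phi> 1 x p"
    by (rule bdf_tangent_expansion[OF x p c v(1) y])
  then have ne: "pd U \<phi> 1 x p \<noteq> 0" using v(2) by auto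
  have "smooth_at M x p" using bdf_smooth[OF x] smooth_functions_iff by blast
  then obtain F d where F: "(F has_real_derivative pd U \<phi> 1 x p) (at 0)" "d > 0"
    "\<And>t. \<bar>t\<bar> < d \<Longrightarrow> \<phi> p + t *\<^sub>R axis 1 1 \<in> half_space \<Longrightarrow>
      \<exists>q\<in>U. \<phi> q = \<phi> p + t *\<^sub>R axis 1 1 \<and> F t = x q"
    using pd_directional[OF c, of x 1] by blast
  have hs: "\<phi> p + t *\<^sub>R axis 1 1 \<in> half_space" if "t \<ge> 0" for t
    using that chart_half_space[OF c] by (simp add: half_space_def)
  have "F 0 = 0"
  proof -
    obtain q where "q \<in> U" "\<phi> q = \<phi> p" "F 0 = x q" using F(3)[of 0] F(2) hs[of 0] by auto
    then show ?thesis using boundary_iff[OF c(1)] p c(2) bdf_zero_iff[OF x] by metis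
  qed
  have "\<not> pd U \<phi> 1 x p < 0"
  proof
    assume "pd U \<phi> 1 x p < 0"
    then obtain e where e: "e > 0" "\<And>t. 0 < t \<Longrightarrow> t < e \<Longrightarrow> F (0 + t) < F 0"
      using DERIV_neg_dec_right[OF F(1)] by blast
    define t where "t = min d e / 2"
    have t: "0 < t" "t < e" "t < d" using e(1) F(2) by (auto simp: t_def)
    then obtain q where "F t = x q" using F(3)[of t] hs[of t] by auto
    then show False using e(2)[OF t(1,2)] \<open>F 0 = 0\<close> bdf_nonneg[OF x, of q] by simp
  qed
  with ne show ?thesis by linarith
qed

text \<open>At a boundary point both differentials are positive multiples of that of the first
  coordinate. Hence \<open>K\<close> and the notion of an outward vector do not depend on the
  boundary defining function.\<close>

lemma bdf_ratio:
  assumes x: "bdf M x" and y: "bdf M y" and p: "p \<in> bdry M"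
  obtains k where "k > 0" "\<And>v. v \<in> tangent_space M p \<Longrightarrow> v y = k * v x"
proof -
  obtain U \<phi> where c: "(U, \<phi>) \<in> M" "p \<in> U" by (rule chart_exists)
  obtain z where z: "\<And>i. z i \<in> smooth_functions M" "\<And>i. \<forall>\<^sub>F q in nhds p. z i q = \<phi> q $ i"
    using coordinate_functions_exist[OF c] by metis
  note px = bdf_pd_pos[OF x p c] and py = bdf_pd_pos[OF y p c]
  show ?thesis
  proof
    show "pd U \<phi> 1 y p / pd U \<phi> 1 x p > 0" using px py by simp
    show "v y = pd U \<phi> 1 y p / pd U \<phi> 1 x p * v x" if "v \<in> tangent_space M p" for v
      using bdf_tangent_expansion[OF x p c that z] bdf_tangent_expansion[OF y p c that z] px by simp
  qed
qed

text \<open>Hadamard's lemma for the contraction onto the hyperplane: \<open>f\<close> vanishes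
  there, and only the normal coordinate contributes to the sum.\<close>

lemma boundary_factor:
  assumes c: "(U, \<phi>) \<in> M" "p \<in> U" "p \<in> bdry M" and f: "smooth_at M f p" "\<And>q. q \<in> bdry M \<Longrightarrow> f q = 0"
  obtains G where "smooth_at M G p" "\<forall>\<^sub>F q in nhds p. f q = \<phi> q $ 1 * G q" "G p = pd U \<phi> 1 f p"
proof -
  obtain W h where W: "open W" "\<phi> p \<in> W" "smooth_on W h" "\<And>q. q \<in> U \<Longrightarrow> \<phi> q \<in> W \<Longrightarrow> f q = h (\<phi> q)"
    using smooth_at_chartE[OF f(1) c(1,2)] by metis
  obtain r1 where r1: "r1 > 0" "\<And>z. z \<in> half_space \<Longrightarrow> dist (\<phi> p) z < r1 \<Longrightarrow> z \<in> \<phi> ` (U \<inter> U)"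
    using chart_ball[OF c(1,2) chart_open[OF c(1)] c(2)] by metis
  obtain r2 where r2: "r2 > 0" "ball (\<phi> p) r2 \<subseteq> W" using W(1,2) by (meson open_contains_ball)
  define B where "B = ball (\<phi> p) (min r1 r2)"
  have B: "open B" "convex B" "\<phi> p \<in> B" using r1(1) r2(1) by (auto simp: B_def)
  have "B \<subseteq> W" using r2(2) by (auto simp: B_def)
  then have hB: "smooth_on B h" by (rule smooth_on_subset[OF W(3)])
  \<comment> \<open>The orthogonal projection onto the bounding hyperplane. It fixes the centre and
    does not increase norms, so the ball is mapped into itself.\<close>
  define L where "L = (\<lambda>z::real^4. z - (z $ 1) *\<^sub>R axis 1 1)"
  have L: "linear L" unfolding L_def by (rule linearI) (auto simp: algebra_simps)
  have L1: "L z $ 1 = 0" for z by (simp add: L_def)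
  have p1: "\<phi> p $ 1 = 0" using boundary_iff[OF c(1,2)] c(3) by simp
  have Lp: "L (\<phi> p) = \<phi> p" using p1 by (simp add: L_def)
  have Ln: "norm (L z) \<le> norm z" for z
  proof (rule norm_le_componentwise_cart)
    fix i show "norm (L z $ i) \<le> norm (z $ i)" by (cases "i = 1") (auto simp: L_def axis_def)
  qed
  have LB: "L z \<in> B" if "z \<in> B" for z
  proof -
    have "dist (\<phi> p) (L z) = norm (L (\<phi> p - z))" by (simp add: dist_norm linear_diff[OF L] Lp)
    also have "\<dots> \<le> dist (\<phi> p) z" using Ln by (simp add: dist_norm)
    finally show ?thesis using that by (simp add: B_def)
  qed
  obtain G where G: "\<And>b. b \<in> Basis \<Longrightarrow> smooth_on B (G b)"
    "\<And>z. z \<in> B \<Longrightarrow> h z = h (0 + L z) + (\<Sum>b\<in>Basis. ((z - (0 + L z)) \<bullet> b) * G b z)"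
    "\<And>z b. z \<in> B \<Longrightarrow> 0 + L z = z \<Longrightarrow> G b z = frechet_derivative h (at z) b"
    by (rule smooth_on_Hadamard[OF B(1,2) L _ hB, of 0]) (use LB in simp, blast)
  define H where "H = G (axis 1 1)"
  \<comment> \<open>The projected point lies in the half-space and in the ball, hence is the image
    of a boundary point; there the extension \<open>h\<close> agrees with \<open>f\<close>, which is
    zero.\<close>
  have h0: "h (L z) = 0" if "z \<in> B" for z
  proof -
    have LzB: "L z \<in> B" using LB[OF that] .
    have "L z \<in> half_space" using L1 by (simp add: half_space_def)
    then obtain q where q: "q \<in> U" "L z = \<phi> q" using r1(2)[of "L z"] LzB by (auto simp: B_def)
    then have "f q = h (L z)" using W(4) LzB r2(2) by (auto simp: B_def)
    moreover have "q \<in> bdry M" using boundary_iff[OF c(1) q(1)] q(2) L1 by metis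
    ultimately show ?thesis using f(2) by simp
  qed
  have hH: "h z = z $ 1 * H z" if "z \<in> B" for z
  proof -
    have "(\<Sum>b\<in>Basis. ((z - (0 + L z)) \<bullet> b) * G b z) = (\<Sum>i\<in>(UNIV::4 set). if i = 1 then z $ 1 * H z else 0)"
      unfolding sum_Basis_cart by (rule sum.cong) (auto simp: L_def H_def inner_axis_axis)
    then show ?thesis using G(2)[OF that] h0[OF that] by simp
  qed
  show ?thesis
  proof
    show "smooth_at M (\<lambda>q. H (\<phi> q)) p"
      unfolding H_def by (rule smooth_at_compose[OF B(1) G(1) B(3) smooth_at_chart[OF c(1,2)]]) (simp add: axis_in_Basis_iff)
    have "\<forall>\<^sub>F q in nhds p. q \<in> U \<inter> \<phi> -` B"
      using continuous_open_preimage[OF chart_continuous[OF c(1)] chart_open[OF c(1)] B(1)] c B(3)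
      by (intro eventually_nhds_in_open) auto
    then show "\<forall>\<^sub>F q in nhds p. f q = \<phi> q $ 1 * H (\<phi> q)"
      by eventually_elim (use hH W(4) r2(2) in \<open>auto simp: B_def subset_iff\<close>)
    show "H (\<phi> p) = pd U \<phi> 1 f p"
      using G(3)[OF B(3)] Lp pd_eq[OF c(1,2) W(1,2) smooth_on_has_derivative[OF W(3,2)] W(4)] by (simp add: H_def)
  qed
qed

text \<open>Near the boundary both \<open>f\<close> and \<open>x\<close> are multiples of the normal
  coordinate, and the cofactor of \<open>x\<close> is positive; the quotient of the cofactors is the
  answer. In the interior \<open>x\<close> itself is invertible.\<close>

lemma bdf_division_local:
  assumes x: "bdf M x" and f: "f \<in> smooth_functions M" "\<And>q. q \<in> bdry M \<Longrightarrow> f q = 0"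
  obtains u where "smooth_at M u p" "\<forall>\<^sub>F q in nhds p. f q = x q * u q"
proof (cases "p \<in> bdry M")
  case True
  obtain U \<phi> where c: "(U, \<phi>) \<in> M" "p \<in> U" by (rule chart_exists)
  have fx: "smooth_at M f p" "smooth_at M x p" using f bdf_smooth[OF x] smooth_functions_iff by blast+
  obtain G where G: "smooth_at M G p" "\<forall>\<^sub>F q in nhds p. f q = \<phi> q $ 1 * G q" "G p = pd U \<phi> 1 f p"
    using boundary_factor[OF c True fx(1) f(2)] by metis
  obtain H where H: "smooth_at M H p" "\<forall>\<^sub>F q in nhds p. x q = \<phi> q $ 1 * H q" "H p = pd U \<phi> 1 x p"
    using boundary_factor[OF c True fx(2)] bdf_zero_iff[OF x] by metis
  have Hp: "H p > 0" using H(3) bdf_pd_pos[OF x True c] by simp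
  have "(H \<longlongrightarrow> H p) (nhds p)"
    by (rule isCont_tendsto_nhds[OF smooth_at_isCont[OF H(1)]])
  then have "\<forall>\<^sub>F q in nhds p. H q > 0" using Hp by (rule order_tendstoD)
  with G(2) H(2) have "\<forall>\<^sub>F q in nhds p. f q = x q * (G q * inverse (H q))"
    by eventually_elim auto
  then show ?thesis
    using that smooth_at_mult[OF G(1) smooth_at_inverse[OF Hp H(1)]] by blast
next
  case False
  have sx: "smooth_at M x q" "smooth_at M f q" for q using f bdf_smooth[OF x] smooth_functions_iff by blast+
  have px: "x p > 0" using bdf_nonneg[OF x, of p] bdf_zero_iff[OF x, of p] False by (auto simp: less_le)
  have "(x \<longlongrightarrow> x p) (nhds p)"
    by (rule isCont_tendsto_nhds[OF smooth_at_isCont[OF sx(1)]])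
  then have "\<forall>\<^sub>F q in nhds p. x q > 0" using px by (rule order_tendstoD)
  then have "\<forall>\<^sub>F q in nhds p. f q = x q * (f q * inverse (x q))"
    by eventually_elim auto
  then show ?thesis
    using that smooth_at_mult[OF sx(2) smooth_at_inverse[OF px sx(1)]] by blast
qed

lemma bdf_division_unique:
  assumes x: "bdf M x" and "u \<in> smooth_functions M" "w \<in> smooth_functions M" "\<And>q. x q * u q = x q * w q"
  shows "u = w"
  by (rule smooth_functions_eqI[OF assms(2,3)]) (use assms(4) bdf_zero_iff[OF x] in auto)

text \<open>Two local quotients agree where \<open>x\<close> is nonzero, hence everywhere by
  continuity, so they glue along the diagonal \<open>u q q\<close>.\<close>

lemma bdf_division:
  assumes x: "bdf M x" and f: "f \<in> smooth_functions M" "\<And>q. q \<in> bdry M \<Longrightarrow> f q = 0"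
  obtains u where "u \<in> smooth_functions M" "\<And>q. f q = x q * u q"
proof -
  have "\<exists>u. smooth_at M u p \<and> (\<forall>\<^sub>F q in nhds p. f q = x q * u q)" for p
    using bdf_division_local[OF assms, of p] by blast
  then obtain u where u: "\<And>p. smooth_at M (u p) p" "\<And>p. \<forall>\<^sub>F q in nhds p. f q = x q * u p q"
    by metis
  define w where "w = (\<lambda>q. u q q)"
  have "smooth_at M w p" for p
  proof (rule smooth_at_cong[OF u(1)])
    have "\<forall>\<^sub>F q in nhds p. \<forall>\<^sub>F q' in nhds q. f q' = x q' * u p q'"
      using u(2)[of p] by (simp add: eventually_eventually)
    then show "\<forall>\<^sub>F q in nhds p. u p q = w q"
      using smooth_at_eventually[OF u(1), of p]
    proof eventually_elim
      case (elim q)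
      have "\<forall>\<^sub>F q' in nhds q. q' \<notin> bdry M \<longrightarrow> u p q' = u q q'"
        using elim(1) u(2)[of q]
      proof eventually_elim
        case (elim q')
        then have "x q' * u p q' = x q' * u q q'" by linarith
        then show ?case using bdf_zero_iff[OF x, of q'] by auto
      qed
      then show ?case
        unfolding w_def by (rule isCont_eq_from_interior[OF smooth_at_isCont[OF elim(2)] smooth_at_isCont[OF u(1)]])
    qed
  qed
  moreover have "f q = x q * w q" for q
    using eventually_nhds_x_imp_x[OF u(2)] by (simp add: w_def)
  ultimately show ?thesis using that smooth_functions_iff by blast
qed

end

section \<open>0-vector fields\<close>

text \<open>The field \<open>V / x\<close>. Its value at a boundary point identifies the fibre of
  the 0-tangent bundle with the ordinary tangent space; this is how elements of the fibre are
  computed with below.\<close>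

definition rescale :: "'a::t2_space chart set \<Rightarrow> ('a \<Rightarrow> real) \<Rightarrow> 'a vfield \<Rightarrow> 'a vfield" where
  "rescale M x V = (SOME W. W \<in> vector_fields M \<and> V = vf_scale x W)"

context compact_manifold begin

lemma vector_field_add:
  assumes "V \<in> vector_fields M" "W \<in> vector_fields M"
  shows "vf_add V W \<in> vector_fields M"
  unfolding vector_fields_def vf_add_def
  using tangent_space_linear[of "V p" p "W p" 1 1 for p] assms
  by (auto simp: vector_field_tangent vector_field_smooth intro: smooth_functions_add)

lemma vector_field_scale:
  assumes "V \<in> vector_fields M" "u \<in> smooth_functions M"
  shows "vf_scale u V \<in> vector_fields M"
  unfolding vector_fields_def vf_scale_def
  using assms by (auto simp: vector_field_tangent vector_field_smooth tangent_space_scale intro: smooth_functions_mult)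

lemma zero_vector_field_add:
  "V \<in> zero_vector_fields M \<Longrightarrow> W \<in> zero_vector_fields M \<Longrightarrow> vf_add V W \<in> zero_vector_fields M"
  using vector_field_add[of V W] unfolding zero_vector_fields_def by (auto simp: vf_add_def)

lemma zero_vector_field_scale:
  "V \<in> zero_vector_fields M \<Longrightarrow> u \<in> smooth_functions M \<Longrightarrow> vf_scale u V \<in> zero_vector_fields M"
  using vector_field_scale[of V u] unfolding zero_vector_fields_def by (auto simp: vf_scale_def)

lemma zero_vector_field_vector_field: "V \<in> zero_vector_fields M \<Longrightarrow> V \<in> vector_fields M"
  by (simp add: zero_vector_fields_def)

lemma zero_vector_field_at_boundary: "V \<in> zero_vector_fields M \<Longrightarrow> p \<in> bdry M \<Longrightarrow> V p f = 0"
  by (simp add: zero_vector_fields_def)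

lemma bdf_scale_zero_vector_field:
  assumes "bdf M x" "V \<in> vector_fields M"
  shows "vf_scale x V \<in> zero_vector_fields M"
  unfolding zero_vector_fields_def
  using vector_field_scale[OF assms(2) bdf_smooth[OF assms(1)]] bdf_zero_iff[OF assms(1)]
  by (auto simp: vf_scale_def)

lemma vector_field_linear:
  assumes "V \<in> vector_fields M" "f \<in> smooth_functions M" "g \<in> smooth_functions M"
  shows "V p (\<lambda>q. a * f q + b * g q) = a * V p f + b * V p g"
    "V p (\<lambda>q. f q * g q) = f p * V p g + g p * V p f"
  using tangent_linear tangent_mult vector_field_tangent[OF assms(1)] assms(2,3) by blast+

lemma lie_bracket_vector_field:
  assumes V: "V \<in> vector_fields M" and W: "W \<in> vector_fields M"
  shows "lie_bracket M V W \<in> vector_fields M"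
proof -
  note s = smooth_functions_const smooth_functions_mult smooth_functions_add smooth_functions_diff
    vector_field_smooth[OF V] vector_field_smooth[OF W]
  have lin: "lie_bracket M V W p (\<lambda>q. a * f q + b * h q) = a * lie_bracket M V W p f + b * lie_bracket M V W p h"
    if f: "f \<in> smooth_functions M" and h: "h \<in> smooth_functions M" for p f h a b
  proof -
    have "(\<lambda>q. a * f q + b * h q) \<in> smooth_functions M" using f h by (intro s)
    then show ?thesis
      using f h by (simp add: lie_bracket_def vector_field_linear[OF V] vector_field_linear[OF W] s algebra_simps)
  qed
  have mult: "lie_bracket M V W p (\<lambda>q. f q * h q) = f p * lie_bracket M V W p h + h p * lie_bracket M V W p f"
    if f: "f \<in> smooth_functions M" and h: "h \<in> smooth_functions M" for p f h
  proof -
    have fh: "(\<lambda>q. f q * h q) \<in> smooth_functions M" using f h by (intro s)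
    have 1: "V p (\<lambda>q. f q * W q h + h q * W q f) = V p (\<lambda>q. f q * W q h) + V p (\<lambda>q. h q * W q f)"
      using vector_field_linear(1)[OF V, of "\<lambda>q. f q * W q h" "\<lambda>q. h q * W q f" p 1 1] f h by (simp add: s)
    have 2: "W p (\<lambda>q. f q * V q h + h q * V q f) = W p (\<lambda>q. f q * V q h) + W p (\<lambda>q. h q * V q f)"
      using vector_field_linear(1)[OF W, of "\<lambda>q. f q * V q h" "\<lambda>q. h q * V q f" p 1 1] f h by (simp add: s)
    show ?thesis
      using f h fh 1 2
      by (simp add: lie_bracket_def vector_field_linear(2)[OF V] vector_field_linear(2)[OF W] s algebra_simps)
  qed
  show ?thesis
    unfolding vector_fields_def tangent_space_def
    using lin mult by (auto simp: lie_bracket_def s)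
qed

text \<open>Each function \<open>V f\<close> vanishes on the boundary and can be divided by
  \<open>x\<close>. Quotients are unique, so the quotients inherit linearity and the product rule
  from \<open>V\<close>.\<close>

lemma rescale_exists:
  assumes x: "bdf M x" and V: "V \<in> zero_vector_fields M"
  shows "\<exists>W. W \<in> vector_fields M \<and> V = vf_scale x W"
proof -
  have V': "V \<in> vector_fields M" using V by (rule zero_vector_field_vector_field)
  have "\<exists>u. u \<in> smooth_functions M \<and> (\<forall>q. V q f = x q * u q)" if "f \<in> smooth_functions M" for f
    using bdf_division[OF x vector_field_smooth[OF V' that]] zero_vector_field_at_boundary[OF V] by metis
  then obtain u where u: "\<And>f. f \<in> smooth_functions M \<Longrightarrow> u f \<in> smooth_functions M"
    "\<And>f q. f \<in> smooth_functions M \<Longrightarrow> V q f = x q * u f q" by metis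
  define W where "W = (\<lambda>q f. if f \<in> smooth_functions M then u f q else 0)"
  note s = smooth_functions_const smooth_functions_mult smooth_functions_add u(1)
  have lin: "u (\<lambda>q. a * f q + b * h q) = (\<lambda>q. a * u f q + b * u h q)"
    if f: "f \<in> smooth_functions M" and h: "h \<in> smooth_functions M" for f h a b
  proof (rule bdf_division_unique[OF x])
    fix q
    have "(\<lambda>q. a * f q + b * h q) \<in> smooth_functions M" using f h by (intro s)
    then have "x q * u (\<lambda>q. a * f q + b * h q) q = V q (\<lambda>q. a * f q + b * h q)" by (simp add: u(2))
    also have "\<dots> = x q * (a * u f q + b * u h q)"
      using f h by (simp add: vector_field_linear(1)[OF V'] u(2) algebra_simps)
    finally show "x q * u (\<lambda>q. a * f q + b * h q) q = x q * (a * u f q + b * u h q)" .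
  qed (use f h in \<open>auto intro!: s\<close>)
  have mult: "u (\<lambda>q. f q * h q) = (\<lambda>q. f q * u h q + h q * u f q)"
    if f: "f \<in> smooth_functions M" and h: "h \<in> smooth_functions M" for f h
  proof (rule bdf_division_unique[OF x])
    fix q
    have "(\<lambda>q. f q * h q) \<in> smooth_functions M" using f h by (intro s)
    then have "x q * u (\<lambda>q. f q * h q) q = V q (\<lambda>q. f q * h q)" by (simp add: u(2))
    also have "\<dots> = x q * (f q * u h q + h q * u f q)"
      using f h by (simp add: vector_field_linear(2)[OF V'] u(2) algebra_simps)
    finally show "x q * u (\<lambda>q. f q * h q) q = x q * (f q * u h q + h q * u f q)" .
  qed (use f h in \<open>auto intro!: s\<close>)
  have "W \<in> vector_fields M"
    unfolding vector_fields_def tangent_space_def W_def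
    using lin mult s by auto
  moreover have "V = vf_scale x W"
    using u(2) tangent_nonsmooth[OF vector_field_tangent[OF V']] by (auto simp: vf_scale_def W_def fun_eq_iff)
  ultimately show ?thesis by blast
qed

lemma
  assumes "bdf M x" "V \<in> zero_vector_fields M"
  shows rescale_vector_field: "rescale M x V \<in> vector_fields M"
    and vf_scale_rescale: "vf_scale x (rescale M x V) = V"
  using someI_ex[OF rescale_exists[OF assms]] unfolding rescale_def by auto

lemma vector_field_eqI:
  assumes "V \<in> vector_fields M" "W \<in> vector_fields M"
    "\<And>f. f \<in> smooth_functions M \<Longrightarrow> (\<lambda>q. V q f) = (\<lambda>q. W q f)"
  shows "V = W"
proof (intro ext)
  fix q f
  show "V q f = W q f"
    using assms(3)[of f, THEN fun_cong, of q] tangent_nonsmooth vector_field_tangent[OF assms(1)] vector_field_tangent[OF assms(2)]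
    by (cases "f \<in> smooth_functions M") metis+
qed

lemma vf_scale_cancel:
  assumes x: "bdf M x" and V: "V \<in> vector_fields M" and W: "W \<in> vector_fields M"
    and eq: "vf_scale x V = vf_scale x W"
  shows "V = W"
proof (rule vector_field_eqI[OF V W])
  fix f assume f: "f \<in> smooth_functions M"
  show "(\<lambda>q. V q f) = (\<lambda>q. W q f)"
    by (rule bdf_division_unique[OF x vector_field_smooth[OF V f] vector_field_smooth[OF W f]])
      (use eq in \<open>auto simp: vf_scale_def fun_eq_iff\<close>)
qed

lemma rescale_unique:
  assumes x: "bdf M x" and W: "W \<in> vector_fields M"
  shows "rescale M x (vf_scale x W) = W"
  using vf_scale_cancel[OF x rescale_vector_field W vf_scale_rescale] bdf_scale_zero_vector_field[OF x W] x by blast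

lemma rescale_tangent:
  "bdf M x \<Longrightarrow> V \<in> zero_vector_fields M \<Longrightarrow> rescale M x V p \<in> tangent_space M p"
  using rescale_vector_field vector_field_tangent by blast

lemma zero_vector_field_apply:
  "bdf M x \<Longrightarrow> V \<in> zero_vector_fields M \<Longrightarrow> V p f = x p * rescale M x V p f"
  using vf_scale_rescale[of x V] unfolding vf_scale_def by metis

lemma rescale_add:
  assumes x: "bdf M x" and V: "V \<in> zero_vector_fields M" and W: "W \<in> zero_vector_fields M"
  shows "rescale M x (vf_add V W) = vf_add (rescale M x V) (rescale M x W)"
proof -
  have "vf_add V W = vf_scale x (vf_add (rescale M x V) (rescale M x W))"
    using zero_vector_field_apply[OF x V] zero_vector_field_apply[OF x W]
    by (simp add: vf_add_def vf_scale_def fun_eq_iff distrib_left)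
  then show ?thesis
    using rescale_unique[OF x vector_field_add[OF rescale_vector_field[OF x V] rescale_vector_field[OF x W]]] by simp
qed

lemma rescale_scale:
  assumes x: "bdf M x" and V: "V \<in> zero_vector_fields M" and u: "u \<in> smooth_functions M"
  shows "rescale M x (vf_scale u V) = vf_scale u (rescale M x V)"
proof -
  have "vf_scale u V = vf_scale x (vf_scale u (rescale M x V))"
    using zero_vector_field_apply[OF x V]
    by (simp add: vf_scale_def fun_eq_iff)
  then show ?thesis
    using rescale_unique[OF x vector_field_scale[OF rescale_vector_field[OF x V] u]] by simp
qed

text \<open>A transversal vector \<open>n\<close> is applied to the two expressions
  \<open>x (V/x) f\<close> and \<open>y (V/y) f\<close> of the same function. Since \<open>x\<close>
  and \<open>y\<close> vanish at \<open>p\<close>, only the derivatives of \<open>x\<close> and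
  \<open>y\<close> survive, and these differ by the factor \<open>k\<close>.\<close>

lemma rescale_ratio:
  assumes x: "bdf M x" and y: "bdf M y" and p: "p \<in> bdry M"
  obtains k where "k > 0" "\<And>v. v \<in> tangent_space M p \<Longrightarrow> v y = k * v x"
    "\<And>V f. V \<in> zero_vector_fields M \<Longrightarrow> rescale M x V p f = k * rescale M y V p f"
proof -
  obtain k where k: "k > 0" "\<And>v. v \<in> tangent_space M p \<Longrightarrow> v y = k * v x"
    using bdf_ratio[OF assms] by metis
  obtain n where n: "n \<in> tangent_space M p" "n x \<noteq> 0" using x p unfolding bdf_def by blast
  have 0: "x p = 0" "y p = 0" using bdf_zero_iff x y p by blast+
  show ?thesis
  proof (rule that[OF k])
    fix V f assume V: "V \<in> zero_vector_fields M"
    note Vx = rescale_vector_field[OF x V] and Vy = rescale_vector_field[OF y V]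
    show "rescale M x V p f = k * rescale M y V p f"
    proof (cases "f \<in> smooth_functions M")
      case True
      have "(\<lambda>q. x q * rescale M x V q f) = (\<lambda>q. y q * rescale M y V q f)"
        using zero_vector_field_apply[OF x V, of _ f] zero_vector_field_apply[OF y V, of _ f] by (simp add: fun_eq_iff)
      then have "n (\<lambda>q. x q * rescale M x V q f) = n (\<lambda>q. y q * rescale M y V q f)" by simp
      then have "n x * rescale M x V p f = n y * rescale M y V p f"
        using tangent_mult[OF n(1) bdf_smooth[OF x] vector_field_smooth[OF Vx True]]
          tangent_mult[OF n(1) bdf_smooth[OF y] vector_field_smooth[OF Vy True]] 0 by (simp add: mult.commute)
      then show ?thesis using n k(2)[OF n(1)] by simp
    next
      case False
      then show ?thesis using tangent_nonsmooth[OF rescale_tangent] x y V by simp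
    qed
  qed
qed

lemma dlog_eq:
  assumes x: "bdf M x" and V: "V \<in> zero_vector_fields M"
  shows "dlog M x V = (\<lambda>q. rescale M x V q x)"
  unfolding dlog_def
proof (rule the_equality)
  show "(\<lambda>q. rescale M x V q x) \<in> smooth_functions M \<and> (\<forall>q. V q x = x q * rescale M x V q x)"
    using vector_field_smooth[OF rescale_vector_field[OF x V] bdf_smooth[OF x]] zero_vector_field_apply[OF x V] by blast
  then show "u = (\<lambda>q. rescale M x V q x)" if "u \<in> smooth_functions M \<and> (\<forall>q. V q x = x q * u q)" for u
    using bdf_division_unique[OF x] that by metis
qed

text \<open>The existential over boundary defining functions in \<open>K_fibre\<close> is replaced
  by a fixed one; changing it multiplies both the rescaled field and the differential by positive
  numbers.\<close>

lemma K_fibre_iff: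
  assumes x: "bdf M x" and p: "p \<in> bdry M"
  shows "V \<in> K_fibre M p \<longleftrightarrow> V \<in> zero_vector_fields M \<and> rescale M x V p x = 0"
proof
  assume "V \<in> K_fibre M p"
  then obtain y where V: "V \<in> zero_vector_fields M" and y: "bdf M y" "dlog M y V p = 0"
    unfolding K_fibre_def by blast
  obtain k where k: "k > 0" "\<And>v. v \<in> tangent_space M p \<Longrightarrow> v y = k * v x"
    "\<And>V f. V \<in> zero_vector_fields M \<Longrightarrow> rescale M x V p f = k * rescale M y V p f"
    using rescale_ratio[OF x y(1) p] by metis
  have "rescale M y V p y = 0" using y dlog_eq[OF y(1) V] by simp
  then show "V \<in> zero_vector_fields M \<and> rescale M x V p x = 0"
    using V k(1) k(2)[OF rescale_tangent[OF y(1) V]] k(3)[OF V] by simp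
next
  assume "V \<in> zero_vector_fields M \<and> rescale M x V p x = 0"
  then show "V \<in> K_fibre M p" unfolding K_fibre_def using x dlog_eq[OF x] by auto
qed

lemma tangent_extension:
  assumes v: "v \<in> tangent_space M p"
  obtains V where "V \<in> vector_fields M" "V p = v"
proof -
  obtain U \<phi> where c: "(U, \<phi>) \<in> M" "p \<in> U" by (rule chart_exists)
  obtain X :: "4 \<Rightarrow> 'a vfield" and y N where X: "open N" "p \<in> N" "N \<subseteq> U" "\<And>i. X i \<in> vector_fields M" "\<And>i. y i \<in> smooth_functions M"
    "\<And>q v. q \<in> N \<Longrightarrow> v \<in> tangent_space M q \<Longrightarrow> v = (\<lambda>f. \<Sum>i\<in>UNIV. v (y i) * X i q f)"
    by (rule local_frame[OF c]) blast
  define V where "V = (\<lambda>q f. \<Sum>i\<in>UNIV. v (y i) * X i q f)"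
  have "V \<in> vector_fields M"
    unfolding vector_fields_def V_def
  proof (intro CollectI conjI allI ballI)
    show "(\<lambda>f. \<Sum>i\<in>UNIV. v (y i) * X i q f) \<in> tangent_space M q" for q
      by (rule tangent_space_sum[OF vector_field_tangent[OF X(4)]])
    show "(\<lambda>q. \<Sum>i\<in>UNIV. v (y i) * X i q f) \<in> smooth_functions M" if "f \<in> smooth_functions M" for f
      by (rule smooth_functions_sum[OF smooth_functions_mult[OF smooth_functions_const vector_field_smooth[OF X(4) that]]])
  qed
  moreover have "V p = v" using X(6)[OF X(2) v] by (simp add: V_def)
  ultimately show ?thesis using that by blast
qed

text \<open>Split \<open>V\<close> as \<open>\<beta> V + (1 - \<beta>) V\<close>. In the first part
  \<open>V / x\<close> is expanded in a local frame, and its coefficients vanish at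
  \<open>p\<close>; in the second the factor \<open>1 - \<beta>\<close> does.\<close>

lemma zero_nullI:
  assumes x: "bdf M x" and V: "V \<in> zero_vector_fields M" and 0: "rescale M x V p = (\<lambda>f. 0)"
  shows "V \<in> zero_null M p"
proof -
  obtain U \<phi> where c: "(U, \<phi>) \<in> M" "p \<in> U" by (rule chart_exists)
  obtain X :: "4 \<Rightarrow> 'a vfield" and y N where X: "open N" "p \<in> N" "N \<subseteq> U" "\<And>i. X i \<in> vector_fields M" "\<And>i. y i \<in> smooth_functions M"
    "\<And>q v. q \<in> N \<Longrightarrow> v \<in> tangent_space M q \<Longrightarrow> v = (\<lambda>f. \<Sum>i\<in>UNIV. v (y i) * X i q f)"
    by (rule local_frame[OF c]) blast
  obtain \<beta> K where \<beta>: "\<beta> \<in> smooth_functions M" "\<And>q. 0 \<le> \<beta> q" "closed K" "K \<subseteq> N"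
    "\<And>q. q \<notin> K \<Longrightarrow> \<beta> q = 0" "\<forall>\<^sub>F q in nhds p. \<beta> q = 1"
    using bump_exists[OF X(1,2)] by metis
  define W where "W = rescale M x V"
  have W: "W \<in> vector_fields M" unfolding W_def using rescale_vector_field[OF x V] .
  have \<beta>p: "\<beta> p = 1" using eventually_nhds_x_imp_x[OF \<beta>(6)] .
  \<comment> \<open>\<open>zero_null\<close> sums over initial segments of the naturals: slots 0 to
    3 run through the frame, with slot 0 standing for the index 4, and slot 4 holds the remainder
    \<open>(1 - \<beta>) V\<close>.\<close>
  define ix where "ix = (\<lambda>k::nat. if k = 0 then 4 else if k = 1 then 1 else if k = 2 then 2 else (3::4))"
  define f where "f = (\<lambda>k q. if k < 4 then \<beta> q * W q (y (ix k)) else 1 - \<beta> q)"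
  define Z where "Z = (\<lambda>k. if k < 4 then vf_scale x (X (ix k)) else V)"
  have s4: "(\<Sum>k<4. F (ix k)) = (\<Sum>i\<in>UNIV. F i)" for F :: "4 \<Rightarrow> real"
    unfolding sum_4 by (simp add: eval_nat_numeral ix_def)
  have f_smooth: "f k \<in> smooth_functions M" for k
    unfolding f_def using \<beta>(1) vector_field_smooth[OF W X(5)]
    by (cases "k < 4") (auto intro: smooth_functions_mult smooth_functions_diff smooth_functions_const)
  have fp: "f k p = 0" for k
    using \<beta>p 0 by (simp add: f_def W_def)
  have Z: "Z k \<in> zero_vector_fields M" for k
    unfolding Z_def using bdf_scale_zero_vector_field[OF x X(4)] V by simp
  have \<beta>W: "\<beta> q * W q h = (\<Sum>i\<in>UNIV. \<beta> q * W q (y i) * X i q h)" for q h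
  proof (cases "q \<in> N")
    case True
    then have "W q h = (\<Sum>i\<in>UNIV. W q (y i) * X i q h)"
      using X(6)[OF True vector_field_tangent[OF W], THEN fun_cong, of h] by simp
    then show ?thesis by (simp add: sum_distrib_left mult.assoc)
  next
    case False
    then have "\<beta> q = 0" using \<beta>(4,5) by blast
    then show ?thesis by simp
  qed
  have "V = (\<lambda>q h. \<Sum>k<5. f k q * Z k q h)"
  proof (intro ext)
    fix q h
    have "(\<Sum>k<5. f k q * Z k q h) = (\<Sum>k<4. f k q * Z k q h) + f 4 q * Z 4 q h"
      using sum.lessThan_Suc[of "\<lambda>k. f k q * Z k q h" 4] by (simp add: eval_nat_numeral)
    also have "(\<Sum>k<4. f k q * Z k q h) = (\<Sum>k<4. \<beta> q * W q (y (ix k)) * (x q * X (ix k) q h))"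
      by (rule sum.cong) (auto simp: f_def Z_def vf_scale_def)
    also have "\<dots> = (\<Sum>i\<in>UNIV. \<beta> q * W q (y i) * (x q * X i q h))"
      by (rule s4)
    also have "\<dots> = x q * (\<beta> q * W q h)"
      unfolding \<beta>W[of q h] by (simp add: sum_distrib_left mult_ac)
    finally show "V q h = (\<Sum>k<5. f k q * Z k q h)"
      using zero_vector_field_apply[OF x V, of q h] by (simp add: f_def Z_def W_def algebra_simps)
  qed
  then show ?thesis
    unfolding zero_null_def using f_smooth fp Z by (intro CollectI exI[of _ 5] exI[of _ f] exI[of _ Z]) auto
qed

end

section \<open>Metric and orientation\<close>

context compact_manifold begin

text \<open>\<open>positive_basis\<close> asks for some chart. The matrices in two charts differ by
  the Jacobian of the transition map, whose determinant is positive in an oriented atlas, so any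
  chart and any extension of its coordinates may be used.\<close>

lemma positive_basis_chart:
  assumes v: "positive_basis M p v" and c: "(U, \<phi>) \<in> M" "p \<in> U"
    and y: "\<And>i. y i \<in> smooth_functions M" "\<And>i. \<forall>\<^sub>F q in nhds p. y i q = \<phi> q $ i"
  shows "det ((\<chi> i j. v j (y i)) :: real^4^4) > 0"
proof -
  obtain U' \<phi>' z where c': "(U', \<phi>') \<in> M" "p \<in> U'"
    and z: "\<And>i. z i \<in> smooth_functions M" "\<And>i. \<forall>\<^sub>F q in nhds p. z i q = \<phi>' q $ i"
    and d: "det ((\<chi> i j. v j (z i)) :: real^4^4) > 0"
    using v unfolding positive_basis_def by blast
  have vT: "v j \<in> tangent_space M p" for j using v unfolding positive_basis_def by blast
  obtain W T where W: "open W" "\<phi>' p \<in> W" "smooth_on W T"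
    "\<And>q. q \<in> U' \<Longrightarrow> \<phi>' q \<in> W \<Longrightarrow> q \<in> U \<and> \<phi> q = T (\<phi>' q)"
    using chart_transition[OF c'(1) c(1) c'(2) c(2)] by blast
  define D where "D = frechet_derivative T (at (\<phi>' p))"
  have D: "(T has_derivative D) (at (\<phi>' p))" unfolding D_def by (rule smooth_on_has_derivative[OF W(3,2)])
  have fD: "frechet_derivative (\<phi> \<circ> inv_into U' \<phi>') (at (\<phi>' p) within half_space) = D"
    by (rule chart_frechet_derivative[OF c' W(1,2) D]) (use W(4) in blast)
  have "\<phi>' p \<in> \<phi>' ` (U' \<inter> U)" using c c' by blast
  then have "det (matrix (frechet_derivative (\<phi> \<circ> inv_into U' \<phi>') (at (\<phi>' p) within half_space))) > 0"
    using manifold c(1) c'(1) unfolding oriented_manifold_with_boundary_def by fastforce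
  then have dJ: "det (matrix D) > 0" unfolding fD .
  have pdD: "pd U' \<phi>' k (y i) p = matrix D $ i $ k" for i k
  proof -
    have "pd U' \<phi>' k (y i) p = pd U' \<phi>' k (\<lambda>q. \<phi> q $ i) p"
      by (rule pd_cong[OF c' _ y(2)]) (use y(1) smooth_functions_iff in blast)
    also have "\<dots> = D (axis k 1) $ i"
      by (rule pd_eq[OF c' W(1,2) has_derivative_compose[OF D bounded_linear_imp_has_derivative[OF bounded_linear_vec_nth]]])
        (use W(4) in simp)
    finally show ?thesis by (simp add: matrix_def)
  qed
  have "(\<chi> i j. v j (y i)) = matrix D ** (\<chi> i j. v j (z i))"
    using tangent_expansion[OF c' vT z y(1)]
    by (simp add: matrix_matrix_mult_def vec_eq_iff pdD mult.commute)
  then show ?thesis using d dJ by (simp add: det_mul)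
qed

lemma positive_basis_tangent: "positive_basis M p v \<Longrightarrow> v i \<in> tangent_space M p"
  by (simp add: positive_basis_def)

lemma positive_basis_combination:
  assumes v: "positive_basis M p v" and w: "\<And>j. w j = (\<lambda>f. \<Sum>k\<in>UNIV. C j k * v k f)"
  shows "positive_basis M p w \<longleftrightarrow> det ((\<chi> j k. C j k) :: real^4^4) > 0"
proof -
  obtain U \<phi> where c: "(U, \<phi>) \<in> M" "p \<in> U" by (rule chart_exists)
  obtain y where y: "\<And>i. y i \<in> smooth_functions M" "\<And>i. \<forall>\<^sub>F q in nhds p. y i q = \<phi> q $ i"
    using coordinate_functions_exist[OF c] by metis
  have pos: "det ((\<chi> i j. v j (y i)) :: real^4^4) > 0"
    by (rule positive_basis_chart[OF v c y])
  have wT: "w j \<in> tangent_space M p" for j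
    unfolding w by (intro tangent_space_sum positive_basis_tangent[OF v])
  have "(\<chi> i j. w j (y i)) = (\<chi> i j. v j (y i)) ** transpose (\<chi> j k. C j k)"
    by (simp add: matrix_matrix_mult_def vec_eq_iff w transpose_def mult.commute)
  then have dw: "det (\<chi> i j. w j (y i)) = det (\<chi> i j. v j (y i)) * det (\<chi> j k. C j k)"
    by (simp add: det_mul)
  show ?thesis
  proof
    assume "positive_basis M p w"
    then have "det ((\<chi> i j. w j (y i)) :: real^4^4) > 0" by (rule positive_basis_chart[OF _ c y])
    then show "det (\<chi> j k. C j k) > 0" using pos dw by (simp add: zero_less_mult_iff)
  next
    assume "det ((\<chi> j k. C j k) :: real^4^4) > 0"
    then have "det (\<chi> i j. w j (y i)) > 0" using pos dw by simp
    then show "positive_basis M p w"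
      unfolding positive_basis_def using wT c y by blast
  qed
qed

lemma positive_basis_spans:
  assumes v: "positive_basis M p v" and w: "w \<in> tangent_space M p"
  obtains c where "w = (\<lambda>f. \<Sum>k\<in>UNIV. c k * v k f)"
proof -
  obtain U \<phi> where c: "(U, \<phi>) \<in> M" "p \<in> U" by (rule chart_exists)
  obtain y where y: "\<And>i. y i \<in> smooth_functions M" "\<And>i. \<forall>\<^sub>F q in nhds p. y i q = \<phi> q $ i"
    using coordinate_functions_exist[OF c] by metis
  define A where "A = ((\<chi> i j. v j (y i)) :: real^4^4)"
  have "det A > 0" unfolding A_def by (rule positive_basis_chart[OF v c y])
  then have "invertible A" by (simp add: invertible_det_nz)
  then obtain B where "A ** B = mat 1" unfolding invertible_def by blast
  define k where "k = B *v (\<chi> i. w (y i))"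
  have "A *v k = (\<chi> i. w (y i))"
    using \<open>A ** B = mat 1\<close> by (simp add: k_def matrix_vector_mul_assoc)
  then have wy: "w (y i) = (\<Sum>j\<in>UNIV. k $ j * v j (y i))" for i
    by (simp add: A_def matrix_vector_mult_def vec_eq_iff mult.commute)
  define w' where "w' = (\<lambda>f. \<Sum>j\<in>UNIV. k $ j * v j f)"
  have w': "w' \<in> tangent_space M p"
    unfolding w'_def by (intro tangent_space_sum positive_basis_tangent[OF v])
  have "w = w'"
  proof
    fix f
    show "w f = w' f"
      using tangent_expansion[OF c w y, of f] tangent_expansion[OF c w' y, of f] wy
        tangent_nonsmooth[OF w, of f] tangent_nonsmooth[OF w', of f]
      by (cases "f \<in> smooth_functions M") (auto simp: w'_def)
  qed
  then show ?thesis using that unfolding w'_def by blast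
qed

lemma positive_basis_exists: obtains v where "positive_basis M p v"
proof -
  obtain U \<phi> where c: "(U, \<phi>) \<in> M" "p \<in> U" by (rule chart_exists)
  obtain X :: "4 \<Rightarrow> 'a vfield" and y N where X: "p \<in> N" "\<And>i. X i \<in> vector_fields M" "\<And>i. y i \<in> smooth_functions M"
    "\<And>i q. q \<in> N \<Longrightarrow> \<forall>\<^sub>F q' in nhds q. y i q' = \<phi> q' $ i"
    "\<And>i j q. q \<in> N \<Longrightarrow> X i q (y j) = (if i = j then 1 else 0)"
    by (rule local_frame[OF c]) blast
  have "(\<chi> i j. X j p (y i)) = (mat 1 :: real^4^4)"
    by (simp add: X(5)[OF X(1)] mat_def vec_eq_iff)
  then have "det ((\<chi> i j. X j p (y i)) :: real^4^4) > 0" by simp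
  then have "positive_basis M p (\<lambda>i. X i p)"
    unfolding positive_basis_def using vector_field_tangent[OF X(2)] c X(1,3,4) by blast
  then show ?thesis by (rule that)
qed

end

section \<open>The compactified metric and its orthonormal frames\<close>

locale asymptotically_hyperbolic_manifold = compact_manifold M for M :: "'a::t2_space chart set" +
  fixes g :: "'a metric_field" and x :: "'a \<Rightarrow> real" and h :: "'a metric_field"
  assumes interior_metric: "riemannian_metric_on M (- bdry M) g"
    and compactification: "compactification M g x h"
    and differential_norm: "\<And>p. p \<in> bdry M \<Longrightarrow> differential_norm_sq M h p x = 1"
begin

lemma x_bdf: "bdf M x"
  and h_metric: "riemannian_metric_on M UNIV h"
  using compactification by (auto simp: compactification_def)

abbreviation rs :: "'a vfield \<Rightarrow> 'a vfield" where "rs \<equiv> rescale M x"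

lemmas rs_vector_field = rescale_vector_field[OF x_bdf]
  and rs_tangent = rescale_tangent[OF x_bdf]

lemma h_sym: "v \<in> tangent_space M p \<Longrightarrow> w \<in> tangent_space M p \<Longrightarrow> h p v w = h p w v"
  and h_pos: "v \<in> tangent_space M p \<Longrightarrow> v \<noteq> (\<lambda>f. 0) \<Longrightarrow> h p v v > 0"
  and h_linear: "u \<in> tangent_space M p \<Longrightarrow> v \<in> tangent_space M p \<Longrightarrow> w \<in> tangent_space M p \<Longrightarrow>
    h p (\<lambda>f. a * u f + b * v f) w = a * h p u w + b * h p v w"
  using h_metric unfolding riemannian_metric_on_def by blast+

lemma h_zero: "w \<in> tangent_space M p \<Longrightarrow> h p (\<lambda>f. 0) w = 0"
  using h_linear[of w p w w 0 0] by simp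

lemma h_sum:
  assumes "w \<in> tangent_space M p" "\<And>i. i \<in> I \<Longrightarrow> v i \<in> tangent_space M p"
  shows "h p (\<lambda>f. \<Sum>i\<in>I. c i * v i f) w = (\<Sum>i\<in>I. c i * h p (v i) w)"
  using assms(2)
proof (induction I rule: infinite_finite_induct)
  case (insert j I)
  have "(\<lambda>f. \<Sum>i\<in>I. c i * v i f) \<in> tangent_space M p" using insert by (intro tangent_space_sum) auto
  then show ?case
    using insert h_linear[of "v j" p "\<lambda>f. \<Sum>i\<in>I. c i * v i f" w "c j" 1] assms(1) by simp
qed (auto simp: h_zero[OF assms(1)])

text \<open>In the interior \<open>g(x V', x W') = x^2 g(V', W') = h(V', W')\<close>, and the last
  expression is smooth up to the boundary. Thus the 0-metric is \<open>h\<close> evaluated on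
  rescaled fields.\<close>

lemma zero_metric_eq:
  assumes V: "V \<in> zero_vector_fields M" and W: "W \<in> zero_vector_fields M"
  shows "zero_metric M g V W = (\<lambda>p. h p (rs V p) (rs W p))"
    and "(\<lambda>p. h p (rs V p) (rs W p)) \<in> smooth_functions M"
proof -
  let ?u = "\<lambda>p. h p (rs V p) (rs W p)"
  show s: "?u \<in> smooth_functions M"
    using h_metric rs_vector_field[OF V] rs_vector_field[OF W]
    unfolding riemannian_metric_on_def smooth_functions_def by blast
  have i: "?u p = g p (V p) (W p)" if p: "p \<notin> bdry M" for p
  proof -
    note v = rs_tangent[OF V, of p] and w = rs_tangent[OF W, of p]
    have g_lin: "g p (\<lambda>f. a * u f + b * v f) w = a * g p u w + b * g p v w"
      and g_sym: "g p u w = g p w u"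
      if "u \<in> tangent_space M p" "v \<in> tangent_space M p" "w \<in> tangent_space M p" for u v w a b
      using interior_metric that p unfolding riemannian_metric_on_def by blast+
    have Vp: "V p = (\<lambda>f. x p * rs V p f)" and Wp: "W p = (\<lambda>f. x p * rs W p f)"
      using zero_vector_field_apply[OF x_bdf V] zero_vector_field_apply[OF x_bdf W] by auto
    have wT: "W p \<in> tangent_space M p" using zero_vector_field_vector_field[OF W] vector_field_tangent by blast
    have "g p (V p) (W p) = x p * g p (rs V p) (W p)"
      using g_lin[OF v v wT, of "x p" 0] by (simp add: Vp)
    also have "\<dots> = x p * (x p * g p (rs W p) (rs V p))"
      using g_sym[OF v v wT] g_lin[OF w w v, of "x p" 0] by (simp add: Wp)
    also have "\<dots> = ?u p"
      using compactification p v w g_sym[OF v v w] unfolding compactification_def by (simp add: power2_eq_square)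
    finally show ?thesis by simp
  qed
  show "zero_metric M g V W = ?u"
    unfolding zero_metric_def
    by (rule the_equality) (use s i smooth_functions_eqI in auto)
qed

definition orthonormal :: "'a \<Rightarrow> (4 \<Rightarrow> 'a tangent) \<Rightarrow> bool" where
  "orthonormal p b \<longleftrightarrow> positive_basis M p b \<and> (\<forall>i j. h p (b i) (b j) = (if i = j then 1 else 0))"

lemma orthonormal_tangent: "orthonormal p b \<Longrightarrow> b i \<in> tangent_space M p"
  unfolding orthonormal_def using positive_basis_tangent by blast

lemma orthonormal_metric: "orthonormal p b \<Longrightarrow> h p (b i) (b j) = (if i = j then 1 else 0)"
  unfolding orthonormal_def by blast

lemma orthonormal_expansion:
  assumes b: "orthonormal p b" and v: "v \<in> tangent_space M p"
  shows "v = (\<lambda>f. \<Sum>i\<in>UNIV. h p v (b i) * b i f)"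
proof -
  obtain c where c: "v = (\<lambda>f. \<Sum>k\<in>UNIV. c k * b k f)"
    using positive_basis_spans[OF _ v] b unfolding orthonormal_def by blast
  have "h p v (b i) = c i" for i
  proof -
    have "h p v (b i) = (\<Sum>k\<in>UNIV. c k * h p (b k) (b i))"
      unfolding c by (rule h_sum) (use orthonormal_tangent[OF b] in auto)
    also have "\<dots> = c i" by (simp add: orthonormal_metric[OF b] if_distrib cong: if_cong)
    finally show ?thesis .
  qed
  then show ?thesis using c by simp
qed

lemma orthonormal_combination:
  assumes b: "orthonormal p b" and w: "\<And>j. w j = (\<lambda>f. \<Sum>k\<in>UNIV. C j k * b k f)"
    and C: "\<And>i j. (\<Sum>k\<in>UNIV. C i k * C j k) = (if i = j then 1 else 0)" "det ((\<chi> j k. C j k) :: real^4^4) > 0"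
  shows "orthonormal p w"
proof -
  have wT: "w j \<in> tangent_space M p" for j
    unfolding w by (intro tangent_space_sum orthonormal_tangent[OF b])
  have "h p (w i) (w j) = (\<Sum>k\<in>UNIV. C i k * C j k)" for i j
  proof -
    have "h p (b k) (w j) = C j k" for k
    proof -
      have "h p (b k) (w j) = h p (w j) (b k)" by (rule h_sym[OF orthonormal_tangent[OF b] wT])
      also have "\<dots> = (\<Sum>l\<in>UNIV. C j l * h p (b l) (b k))"
        unfolding w by (rule h_sum) (use orthonormal_tangent[OF b] in auto)
      also have "\<dots> = C j k" by (simp add: orthonormal_metric[OF b] if_distrib cong: if_cong)
      finally show ?thesis .
    qed
    moreover have "h p (w i) (w j) = (\<Sum>k\<in>UNIV. C i k * h p (b k) (w j))"
      by (subst (1) w[of i]) (rule h_sum, use wT orthonormal_tangent[OF b] in auto)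
    ultimately show ?thesis by simp
  qed
  then show ?thesis
    using positive_basis_combination[of p b w C] b w C unfolding orthonormal_def by simp
qed

text \<open>The metric is transported to real 4-space by a positive basis and orthonormalised there.
  The result may have the wrong orientation, which a change of sign of one vector repairs.\<close>

lemma orthonormal_exists: obtains b where "orthonormal p b"
proof -
  obtain v where v: "positive_basis M p v" by (rule positive_basis_exists)
  note vT = positive_basis_tangent[OF v]
  define t where "t = (\<lambda>c::real^4. \<lambda>f. \<Sum>k\<in>UNIV. c $ k * v k f)"
  have tT: "t c \<in> tangent_space M p" for c unfolding t_def by (intro tangent_space_sum vT)
  define B where "B = (\<lambda>c d. h p (t c) (t d))"
  have t_lin: "t (c + d) = (\<lambda>f. 1 * t c f + 1 * t d f)" "t (a *\<^sub>R c) = (\<lambda>f. a * t c f + 0 * t c f)" for a c d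
    by (auto simp: t_def fun_eq_iff sum.distrib algebra_simps sum_distrib_left)
  have left: "linear (\<lambda>c. B c d)" for d
    unfolding B_def
    by (rule linearI) (simp_all only: t_lin h_linear[OF tT tT tT], simp_all)
  have sym: "B c d = B d c" for c d unfolding B_def by (rule h_sym[OF tT tT])
  have "linear (\<lambda>d. B c d)" for c using left[of c] by (simp add: sym[of c])
  then have bil: "bilinear B" using left by (simp add: bilinear_def)
  have t0: "c = 0" if "t c = (\<lambda>f. 0)" for c
  proof -
    obtain U \<phi> where ch: "(U, \<phi>) \<in> M" "p \<in> U" by (rule chart_exists)
    obtain y where y: "\<And>i. y i \<in> smooth_functions M" "\<And>i. \<forall>\<^sub>F q in nhds p. y i q = \<phi> q $ i"
      using coordinate_functions_exist[OF ch] by metis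
    define A where "A = ((\<chi> i j. v j (y i)) :: real^4^4)"
    have "det A > 0" unfolding A_def by (rule positive_basis_chart[OF v ch y])
    then obtain B where "B ** A = mat 1" using invertible_det_nz[of A] unfolding invertible_def by auto
    moreover have "A *v c = 0"
      using fun_cong[OF that] by (simp add: A_def t_def matrix_vector_mult_def vec_eq_iff mult.commute)
    ultimately show ?thesis
      by (metis matrix_vector_mul_assoc matrix_vector_mul_lid matrix_vector_mult_0_right)
  qed
  have pos: "B c c > 0" if "c \<noteq> 0" for c
    unfolding B_def using h_pos[OF tT] t0 that by blast
  obtain C :: "4 \<Rightarrow> real^4" where C: "\<And>i j. B (C i) (C j) = (if i = j then 1 else 0)"
    using pos_def_orthonormal[OF bil sym pos] by blast
  define d where "d = det ((\<chi> j k. C j $ k) :: real^4^4)"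
  have "d \<noteq> 0"
  proof
    assume "d = 0"
    then have "\<not> invertible (transpose (\<chi> j k. C j $ k) :: real^4^4)" by (simp add: invertible_det_nz d_def)
    then obtain c :: "real^4" where c: "c \<noteq> 0" "transpose (\<chi> j k. C j $ k) *v c = 0"
      unfolding invertible_left_inverse matrix_left_invertible_ker by blast
    have "(\<Sum>j\<in>UNIV. c $ j *\<^sub>R C j) = 0"
      using c(2) by (simp add: matrix_vector_mult_def transpose_def vec_eq_iff mult.commute)
    then have "B (\<Sum>j\<in>UNIV. c $ j *\<^sub>R C j) (C i) = 0" for i
      using linear_0[OF left] by simp
    then have "(\<Sum>j\<in>UNIV. c $ j * B (C j) (C i)) = 0" for i
      by (simp add: linear_sum[OF left] linear_scale[OF left])
    then have "c $ i = 0" for i by (simp add: C if_distrib cong: if_cong)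
    then show False using c(1) by (simp add: vec_eq_iff)
  qed
  \<comment> \<open>Only the first vector is multiplied by the sign of the determinant, so the new
    determinant is \<open>|d|\<close>.\<close>
  define s where "s = (\<lambda>j::4. if j = 1 then sgn d else 1)"
  have s2: "s j * s j = 1" for j using \<open>d \<noteq> 0\<close> by (auto simp: s_def sgn_if)
  have "det (\<chi> j k. s j * C j $ k) = det (\<chi> j. s j *s C j)"
    by (rule arg_cong[of _ _ det]) (simp add: vec_eq_iff)
  also have "\<dots> = prod s UNIV * det (\<chi> j. C j)" by (rule det_rows_mul)
  also have "prod s UNIV = sgn d" unfolding UNIV_4 by (simp add: s_def)
  also have "det (\<chi> j. C j) = d"
    unfolding d_def by (rule arg_cong[of _ _ det]) (simp add: vec_eq_iff)
  finally have "det (\<chi> j k. s j * C j $ k) = sgn d * d" .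
  then have det: "det (\<chi> j k. s j * C j $ k) > 0" using \<open>d \<noteq> 0\<close> by (simp add: sgn_if)
  define b where "b = (\<lambda>j f. \<Sum>k\<in>UNIV. (s j * C j $ k) * v k f)"
  have bt: "b j = t (s j *\<^sub>R C j)" for j by (simp add: b_def t_def)
  have "h p (b i) (b j) = s i * s j * B (C i) (C j)" for i j
    unfolding bt using bilinear_lmul[OF bil] bilinear_rmul[OF bil] by (simp add: B_def mult.assoc)
  then have "h p (b i) (b j) = (if i = j then 1 else 0)" for i j
    using C s2 by simp
  moreover have "positive_basis M p b"
    using positive_basis_combination[OF v, of b "\<lambda>j k. s j * C j $ k"] det by (simp add: b_def)
  ultimately show ?thesis using that unfolding orthonormal_def by blast
qed

text \<open>The numbers \<open>b i x\<close> are the coordinates of the gradient of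
  \<open>x\<close>. This is where the hypothesis \<open>|dx| = 1\<close> on the boundary enters; it
  makes the outward normal \<open>- grad x\<close> a unit vector on which \<open>x\<close> has
  derivative exactly -1.\<close>

lemma orthonormal_dx_norm:
  assumes p: "p \<in> bdry M" and b: "orthonormal p b"
  shows "(\<Sum>i\<in>UNIV. (b i x)\<^sup>2) = 1"
proof -
  define w where "w = (\<lambda>f. \<Sum>i\<in>UNIV. b i x * b i f)"
  have wT: "w \<in> tangent_space M p" unfolding w_def by (intro tangent_space_sum orthonormal_tangent[OF b])
  have wh: "h p w v = v x" if v: "v \<in> tangent_space M p" for v
  proof -
    have "h p w v = (\<Sum>i\<in>UNIV. b i x * h p (b i) v)"
      unfolding w_def by (rule h_sum[OF v orthonormal_tangent[OF b]])
    also have "\<dots> = (\<Sum>i\<in>UNIV. h p v (b i) * b i x)"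
      using h_sym[OF v orthonormal_tangent[OF b]] by (simp add: mult.commute)
    also have "\<dots> = v x" using orthonormal_expansion[OF b v] by metis
    finally show ?thesis .
  qed
  have "gradient M h p x = w"
    unfolding gradient_def
  proof (rule the_equality)
    fix u assume u: "u \<in> tangent_space M p \<and> (\<forall>w\<in>tangent_space M p. h p u w = w x)"
    then have "u = (\<lambda>f. \<Sum>i\<in>UNIV. h p u (b i) * b i f)" using orthonormal_expansion[OF b] by blast
    then show "u = w" using u orthonormal_tangent[OF b] by (simp add: w_def)
  qed (use wT wh in auto)
  then have "w x = 1" using differential_norm[OF p] wh[OF wT] by (simp add: differential_norm_sq_def)
  then show ?thesis by (simp add: w_def power2_eq_square)
qed

text \<open>As the frame is orthonormal and \<open>|dx| = 1\<close>, the condition says that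
  \<open>b 1\<close> is the outward unit normal and the other three vectors are tangent to the
  boundary.\<close>

definition boundary_adapted :: "'a \<Rightarrow> (4 \<Rightarrow> 'a tangent) \<Rightarrow> bool" where
  "boundary_adapted p b \<longleftrightarrow> orthonormal p b \<and> (\<forall>i. b i x = (if i = 1 then - 1 else 0))"

text \<open>\<open>n\<close> lists the coordinates of the outward normal in the given frame. It is
  the first row of \<open>iso_frame n\<close>, so the rotated frame starts with the normal.\<close>

lemma iso_frame_boundary_adapted:
  assumes p: "p \<in> bdry M" and b: "orthonormal p b"
  defines "n \<equiv> \<chi> i. - b i x"
  shows "norm n = 1" "boundary_adapted p (\<lambda>i f. \<Sum>j\<in>UNIV. iso_frame n i j * b j f)"
proof -
  have "(norm n)\<^sup>2 = 1"
    using orthonormal_dx_norm[OF p b] unfolding norm_4 by (simp add: n_def sum_4 power2_eq_square)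
  then show n: "norm n = 1" by (intro power2_eq_imp_eq[of "norm n" 1]) auto
  have "(\<Sum>j\<in>UNIV. iso_frame n i j * b j x) = (if i = 1 then - 1 else 0)" for i
  proof -
    have "(\<Sum>j\<in>UNIV. iso_frame n i j * b j x) = - (\<Sum>j\<in>UNIV. iso_frame n i j * iso_frame n 1 j)"
    proof -
      have "b j x = - iso_frame n 1 j" for j by (simp add: iso_frame_def n_def)
      then show ?thesis by (simp add: sum_negf)
    qed
    then show ?thesis using iso_frame_orthonormal[OF n, of i 1] by simp
  qed
  moreover have "orthonormal p (\<lambda>i f. \<Sum>j\<in>UNIV. iso_frame n i j * b j f)"
    by (rule orthonormal_combination[OF b refl iso_frame_orthonormal[OF n]]) (simp add: iso_frame_det[OF n])
  ultimately show "boundary_adapted p (\<lambda>i f. \<Sum>j\<in>UNIV. iso_frame n i j * b j f)"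
    by (simp add: boundary_adapted_def)
qed

end

section \<open>Frames along the boundary\<close>

text \<open>Places the frame of \<open>K\<close> after the normal vector, in accordance with the
  outward-normal-first convention.\<close>

definition sh :: "3 \<Rightarrow> 4" where
  "sh i = (if i = 1 then 2 else if i = 2 then 3 else 4)"

lemma sh_simps [simp]: "sh 1 = 2" "sh 2 = 3" "sh 3 = 4" "sh i \<noteq> 1" "sh i = sh j \<longleftrightarrow> i = j"
  using exhaust_3[of i] exhaust_3[of j] by (auto simp: sh_def)

lemma sum_4_sh: "(\<Sum>i\<in>UNIV. F i) = F 1 + (\<Sum>i\<in>UNIV. F (sh i))" for F :: "4 \<Rightarrow> 'b::comm_monoid_add"
  by (simp add: sum_4 sum_3 add.assoc)

context asymptotically_hyperbolic_manifold begin

text \<open>Passing from an arbitrary boundary defining function to \<open>x\<close> multiplies all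
  four vectors by the same positive number \<open>k\<close>, hence the determinant by its fourth
  power; the orientation is unaffected.\<close>

lemma zero_frame_iff:
  assumes p: "p \<in> bdry M"
  shows "zero_frame M g p e \<longleftrightarrow> (\<forall>i. e i \<in> zero_vector_fields M) \<and> orthonormal p (\<lambda>i. rs (e i) p)"
proof
  assume z: "zero_frame M g p e"
  then have e: "e i \<in> zero_vector_fields M" for i by (simp add: zero_frame_def)
  obtain y v where y: "bdf M y" "\<And>i. v i \<in> vector_fields M" "\<And>i. e i = vf_scale y (v i)"
    "positive_basis M p (\<lambda>i. v i p)" using z unfolding zero_frame_def by blast
  obtain k where k: "k > 0" "\<And>V f. V \<in> zero_vector_fields M \<Longrightarrow> rs V p f = k * rescale M y V p f"
    using rescale_ratio[OF x_bdf y(1) p] by metis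
  have "rs (e i) p = (\<lambda>f. k * v i p f)" for i
    using k(2)[OF e[of i]] rescale_unique[OF y(1,2), of i] y(3)[of i] by auto
  then have "rs (e j) p = (\<lambda>f. \<Sum>i\<in>UNIV. (if j = i then k else 0) * v i p f)" for j
    by (simp add: fun_eq_iff if_distrib[of "\<lambda>a. a * y" for y] cong: if_cong)
  from positive_basis_combination[OF y(4) this]
  have "positive_basis M p (\<lambda>i. rs (e i) p) \<longleftrightarrow> det ((\<chi> j i. if j = i then k else 0) :: real^4^4) > 0" .
  moreover have "det ((\<chi> j i. if j = i then k else 0) :: real^4^4) = (\<Prod>i\<in>(UNIV::4 set). k)"
    by (subst det_diagonal) auto
  ultimately have "positive_basis M p (\<lambda>i. rs (e i) p)" using k(1) by simp
  moreover have "h p (rs (e i) p) (rs (e j) p) = (if i = j then 1 else 0)" for i j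
    using z zero_metric_eq(1)[OF e e, of i j] unfolding zero_frame_def by metis
  ultimately show "(\<forall>i. e i \<in> zero_vector_fields M) \<and> orthonormal p (\<lambda>i. rs (e i) p)"
    using e by (simp add: orthonormal_def)
next
  assume z: "(\<forall>i. e i \<in> zero_vector_fields M) \<and> orthonormal p (\<lambda>i. rs (e i) p)"
  then have e: "e i \<in> zero_vector_fields M" for i by simp
  show "zero_frame M g p e"
    unfolding zero_frame_def
  proof (intro conjI allI)
    show "\<exists>x v. bdf M x \<and> (\<forall>i. v i \<in> vector_fields M \<and> e i = vf_scale x (v i)) \<and> positive_basis M p (\<lambda>i. v i p)"
      using x_bdf rs_vector_field[OF e] vf_scale_rescale[OF x_bdf e] z unfolding orthonormal_def
      by (intro exI[of _ x] exI[of _ "\<lambda>i. rs (e i)"]) auto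
  qed (use e z zero_metric_eq(1)[OF e e] in \<open>auto simp: orthonormal_def\<close>)
qed

lemma realize_frame:
  assumes "\<And>i::'i. b i \<in> tangent_space M p"
  obtains e where "\<And>i. e i \<in> zero_vector_fields M" "\<And>i. rs (e i) p = b i"
proof -
  have "\<exists>V. V \<in> zero_vector_fields M \<and> rs V p = b i" for i
  proof -
    obtain W where W: "W \<in> vector_fields M" "W p = b i" using tangent_extension[OF assms] by blast
    then show ?thesis
      using bdf_scale_zero_vector_field[OF x_bdf W(1)] rescale_unique[OF x_bdf W(1)] by (intro exI[of _ "vf_scale x W"]) simp
  qed
  then show ?thesis using that by metis
qed

lemma zero_frame_exists:
  assumes p: "p \<in> bdry M"
  obtains e where "zero_frame M g p e"
proof -
  obtain b where b: "orthonormal p b" by (rule orthonormal_exists)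
  obtain e where e: "\<And>i. e i \<in> zero_vector_fields M" "\<And>i. rs (e i) p = b i"
    by (rule realize_frame[of b p, OF orthonormal_tangent[OF b]]) blast
  then show ?thesis using that zero_frame_iff[OF p, of e] b by simp
qed

definition boundary_coords :: "'a \<Rightarrow> (4 \<Rightarrow> 'a tangent) \<Rightarrow> 'a tangent \<Rightarrow> real^3" where
  "boundary_coords p b v = (\<chi> j. h p v (b (sh j)))"

context
  fixes p b
  assumes p: "p \<in> bdry M" and b: "boundary_adapted p b"
begin

lemma b_orthonormal: "orthonormal p b"
  and b_x: "b i x = (if i = 1 then - 1 else 0)"
  using b by (auto simp: boundary_adapted_def)

lemma b_tangent: "b i \<in> tangent_space M p"
  by (rule orthonormal_tangent[OF b_orthonormal])

lemma normal_component:
  assumes v: "v \<in> tangent_space M p"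
  shows "h p v (b 1) = - v x"
proof -
  have "v x = (\<Sum>i\<in>UNIV. h p v (b i) * b i x)" using orthonormal_expansion[OF b_orthonormal v] by metis
  then show ?thesis by (simp add: b_x if_distrib cong: if_cong)
qed

lemma K_expansion:
  assumes v: "v \<in> tangent_space M p" "v x = 0"
  shows "v = (\<lambda>f. \<Sum>j\<in>UNIV. boundary_coords p b v $ j * b (sh j) f)"
  using orthonormal_expansion[OF b_orthonormal v(1)] normal_component[OF v(1)] v(2)
  by (simp add: sum_4_sh boundary_coords_def)

lemma h_boundary_coords:
  assumes v: "v \<in> tangent_space M p" "v x = 0" and w: "w \<in> tangent_space M p"
  shows "h p v w = boundary_coords p b v \<bullet> boundary_coords p b w"
proof -
  have "h p v w = (\<Sum>j\<in>UNIV. boundary_coords p b v $ j * h p (b (sh j)) w)"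
    by (subst K_expansion[OF v]) (rule h_sum[OF w b_tangent])
  then show ?thesis
    using h_sym[OF b_tangent w] by (simp add: inner_vec_def boundary_coords_def)
qed

lemma K_coords_eq:
  assumes V: "V \<in> K_fibre M p" and e: "\<And>i. e i \<in> K_fibre M p"
  shows "K_coords M g p e V = (\<chi> i. boundary_coords p b (rs (e i) p)) *v boundary_coords p b (rs V p)"
proof -
  have z: "V \<in> zero_vector_fields M" "e i \<in> zero_vector_fields M" "rs V p x = 0" for i
    using V e K_fibre_iff[OF x_bdf p] by auto
  show ?thesis
    unfolding K_coords_def vec_eq_iff
    using zero_metric_eq(1)[OF z(1,2)] h_boundary_coords[OF rs_tangent[OF z(1)] z(3) rs_tangent[OF z(2)]]
    by (simp add: matrix_vector_mult_def inner_vec_def mult.commute)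
qed

text \<open>Any two positive orthonormal frames of \<open>K\<close> differ by a rotation.
  Orthogonality is immediate; for the sign, the given frame is completed by its own outward vector,
  which need not be normal to the boundary, and compared with \<open>b\<close>.\<close>

lemma K_frame_rotation:
  assumes e: "K_frame M g p e"
  defines "P \<equiv> (\<chi> i. boundary_coords p b (rs (e i) p)) :: real^3^3"
  shows "orthogonal_matrix P" "det P = 1"
proof -
  have eK: "e i \<in> K_fibre M p" for i using e by (simp add: K_frame_def)
  then have z: "e i \<in> zero_vector_fields M" "rs (e i) p x = 0" for i using K_fibre_iff[OF x_bdf p] by auto
  have "(P ** transpose P) $ i $ j = (if i = j then 1 else 0)" for i j
  proof -
    have "(P ** transpose P) $ i $ j = h p (rs (e i) p) (rs (e j) p)"
      using h_boundary_coords[OF rs_tangent[OF z(1)] z(2) rs_tangent[OF z(1)], of i j]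
      by (simp add: matrix_matrix_mult_def transpose_def P_def inner_vec_def)
    also have "\<dots> = zero_metric M g (e i) (e j) p" using zero_metric_eq(1)[OF z(1) z(1)] by simp
    finally show ?thesis using e by (simp add: K_frame_def)
  qed
  then have PP: "P ** transpose P = mat 1" by (simp add: vec_eq_iff mat_def)
  then show oP: "orthogonal_matrix P" by (simp add: orthogonal_matrix_def matrix_left_right_inverse)
  obtain y v n where y: "bdf M y" "\<And>i. v i \<in> vector_fields M" "\<And>i. e i = vf_scale y (v i)"
    and n: "n \<in> tangent_space M p" "n y < 0"
    and pos: "positive_basis M p (\<lambda>i. if i = 1 then n else if i = 2 then v 1 p else if i = 3 then v 2 p else v 3 p)"
    using e unfolding K_frame_def by blast
  obtain k where k: "k > 0" "\<And>v. v \<in> tangent_space M p \<Longrightarrow> v y = k * v x"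
    "\<And>V f. V \<in> zero_vector_fields M \<Longrightarrow> rs V p f = k * rescale M y V p f"
    using rescale_ratio[OF x_bdf y(1) p] by metis
  have vT: "v i p \<in> tangent_space M p" for i using vector_field_tangent[OF y(2)] .
  have ev: "rs (e i) p = (\<lambda>f. k * v i p f)" for i
    using k(3)[OF z(1)[of i]] rescale_unique[OF y(1,2), of i] y(3)[of i] by auto
  define w where "w = (\<lambda>i::4. if i = 1 then n else if i = 2 then v 1 p else if i = 3 then v 2 p else v 3 p)"
  have wT: "w i \<in> tangent_space M p" for i using n vT by (simp add: w_def)
  define C where "C = (\<lambda>j l. h p (w j) (b l))"
  have "w j = (\<lambda>f. \<Sum>l\<in>UNIV. C j l * b l f)" for j
    unfolding C_def by (rule orthonormal_expansion[OF b_orthonormal wT])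
  then have dC: "det ((\<chi> j l. C j l) :: real^4^4) > 0"
    using positive_basis_combination[of p b w C] b_orthonormal pos unfolding orthonormal_def w_def by blast
  have vP: "h p (v i p) (b (sh j)) = P $ i $ j / k" for i j
    using h_linear[OF vT[of i] vT[of i] b_tangent[of "sh j"], of k 0] k(1) by (simp add: P_def boundary_coords_def ev)
  have v1: "h p (v i p) (b 1) = 0" for i
  proof -
    have "k * v i p x = 0" using z(2)[of i] by (simp add: ev)
    then show ?thesis using normal_component[OF vT, of i] k(1) by simp
  qed
  have c11: "C 1 1 > 0"
    using normal_component[OF n(1)] n(2) k(1) k(2)[OF n(1)] by (simp add: C_def w_def mult_less_0_iff)
  \<comment> \<open>The last three vectors are tangent to the boundary, so the coefficient matrix is
    block triangular. Its corner \<open>C 1 1\<close> is positive because \<open>n\<close> points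
    outwards, and the remaining block is \<open>P / k\<close>.\<close>
  have rows: "C 2 1 = 0" "C 3 1 = 0" "C 4 1 = 0"
    "C 2 2 = P$1$1 / k" "C 2 3 = P$1$2 / k" "C 2 4 = P$1$3 / k"
    "C 3 2 = P$2$1 / k" "C 3 3 = P$2$2 / k" "C 3 4 = P$2$3 / k"
    "C 4 2 = P$3$1 / k" "C 4 3 = P$3$2 / k" "C 4 4 = P$3$3 / k"
    using vP[of _ 1] vP[of _ 2] vP[of _ 3] by (simp_all add: C_def w_def v1)
  have "det ((\<chi> j l. C j l) :: real^4^4) = C 1 1 * det P / k ^ 3"
    unfolding det_4 det_3 Let_def using k(1) by (simp add: rows field_simps power3_eq_cube)
  then have "det P > 0" using dC c11 k(1) by (simp add: zero_less_divide_iff zero_less_mult_iff)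
  then show "det P = 1" using det_orthogonal_matrix[OF oP] by auto
qed

text \<open>Rotations commute with the cross product, so the unknown frame in \<open>K_cross\<close>
  can be traded for the adapted one.\<close>

lemma K_cross_coords:
  assumes "K_cross M g p V W U"
  shows "boundary_coords p b (rs U p) = cross3 (boundary_coords p b (rs V p)) (boundary_coords p b (rs W p))"
proof -
  obtain e where K: "V \<in> K_fibre M p" "W \<in> K_fibre M p" "U \<in> K_fibre M p" and e: "K_frame M g p e"
    and c: "K_coords M g p e U = cross3 (K_coords M g p e V) (K_coords M g p e W)"
    using assms unfolding K_cross_def by blast
  define P :: "real^3^3" where "P = (\<chi> i. boundary_coords p b (rs (e i) p))"
  have eK: "e i \<in> K_fibre M p" for i using e by (simp add: K_frame_def)
  have P: "orthogonal_matrix P" "det P = 1" unfolding P_def using K_frame_rotation[OF e] by auto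
  have "P *v boundary_coords p b (rs U p) = P *v cross3 (boundary_coords p b (rs V p)) (boundary_coords p b (rs W p))"
    using c P cross_orthogonal_matrix[OF P(1)]
    unfolding K_coords_eq[OF K(1) eK] K_coords_eq[OF K(2) eK] K_coords_eq[OF K(3) eK] P_def[symmetric] by simp
  then have "transpose P *v (P *v boundary_coords p b (rs U p)) =
      transpose P *v (P *v cross3 (boundary_coords p b (rs V p)) (boundary_coords p b (rs W p)))" by simp
  then show ?thesis using P(1) by (simp add: matrix_vector_mul_assoc orthogonal_matrix_def)
qed

lemma K_frame_adapted:
  assumes e: "\<And>i. e i \<in> zero_vector_fields M" "\<And>i. rs (e i) p = b (sh i)"
  shows "K_frame M g p e"
  unfolding K_frame_def
proof (intro conjI allI)
  show "e i \<in> K_fibre M p" for i using K_fibre_iff[OF x_bdf p] e b_x by simp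
  show "zero_metric M g (e i) (e j) p = (if i = j then 1 else 0)" for i j
    using zero_metric_eq(1)[OF e(1) e(1), of i j] orthonormal_metric[OF b_orthonormal] by (simp add: e(2))
  have "(\<lambda>i. if i = 1 then b 1 else if i = 2 then rs (e 1) p else if i = 3 then rs (e 2) p else rs (e 3) p) = b"
    using exhaust_4 by (fastforce simp: e(2) fun_eq_iff)
  then have pos: "positive_basis M p (\<lambda>i. if i = 1 then b 1 else if i = 2 then rs (e 1) p else if i = 3 then rs (e 2) p else rs (e 3) p)"
    using b_orthonormal unfolding orthonormal_def by simp
  show "\<exists>x v n. bdf M x \<and> (\<forall>i. v i \<in> vector_fields M \<and> e i = vf_scale x (v i)) \<and> n \<in> tangent_space M p \<and> n x < 0 \<and>
      positive_basis M p (\<lambda>i. if i = 1 then n else if i = 2 then v 1 p else if i = 3 then v 2 p else v 3 p)"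
    using x_bdf rs_vector_field[OF e(1)] vf_scale_rescale[OF x_bdf e(1)] b_tangent[of 1] b_x[of 1] pos
    by (intro exI[of _ x] exI[of _ "\<lambda>i. rs (e i)"] exI[of _ "b 1"]) simp
qed

text \<open>These three products turn the homomorphism condition into exactly the three equations
  for self-duality.\<close>

lemma K_cross_adapted:
  assumes e: "\<And>i. e i \<in> zero_vector_fields M" "\<And>i. rs (e i) p = b (sh i)"
  shows "K_cross M g p (e 2) (e 3) (e 1)" "K_cross M g p (e 3) (e 1) (e 2)" "K_cross M g p (e 1) (e 2) (e 3)"
proof -
  have f: "K_frame M g p e" by (rule K_frame_adapted[OF e])
  have eK: "e i \<in> K_fibre M p" for i using f by (simp add: K_frame_def)
  have c: "K_coords M g p e (e i) = axis i 1" for i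
    using f by (simp add: K_coords_def K_frame_def vec_eq_iff axis_def)
  have "cross3 (axis 3 1) (axis 1 1) = axis 2 1" "cross3 (axis 2 1) (axis 3 1) = axis 1 1"
    "cross3 (axis 1 1) (axis 2 1) = axis 3 1" by (simp_all add: cross_basis)
  then show "K_cross M g p (e 2) (e 3) (e 1)" "K_cross M g p (e 3) (e 1) (e 2)" "K_cross M g p (e 1) (e 2) (e 3)"
    unfolding K_cross_def using f eK c by metis+
qed

end

end

section \<open>SU(2) bundles\<close>

lemma conj_transpose_mult: "conj_transpose (A ** B) = conj_transpose B ** conj_transpose A"
  by (simp add: conj_transpose_def vec_eq_iff matrix_matrix_mult_def mult.commute)

lemma hermitian_matrix: "hermitian (T *v u) w = hermitian u (conj_transpose T *v w)"
  by (simp add: hermitian_def conj_transpose_def matrix_vector_mult_def sum_2 algebra_simps)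

lemma complex_volume_matrix: "complex_volume (T *v u) (T *v w) = det T * complex_volume u w"
  by (simp add: complex_volume_def matrix_vector_mult_def sum_2 det_2 algebra_simps)

lemma SU2_left: "T \<in> SU2 \<Longrightarrow> conj_transpose T ** T = mat 1"
  by (simp add: SU2_def)

lemma SU2_right: "T \<in> SU2 \<Longrightarrow> T ** conj_transpose T = mat 1"
  using SU2_left matrix_left_right_inverse by blast

lemma SU2_matrix_inv: 
  assumes "T \<in> SU2" 
  shows "matrix_inv T = conj_transpose T"
proof -
  have "\<exists>S. T ** S = mat 1 \<and> S ** T = mat 1" using SU2_left[OF assms] SU2_right[OF assms] by blast
  then have i: "matrix_inv T ** T = mat 1" unfolding matrix_inv_def by (rule someI2_ex) blast
  have "matrix_inv T = matrix_inv T ** (T ** conj_transpose T)" by (simp add: SU2_right[OF assms])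
  also have "\<dots> = conj_transpose T" by (simp add: matrix_mul_assoc i)
  finally show ?thesis .
qed

lemma hermitian_bounded_bilinear: "bounded_bilinear hermitian"
  unfolding bilinear_conv_bounded_bilinear[symmetric] bilinear_def
  by (auto intro!: linearI simp: hermitian_def sum_2 algebra_simps)

lemma complex_volume_bounded_bilinear: "bounded_bilinear complex_volume"
  unfolding bilinear_conv_bounded_bilinear[symmetric] bilinear_def
  by (auto intro!: linearI simp: complex_volume_def algebra_simps)

text \<open>Common features of the Hermitian metric and the complex volume form. Both are only used
  as real bilinear forms, so a single computation proves that a connection preserves either of
  them.\<close>

definition invariant_form :: "(complex^2 \<Rightarrow> complex^2 \<Rightarrow> complex) \<Rightarrow> bool" where
  "invariant_form B \<longleftrightarrow> bounded_bilinear B \<and> (\<forall>T\<in>SU2. \<forall>u w. B (T *v u) (T *v w) = B u w)"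

lemma invariant_form_hermitian: "invariant_form hermitian"
  unfolding invariant_form_def
  by (auto simp: hermitian_bounded_bilinear hermitian_matrix matrix_vector_mul_assoc SU2_left)

lemma invariant_form_complex_volume: "invariant_form complex_volume"
  unfolding invariant_form_def
  by (auto simp: complex_volume_bounded_bilinear complex_volume_matrix SU2_def)

lemma scaleR_matrix_vector: "A *v (c *\<^sub>R u) = c *\<^sub>R (A *v u)" for A :: "complex^2^2" and u :: "complex^2"
  by (simp add: matrix_vector_mult_def vec_eq_iff scaleR_sum_right)

lemma vec_scale_matrix_vector: "A *v (c *s u) = c *s (A *v u)" for A :: "complex^2^2"
  by (simp add: matrix_vector_mult_def vec_eq_iff sum_distrib_left mult.left_commute)

section \<open>Derivatives of complex and vector valued functions\<close>

definition vec_derivative :: "'a tangent \<Rightarrow> ('a \<Rightarrow> complex^2) \<Rightarrow> complex^2" where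
  "vec_derivative v F = (\<chi> i. complex_derivative v (\<lambda>q. F q $ i))"

context compact_manifold begin

abbreviation smooth :: "('a \<Rightarrow> 'b::real_normed_vector) \<Rightarrow> bool" where
  "smooth F \<equiv> \<forall>q. smooth_at M F q"

lemma smooth_Re_Im: "smooth F \<Longrightarrow> (\<lambda>q. Re (F q)) \<in> smooth_functions M"
  "smooth F \<Longrightarrow> (\<lambda>q. Im (F q)) \<in> smooth_functions M"
  unfolding smooth_functions_iff
  using smooth_at_bounded_linear[OF bounded_linear_Re] smooth_at_bounded_linear[OF bounded_linear_Im] by blast+

lemma smooth_at_complex:
  assumes "smooth_at M f p" "smooth_at M g p"
  shows "smooth_at M (\<lambda>q. Complex (f q) (g q)) p"
proof -
  have "smooth_at M (\<lambda>q. f q *\<^sub>R 1 + g q *\<^sub>R \<i>) p"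
    by (intro smooth_at_add smooth_at_scaleR assms smooth_at_const)
  moreover have "f q *\<^sub>R 1 + g q *\<^sub>R \<i> = Complex (f q) (g q)" for q by (simp add: complex_eq_iff)
  ultimately show ?thesis by simp
qed

lemma smooth_at_matrix_vector:
  fixes A :: "'a \<Rightarrow> complex^2^2"
  assumes "smooth_at M A p" "smooth_at M s p"
  shows "smooth_at M (\<lambda>q. A q *v s q) p"
proof -
  have A: "smooth_at M (\<lambda>q. A q $ i $ j) p" for i j
    using assms(1) smooth_at_vec_iff[of A p] smooth_at_vec_iff[of "\<lambda>q. A q $ i" p] by blast
  have s: "smooth_at M (\<lambda>q. s q $ j) p" for j using assms(2) smooth_at_vec_iff by blast
  have "smooth_at M (\<lambda>q. \<Sum>j\<in>UNIV. A q $ i $ j * s q $ j) p" for i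
    by (intro smooth_at_sum smooth_at_mult A s)
  then show ?thesis
    unfolding smooth_at_vec_iff[of "\<lambda>q. A q *v s q"] by (simp add: matrix_vector_mult_def)
qed

lemma smooth_at_vec_scale:
  fixes s :: "'a \<Rightarrow> complex^2"
  assumes "smooth_at M c p" "smooth_at M s p"
  shows "smooth_at M (\<lambda>q. c q *s s q) p"
proof -
  have s: "smooth_at M (\<lambda>q. s q $ j) p" for j using assms(2) smooth_at_vec_iff by blast
  then show ?thesis
    unfolding smooth_at_vec_iff[of "\<lambda>q. c q *s s q"] by (simp add: smooth_at_mult assms(1))
qed

lemma smooth_vec_nth: "smooth F \<Longrightarrow> smooth (\<lambda>q. F q $ i)" for F :: "'a \<Rightarrow> 'b::real_normed_vector^'n::finite"
  using smooth_at_vec_iff by blast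

context
  fixes v p
  assumes v: "v \<in> tangent_space M p"
begin

lemma complex_derivative_add:
  assumes "smooth F" "smooth G"
  shows "complex_derivative v (\<lambda>q. F q + G q) = complex_derivative v F + complex_derivative v G"
  using tangent_add[OF v] smooth_Re_Im[OF assms(1)] smooth_Re_Im[OF assms(2)]
  by (simp add: complex_derivative_def complex_eq_iff)

lemma complex_derivative_scaleR:
  assumes "f \<in> smooth_functions M" "smooth F"
  shows "complex_derivative v (\<lambda>q. f q *\<^sub>R F q) = v f *\<^sub>R F p + f p *\<^sub>R complex_derivative v F"
  using tangent_mult[OF v assms(1)] smooth_Re_Im[OF assms(2)]
  by (simp add: complex_derivative_def complex_eq_iff)

lemma complex_derivative_mult:
  assumes "smooth F" "smooth G"
  shows "complex_derivative v (\<lambda>q. F q * G q) = complex_derivative v F * G p + F p * complex_derivative v G"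
  using smooth_Re_Im[OF assms(1)] smooth_Re_Im[OF assms(2)]
  by (simp add: complex_derivative_def complex_eq_iff tangent_mult[OF v] tangent_add[OF v] tangent_diff[OF v]
      smooth_functions_mult algebra_simps)

lemma complex_derivative_cnj:
  assumes "smooth F"
  shows "complex_derivative v (\<lambda>q. cnj (F q)) = cnj (complex_derivative v F)"
  using tangent_linear[OF v smooth_Re_Im(2)[OF assms] smooth_Re_Im(2)[OF assms], of "-1" 0]
  by (simp add: complex_derivative_def complex_eq_iff)

lemma complex_derivative_const: "complex_derivative v (\<lambda>q. c) = 0"
  by (simp add: complex_derivative_def complex_eq_iff tangent_const[OF v])

lemma complex_derivative_diff:
  assumes "smooth F" "smooth G"
  shows "complex_derivative v (\<lambda>q. F q - G q) = complex_derivative v F - complex_derivative v G"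
  using tangent_diff[OF v] smooth_Re_Im[OF assms(1)] smooth_Re_Im[OF assms(2)]
  by (simp add: complex_derivative_def complex_eq_iff)

lemma complex_derivative_sum:
  assumes "\<And>i. i \<in> I \<Longrightarrow> smooth (F i)"
  shows "complex_derivative v (\<lambda>q. \<Sum>i\<in>I. F i q) = (\<Sum>i\<in>I. complex_derivative v (F i))"
  using assms
proof (induction I rule: infinite_finite_induct)
  case (insert j I)
  have "smooth (\<lambda>q. \<Sum>i\<in>I. F i q)" using insert by (auto intro: smooth_at_sum)
  then show ?case using insert complex_derivative_add[of "F j" "\<lambda>q. \<Sum>i\<in>I. F i q"] by simp
qed (simp_all add: complex_derivative_const)

lemma vec_derivative_add:
  assumes "smooth F" "smooth G"
  shows "vec_derivative v (\<lambda>q. F q + G q) = vec_derivative v F + vec_derivative v G"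
  using complex_derivative_add[OF smooth_vec_nth[OF assms(1)] smooth_vec_nth[OF assms(2)]]
  by (simp add: vec_derivative_def vec_eq_iff)

lemma vec_derivative_scaleR:
  assumes "f \<in> smooth_functions M" "smooth F"
  shows "vec_derivative v (\<lambda>q. f q *\<^sub>R F q) = v f *\<^sub>R F p + f p *\<^sub>R vec_derivative v F"
  using complex_derivative_scaleR[OF assms(1) smooth_vec_nth[OF assms(2)]]
  by (simp add: vec_derivative_def vec_eq_iff)

lemma vec_derivative_scaleR_const:
  assumes "smooth F"
  shows "vec_derivative v (\<lambda>q. c *\<^sub>R F q) = c *\<^sub>R vec_derivative v F"
  using vec_derivative_scaleR[OF smooth_functions_const assms] tangent_const[OF v] by simp

lemma vec_derivative_vec_scale:
  assumes "smooth F"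
  shows "vec_derivative v (\<lambda>q. c *s F q) = c *s vec_derivative v F"
proof -
  have c: "smooth (\<lambda>q. c)" using smooth_at_const by blast
  show ?thesis
    using complex_derivative_mult[OF c smooth_vec_nth[OF assms]]
    by (simp add: vec_derivative_def vec_eq_iff complex_derivative_const)
qed

lemma complex_derivative_hermitian:
  assumes "smooth F" "smooth G"
  shows "complex_derivative v (\<lambda>q. hermitian (F q) (G q)) =
    hermitian (vec_derivative v F) (G p) + hermitian (F p) (vec_derivative v G)"
proof -
  have c: "smooth (\<lambda>q. cnj (G q $ i))" for i
    using smooth_at_bounded_linear[OF bounded_linear_cnj] smooth_vec_nth[OF assms(2)] by blast
  have m: "smooth (\<lambda>q. F q $ i * cnj (G q $ i))" for i
    using smooth_at_mult smooth_vec_nth[OF assms(1)] c by blast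
  show ?thesis
    by (simp add: hermitian_def sum_2 vec_derivative_def complex_derivative_add[OF m m]
        complex_derivative_mult[OF smooth_vec_nth[OF assms(1)] c] complex_derivative_cnj[OF smooth_vec_nth[OF assms(2)]])
qed

lemma complex_derivative_complex_volume:
  assumes "smooth F" "smooth G"
  shows "complex_derivative v (\<lambda>q. complex_volume (F q) (G q)) =
    complex_volume (vec_derivative v F) (G p) + complex_volume (F p) (vec_derivative v G)"
proof -
  have m: "smooth (\<lambda>q. F q $ i * G q $ j)" for i j
    using smooth_at_mult smooth_vec_nth[OF assms(1)] smooth_vec_nth[OF assms(2)] by blast
  show ?thesis
    by (simp only: complex_volume_def vec_derivative_def vec_lambda_beta complex_derivative_diff[OF m m]
        complex_derivative_mult[OF smooth_vec_nth[OF assms(1)] smooth_vec_nth[OF assms(2)]])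
      (simp add: algebra_simps)
qed

end

end

section \<open>Sections of the bundle and existence of an ordinary connection\<close>

locale su2_bundle_manifold = compact_manifold M for M :: "'a::t2_space chart set" +
  fixes E :: "'a trivialisations"
  assumes su2: "su2_bundle M E"
begin

lemma triv_exists: obtains U \<tau> where "(U, \<tau>) \<in> E" "p \<in> U"
  using su2 unfolding su2_bundle_def by (metis (no_types, lifting) UNIV_I UN_E case_prod_conv surj_pair)

lemma triv_open: "(U, \<tau>) \<in> E \<Longrightarrow> open U"
  and triv_SU2: "(U, \<tau>) \<in> E \<Longrightarrow> p \<in> U \<Longrightarrow> \<tau> p \<in> SU2"
  using su2 unfolding su2_bundle_def by blast+

lemma triv_inverse:
  assumes "(U, \<tau>) \<in> E" "p \<in> U"
  shows "conj_transpose (\<tau> p) *v (\<tau> p *v u) = u" "\<tau> p *v (conj_transpose (\<tau> p) *v u) = u"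
  using SU2_left[OF triv_SU2[OF assms]] SU2_right[OF triv_SU2[OF assms]]
  by (simp_all add: matrix_vector_mul_assoc)

lemma triv_transition:
  assumes "(U, \<tau>) \<in> E" "(U', \<tau>') \<in> E" "p \<in> U" "p \<in> U'"
  shows "smooth_at M (\<lambda>q. \<tau>' q ** conj_transpose (\<tau> q)) p"
proof -
  have o: "open (U \<inter> U')" using triv_open assms by blast
  have "smooth_fun_on M (U \<inter> U') (\<lambda>p. \<tau>' p ** matrix_inv (\<tau> p))"
    using su2 assms unfolding su2_bundle_def by fastforce
  then have "smooth_at M (\<lambda>p. \<tau>' p ** matrix_inv (\<tau> p)) p"
    using smooth_fun_on_iff[OF o] assms by blast
  moreover have "\<forall>\<^sub>F q in nhds p. q \<in> U \<inter> U'" using o assms by (intro eventually_nhds_in_open) auto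
  then have "\<forall>\<^sub>F q in nhds p. \<tau>' q ** matrix_inv (\<tau> q) = \<tau>' q ** conj_transpose (\<tau> q)"
    by eventually_elim (use SU2_matrix_inv triv_SU2[OF assms(1)] in simp)
  ultimately show ?thesis by (rule smooth_at_cong)
qed

lemma section_iff: "s \<in> smooth_sections M E \<longleftrightarrow> (\<forall>(U, \<tau>)\<in>E. \<forall>p\<in>U. smooth_at M (\<lambda>q. \<tau> q *v s q) p)"
proof -
  have "(case c of (U, \<tau>) \<Rightarrow> smooth_fun_on M U (\<lambda>p. \<tau> p *v s p)) =
      (case c of (U, \<tau>) \<Rightarrow> \<forall>p\<in>U. smooth_at M (\<lambda>q. \<tau> q *v s q) p)" if "c \<in> E" for c
    using that smooth_fun_on_iff[OF triv_open] by (cases c) simp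
  then show ?thesis unfolding smooth_sections_def mem_Collect_eq by (intro ball_cong refl) blast
qed

lemma section_smooth_at:
  "s \<in> smooth_sections M E \<Longrightarrow> (U, \<tau>) \<in> E \<Longrightarrow> p \<in> U \<Longrightarrow> smooth_at M (\<lambda>q. \<tau> q *v s q) p"
  unfolding section_iff by blast

lemma section_scaleR_add:
  assumes "s \<in> smooth_sections M E" "t \<in> smooth_sections M E" "f \<in> smooth_functions M" "g \<in> smooth_functions M"
  shows "(\<lambda>q. f q *\<^sub>R s q + g q *\<^sub>R t q) \<in> smooth_sections M E"
  unfolding section_iff
proof (intro ballI, clarify)
  fix U \<tau> p assume *: "(U, \<tau>) \<in> E" "p \<in> U"
  have "smooth_at M (\<lambda>q. f q *\<^sub>R (\<tau> q *v s q) + g q *\<^sub>R (\<tau> q *v t q)) p"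
    using section_smooth_at[OF assms(1) *] section_smooth_at[OF assms(2) *] assms(3,4)
    by (intro smooth_at_add smooth_at_scaleR) (auto simp: smooth_functions_iff)
  then show "smooth_at M (\<lambda>q. \<tau> q *v (f q *\<^sub>R s q + g q *\<^sub>R t q)) p"
    by (simp add: matrix_vector_right_distrib scaleR_matrix_vector)
qed

lemma section_add: "s \<in> smooth_sections M E \<Longrightarrow> t \<in> smooth_sections M E \<Longrightarrow> (\<lambda>q. s q + t q) \<in> smooth_sections M E"
  using section_scaleR_add[OF _ _ smooth_functions_const smooth_functions_const, of s t 1 1] by simp

lemma section_scaleR: "s \<in> smooth_sections M E \<Longrightarrow> f \<in> smooth_functions M \<Longrightarrow> (\<lambda>q. f q *\<^sub>R s q) \<in> smooth_sections M E"
  using section_scaleR_add[OF _ _ _ smooth_functions_const, of s s f 0] by simp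

lemma section_vec_scale:
  assumes "s \<in> smooth_sections M E"
  shows "(\<lambda>q. c *s s q) \<in> smooth_sections M E"
  unfolding section_iff
proof (intro ballI, clarify)
  fix U \<tau> p assume *: "(U, \<tau>) \<in> E" "p \<in> U"
  show "smooth_at M (\<lambda>q. \<tau> q *v (c *s s q)) p"
    using smooth_at_vec_scale[OF smooth_at_const section_smooth_at[OF assms *]]
    by (simp add: vec_scale_matrix_vector)
qed

text \<open>A function \<open>F\<close> given in one trivialisation becomes a section by inverting
  \<open>\<tau>\<close>, which for a special unitary matrix is the conjugate transpose. In any other
  trivialisation a smooth transition matrix appears, and the cut-off removes the region where it is
  undefined.\<close>

lemma section_from_triv:
  assumes t: "(U, \<tau>) \<in> E" and \<beta>: "\<beta> \<in> smooth_functions M" "closed K" "K \<subseteq> U" "\<And>q. q \<notin> K \<Longrightarrow> \<beta> q = 0"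
    and F: "\<And>q. q \<in> U \<Longrightarrow> smooth_at M F q"
  shows "(\<lambda>q. \<beta> q *\<^sub>R (conj_transpose (\<tau> q) *v F q)) \<in> smooth_sections M E"
  unfolding section_iff
proof (intro ballI, clarify)
  fix U' \<tau>' p assume *: "(U', \<tau>') \<in> E" "p \<in> U'"
  have "smooth_at M (\<lambda>q. \<beta> q *\<^sub>R ((\<tau>' q ** conj_transpose (\<tau> q)) *v F q)) p"
  proof (rule smooth_at_bump_scaleR[OF \<beta>(1,2,4) _ triv_open[OF *(1)] *(2)])
    show "smooth_at M (\<lambda>q. (\<tau>' q ** conj_transpose (\<tau> q)) *v F q) q" if "q \<in> K" "q \<in> U'" for q
      using that \<beta>(3) by (intro smooth_at_matrix_vector triv_transition[OF t *(1)] F) auto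
  qed
  then show "smooth_at M (\<lambda>q. \<tau>' q *v (\<beta> q *\<^sub>R (conj_transpose (\<tau> q) *v F q))) p"
    by (simp add: scaleR_matrix_vector matrix_vector_mul_assoc)
qed

lemma local_sections:
  obtains U \<tau> N \<sigma> where "(U, \<tau>) \<in> E" "open N" "p \<in> N" "N \<subseteq> U" "\<And>i::2. \<sigma> i \<in> smooth_sections M E"
    "\<And>i q. q \<in> N \<Longrightarrow> \<tau> q *v \<sigma> i q = axis i 1"
proof -
  obtain U \<tau> where t: "(U, \<tau>) \<in> E" "p \<in> U" by (rule triv_exists)
  obtain \<beta> K where \<beta>: "\<beta> \<in> smooth_functions M" "\<And>q. 0 \<le> \<beta> q" "closed K" "K \<subseteq> U"
    "\<And>q. q \<notin> K \<Longrightarrow> \<beta> q = 0" "\<forall>\<^sub>F q in nhds p. \<beta> q = 1"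
    using bump_exists[OF triv_open[OF t(1)] t(2)] by metis
  have "\<forall>\<^sub>F q in nhds p. q \<in> U \<and> \<beta> q = 1"
    using \<beta>(6) t triv_open[OF t(1)] by (intro eventually_conj eventually_nhds_in_open) auto
  then obtain N where N: "open N" "p \<in> N" "\<And>q. q \<in> N \<Longrightarrow> q \<in> U \<and> \<beta> q = 1"
    unfolding eventually_nhds by blast
  define \<sigma> where "\<sigma> = (\<lambda>i::2. \<lambda>q. \<beta> q *\<^sub>R (conj_transpose (\<tau> q) *v axis i 1))"
  show ?thesis
  proof (rule that[OF t(1) N(1,2)])
    show "\<sigma> i \<in> smooth_sections M E" for i
      unfolding \<sigma>_def by (rule section_from_triv[OF t(1) \<beta>(1,3,4,5) smooth_at_const])
    show "\<tau> q *v \<sigma> i q = axis i 1" if "q \<in> N" for i q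
      using N(3)[OF that] triv_inverse(2)[OF t(1)] by (simp add: \<sigma>_def)
  qed (use N in auto)
qed

text \<open>Sections reach every vector of a fibre, which makes the endomorphism described by
  \<open>endo_at\<close> unique.\<close>

lemma sections_through:
  obtains s where "s \<in> smooth_sections M E" "s p = u"
proof -
  obtain U \<tau> where t: "(U, \<tau>) \<in> E" "p \<in> U" by (rule triv_exists)
  obtain \<beta> K where \<beta>: "\<beta> \<in> smooth_functions M" "\<And>q. 0 \<le> \<beta> q" "closed K" "K \<subseteq> U"
    "\<And>q. q \<notin> K \<Longrightarrow> \<beta> q = 0" "\<forall>\<^sub>F q in nhds p. \<beta> q = 1"
    using bump_exists[OF triv_open[OF t(1)] t(2)] by metis
  have "(\<lambda>q. \<beta> q *\<^sub>R (conj_transpose (\<tau> q) *v (\<tau> p *v u))) \<in> smooth_sections M E"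
    by (rule section_from_triv[OF t(1) \<beta>(1,3,4,5) smooth_at_const])
  moreover have "\<beta> p *\<^sub>R (conj_transpose (\<tau> p) *v (\<tau> p *v u)) = u"
    using eventually_nhds_x_imp_x[OF \<beta>(6)] triv_inverse(1)[OF t] by simp
  ultimately show ?thesis using that by blast
qed

lemma endo_at_eq:
  assumes "\<And>s. s \<in> smooth_sections M E \<Longrightarrow> L s p = T *v s p"
  shows "endo_at M E p L = T"
  unfolding endo_at_def
proof (rule the_equality)
  fix T' assume T': "\<forall>s\<in>smooth_sections M E. L s p = T' *v s p"
  have "T' *v u = T *v u" for u
    using sections_through[of p u] T' assms by metis
  then show "T' = T" using matrix_eq by blast
qed (use assms in blast)

text \<open>Compactness reduces the cover to finitely many bump functions, at every point one of
  which equals 1. They are not normalised to a partition of unity; the sum of their squares is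
  divided out later.\<close>

lemma smooth_cover:
  obtains P U \<tau> \<beta> K where "finite (P :: 'a set)" "\<And>p. (U p, \<tau> p) \<in> E" "\<And>p. \<beta> p \<in> smooth_functions M"
    "\<And>p. closed (K p)" "\<And>p. K p \<subseteq> U p" "\<And>p q. q \<notin> K p \<Longrightarrow> \<beta> p q = 0" "\<And>q. \<exists>p\<in>P. \<beta> p q = 1"
proof -
  have "\<exists>U \<tau> \<beta> K. (U, \<tau>) \<in> E \<and> \<beta> \<in> smooth_functions M \<and> closed K \<and> K \<subseteq> U \<and> (\<forall>q. q \<notin> K \<longrightarrow> \<beta> q = 0) \<and>
      (\<forall>\<^sub>F q in nhds p. \<beta> q = 1)" for p
  proof -
    obtain U \<tau> where t: "(U, \<tau>) \<in> E" "p \<in> U" by (rule triv_exists)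
    show ?thesis using bump_exists[OF triv_open[OF t(1)] t(2)] t(1) by metis
  qed
  then obtain U \<tau> \<beta> K where *: "\<And>p. (U p, \<tau> p) \<in> E" "\<And>p. \<beta> p \<in> smooth_functions M"
    "\<And>p. closed (K p)" "\<And>p. K p \<subseteq> U p" "\<And>p q. q \<notin> K p \<Longrightarrow> \<beta> p q = 0" "\<And>p. \<forall>\<^sub>F q in nhds p. \<beta> p q = 1"
    by metis
  have "\<exists>N. open N \<and> p \<in> N \<and> (\<forall>q\<in>N. \<beta> p q = 1)" for p using *(6)[of p] unfolding eventually_nhds by blast
  then obtain N where N: "\<And>p. open (N p)" "\<And>p. p \<in> N p" "\<And>p q. q \<in> N p \<Longrightarrow> \<beta> p q = 1" by metis
  obtain P where P: "finite P" "UNIV \<subseteq> (\<Union>p\<in>P. N p)"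
  proof (rule compactE_image[OF compact_UNIV, of UNIV N])
    show "UNIV \<subseteq> (\<Union>p. N p)" using N(2) by blast
  qed (use N(1) in auto)
  have cov: "\<exists>p\<in>P. \<beta> p q = 1" for q using P(2) N(3) by blast
  show ?thesis
    by (rule that[of P U \<tau> \<beta> K]) (fact P(1) * cov)+
qed

text \<open>The fields \<open>\<beta> p (\<tau> p s)\<close> embed the bundle isometrically, up to the factor \<open>w\<close>, in a trivial
  bundle; the connection is the compression of the trivial one, corrected by the logarithmic
  derivative of \<open>w\<close>.\<close>

lemma su2_connection_exists: "\<exists>D. su2_connection M E D"
proof -
  obtain P U \<tau> \<beta> K where P: "finite (P :: 'a set)" and t: "\<And>p. (U p, \<tau> p) \<in> E" and \<beta>: "\<And>p. \<beta> p \<in> smooth_functions M"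
    "\<And>p. closed (K p)" "\<And>p. K p \<subseteq> U p" "\<And>p q. q \<notin> K p \<Longrightarrow> \<beta> p q = 0" and cover: "\<And>q. \<exists>p\<in>P. \<beta> p q = 1"
    by (rule smooth_cover) (rule that, assumption+)
  define \<iota> where "\<iota> = (\<lambda>p s q. \<beta> p q *\<^sub>R (\<tau> p q *v s q))"
  define w where "w = (\<lambda>q. \<Sum>p\<in>P. \<beta> p q * \<beta> p q)"
  define C where "C = (\<lambda>V s q. \<Sum>p\<in>P. \<beta> p q *\<^sub>R (conj_transpose (\<tau> p q) *v vec_derivative (V q) (\<iota> p s)))"
  \<comment> \<open>\<open>C\<close> satisfies a Leibniz rule in which \<open>V f\<close> is
    multiplied by \<open>w\<close>, hence the division by \<open>w\<close>. The forms pulled back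
    from the trivial bundle are \<open>w\<close> times the original ones, so differentiating them
    also differentiates \<open>w\<close>. Half of that logarithmic derivative is subtracted, once in
    each argument of the form.\<close>
  define D where "D = (\<lambda>V s q. inverse (w q) *\<^sub>R C V s q - (V q w * inverse (2 * w q)) *\<^sub>R s q)"
  have w_smooth: "w \<in> smooth_functions M"
    unfolding w_def by (intro smooth_functions_sum smooth_functions_mult \<beta>)
  have w_pos: "w q > 0" for q
  proof -
    obtain p where "p \<in> P" "\<beta> p q = 1" using cover by blast
    then show ?thesis
      unfolding w_def using P by (intro sum_pos2[of P p]) auto
  qed
  have iw_smooth: "(\<lambda>q. inverse (w q)) \<in> smooth_functions M"
    using w_smooth w_pos smooth_at_inverse unfolding smooth_functions_iff by blast
  have \<iota>_smooth: "smooth (\<iota> p s)" if "s \<in> smooth_sections M E" for p s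
    unfolding \<iota>_def
    using smooth_at_bump_scaleR[OF \<beta>(1,2,4) _ open_UNIV UNIV_I] section_smooth_at[OF that t] \<beta>(3) by blast
  have in_U: "q \<in> U p" if "\<beta> p q \<noteq> 0" for p q using that \<beta>(3,4) by blast
  have pull: "(\<Sum>p\<in>P. \<beta> p q *\<^sub>R (conj_transpose (\<tau> p q) *v \<iota> p s q)) = w q *\<^sub>R s q" for s q
  proof -
    have "\<beta> p q *\<^sub>R (conj_transpose (\<tau> p q) *v \<iota> p s q) = (\<beta> p q * \<beta> p q) *\<^sub>R s q" for p
      using triv_inverse(1)[OF t in_U, of p q] by (cases "\<beta> p q = 0") (auto simp: \<iota>_def scaleR_matrix_vector)
    then show ?thesis by (simp add: w_def scaleR_sum_left)
  qed
  have C_section: "C V s \<in> smooth_sections M E" if V: "V \<in> vector_fields M" and s: "s \<in> smooth_sections M E" for V s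
  proof -
    have "smooth (\<lambda>q. vec_derivative (V q) (\<iota> p s))" for p
    proof
      fix q
      have "smooth_at M (\<lambda>q. Complex (V q (\<lambda>q. Re (\<iota> p s q $ i))) (V q (\<lambda>q. Im (\<iota> p s q $ i)))) q" for i
        using vector_field_smooth[OF V] smooth_Re_Im[OF smooth_vec_nth[OF \<iota>_smooth[OF s]]] smooth_functions_iff
        by (intro smooth_at_complex) blast+
      then show "smooth_at M (\<lambda>q. vec_derivative (V q) (\<iota> p s)) q"
        unfolding vec_derivative_def complex_derivative_def
        by (subst smooth_at_vec_iff) simp
    qed
    then have F: "(\<lambda>q. \<beta> p q *\<^sub>R (conj_transpose (\<tau> p q) *v vec_derivative (V q) (\<iota> p s))) \<in> smooth_sections M E" for p
      using section_from_triv[OF t \<beta>] by blast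
    have "(\<lambda>q. \<Sum>p\<in>Q. \<beta> p q *\<^sub>R (conj_transpose (\<tau> p q) *v vec_derivative (V q) (\<iota> p s))) \<in> smooth_sections M E"
      if "finite Q" for Q
      using that
    proof (induction Q)
      case empty
      show ?case using section_scaleR[OF s smooth_functions_const, of 0] by simp
    next
      case (insert p Q)
      then show ?case using section_add[OF F[of p] insert.IH] by simp
    qed
    then show ?thesis using P by (simp add: C_def)
  qed
  have D_section: "D V s \<in> smooth_sections M E" if V: "V \<in> vector_fields M" and s: "s \<in> smooth_sections M E" for V s
  proof -
    have "(\<lambda>q. - (V q w * inverse (2 * w q))) \<in> smooth_functions M"
      using smooth_functions_mult[OF smooth_functions_const[of "- 1 / 2"] smooth_functions_mult[OF vector_field_smooth[OF V w_smooth] iw_smooth]]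
      by (simp add: field_simps)
    from section_scaleR_add[OF C_section[OF V s] s iw_smooth this] show ?thesis
      by (simp add: D_def)
  qed
  have \<iota>_comb: "\<iota> p (\<lambda>q. a *\<^sub>R s q + b *\<^sub>R t q) = (\<lambda>q. a *\<^sub>R \<iota> p s q + b *\<^sub>R \<iota> p t q)" for p s t a b
    by (simp add: \<iota>_def matrix_vector_right_distrib scaleR_matrix_vector algebra_simps)
  have \<iota>_scale: "\<iota> p (\<lambda>q. f q *\<^sub>R s q) = (\<lambda>q. f q *\<^sub>R \<iota> p s q)" for p s f
    by (simp add: \<iota>_def scaleR_matrix_vector mult.commute)
  have \<iota>_vscale: "\<iota> p (\<lambda>q. c *s s q) = (\<lambda>q. c *s \<iota> p s q)" for p s c
    by (simp add: \<iota>_def vec_scale_matrix_vector vec_eq_iff fun_eq_iff)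
  \<comment> \<open>\<open>w * B(s, t)\<close> is the sum of \<open>B\<close> over the components
    \<open>\<iota> p s\<close> and \<open>\<iota> p t\<close> in the trivial bundle. It is
    differentiated there by \<open>dB\<close>, and SU(2) invariance moves \<open>\<tau> p\<close>
    from one argument to its inverse in the other, which assembles \<open>C\<close>.\<close>
  have form: "complex_derivative (V q) (\<lambda>q. B (s q) (t q)) = B (D V s q) (t q) + B (s q) (D V t q)"
    if V: "V \<in> vector_fields M" and s: "s \<in> smooth_sections M E" and t': "t \<in> smooth_sections M E"
      and B: "invariant_form B" and dB: "\<And>v p F G. v \<in> tangent_space M p \<Longrightarrow> smooth F \<Longrightarrow> smooth G \<Longrightarrow>
        complex_derivative v (\<lambda>q. B (F q) (G q)) = B (vec_derivative v F) (G p) + B (F p) (vec_derivative v G)"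
    for V s t q B
  proof -
    have bil: "bounded_bilinear B" and inv: "\<And>T u w. T \<in> SU2 \<Longrightarrow> B (T *v u) (T *v w) = B u w"
      using B by (auto simp: invariant_form_def)
    interpret bounded_bilinear B by (rule bil)
    note vT = vector_field_tangent[OF V, of q]
    define H where "H = (\<lambda>q. B (s q) (t q))"
    have H_smooth: "smooth H"
    proof
      fix r
      obtain U \<tau> where c: "(U, \<tau>) \<in> E" "r \<in> U" by (rule triv_exists)
      have "smooth_at M (\<lambda>q. B (\<tau> q *v s q) (\<tau> q *v t q)) r"
        by (rule smooth_at_bounded_bilinear[OF bil section_smooth_at[OF s c] section_smooth_at[OF t' c]])
      moreover have "\<forall>\<^sub>F q in nhds r. q \<in> U" using triv_open c by (intro eventually_nhds_in_open) auto
      then have "\<forall>\<^sub>F q in nhds r. B (\<tau> q *v s q) (\<tau> q *v t q) = H q"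
        by eventually_elim (use inv triv_SU2[OF c(1)] in \<open>simp add: H_def\<close>)
      ultimately show "smooth_at M H r" by (rule smooth_at_cong)
    qed
    have \<iota>\<iota>: "B (\<iota> p s q) (\<iota> p t q) = (\<beta> p q * \<beta> p q) *\<^sub>R H q" for p q
      using inv[OF triv_SU2[OF t in_U]] by (cases "\<beta> p q = 0") (simp_all add: \<iota>_def H_def scaleR_left scaleR_right zero_left)
    have "(\<lambda>q. w q *\<^sub>R H q) = (\<lambda>q. \<Sum>p\<in>P. B (\<iota> p s q) (\<iota> p t q))"
      by (simp add: w_def scaleR_sum_left \<iota>\<iota>)
    then have "complex_derivative (V q) (\<lambda>q. w q *\<^sub>R H q) = complex_derivative (V q) (\<lambda>q. \<Sum>p\<in>P. B (\<iota> p s q) (\<iota> p t q))"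
      by simp
    also have "\<dots> = (\<Sum>p\<in>P. complex_derivative (V q) (\<lambda>q. B (\<iota> p s q) (\<iota> p t q)))"
      by (rule complex_derivative_sum[OF vT])
        (use smooth_at_bounded_bilinear[OF bil] \<iota>_smooth[OF s] \<iota>_smooth[OF t'] in blast)
    also have "\<dots> = (\<Sum>p\<in>P. B (vec_derivative (V q) (\<iota> p s)) (\<iota> p t q)) + (\<Sum>p\<in>P. B (\<iota> p s q) (vec_derivative (V q) (\<iota> p t)))"
      using dB[OF vT \<iota>_smooth[OF s] \<iota>_smooth[OF t']] by (simp add: sum.distrib)
    also have "(\<Sum>p\<in>P. B (vec_derivative (V q) (\<iota> p s)) (\<iota> p t q)) = B (C V s q) (t q)"
    proof -
      have "B (u) (\<iota> p t q) = B (\<beta> p q *\<^sub>R (conj_transpose (\<tau> p q) *v u)) (t q)" for p u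
      proof (cases "\<beta> p q = 0")
        case False
        note U = in_U[OF False]
        show ?thesis
          using inv[OF triv_SU2[OF t U], of "conj_transpose (\<tau> p q) *v u" "t q"]
          by (simp add: \<iota>_def scaleR_left scaleR_right triv_inverse(2)[OF t U])
      qed (simp add: \<iota>_def zero_left zero_right)
      then show ?thesis by (simp add: C_def sum_left)
    qed
    also have "(\<Sum>p\<in>P. B (\<iota> p s q) (vec_derivative (V q) (\<iota> p t))) = B (s q) (C V t q)"
    proof -
      have "B (\<iota> p s q) u = B (s q) (\<beta> p q *\<^sub>R (conj_transpose (\<tau> p q) *v u))" for p u
      proof (cases "\<beta> p q = 0")
        case False
        note U = in_U[OF False]
        show ?thesis
          using inv[OF triv_SU2[OF t U], of "s q" "conj_transpose (\<tau> p q) *v u"]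
          by (simp add: \<iota>_def scaleR_left scaleR_right triv_inverse(2)[OF t U])
      qed (simp add: \<iota>_def zero_left zero_right)
      then show ?thesis by (simp add: C_def sum_right)
    qed
    finally have *: "V q w *\<^sub>R H q + w q *\<^sub>R complex_derivative (V q) H = B (C V s q) (t q) + B (s q) (C V t q)"
      using complex_derivative_scaleR[OF vT w_smooth H_smooth] by simp
    have "B (D V s q) (t q) + B (s q) (D V t q) =
        inverse (w q) *\<^sub>R (B (C V s q) (t q) + B (s q) (C V t q)) - (V q w * inverse (w q)) *\<^sub>R H q"
    proof -
      have half: "z = (1/2) *\<^sub>R z + (1/2) *\<^sub>R z" for z :: complex by (simp flip: scaleR_left_distrib)
      show ?thesis
        by (subst half[of "(V q w * inverse (w q)) *\<^sub>R H q"])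
          (simp add: D_def H_def diff_left diff_right scaleR_left scaleR_right algebra_simps)
    qed
    also have "\<dots> = complex_derivative (V q) H"
      unfolding *[symmetric] using w_pos[of q] by (simp add: scaleR_add_right mult.commute)
    finally show ?thesis by (simp add: H_def)
  qed
  have C_add: "C (vf_add V W) s q = C V s q + C W s q" for V W s q
  proof -
    have "vec_derivative (vf_add V W q) F = vec_derivative (V q) F + vec_derivative (W q) F" for F
      by (simp add: vec_derivative_def complex_derivative_def vf_add_def vec_eq_iff complex_eq_iff)
    then show ?thesis by (simp add: C_def matrix_vector_right_distrib scaleR_add_right sum.distrib)
  qed
  have C_scale: "C (vf_scale f V) s q = f q *\<^sub>R C V s q" for V f s q
  proof -
    have "vec_derivative (vf_scale f V q) F = f q *\<^sub>R vec_derivative (V q) F" for F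
      by (simp add: vec_derivative_def complex_derivative_def vf_scale_def vec_eq_iff complex_eq_iff)
    then show ?thesis by (simp add: C_def scaleR_matrix_vector scaleR_sum_right mult.commute)
  qed
  have C_comb: "C V (\<lambda>q. a *\<^sub>R s q + b *\<^sub>R t q) q = a *\<^sub>R C V s q + b *\<^sub>R C V t q"
    if V: "V \<in> vector_fields M" and s: "s \<in> smooth_sections M E" and t': "t \<in> smooth_sections M E" for V s t a b q
  proof -
    note vT = vector_field_tangent[OF V, of q]
    have sm: "smooth (\<lambda>q. a *\<^sub>R \<iota> p s q)" "smooth (\<lambda>q. b *\<^sub>R \<iota> p t q)" for p
      using smooth_at_scaleR[OF smooth_at_const] \<iota>_smooth[OF s] \<iota>_smooth[OF t'] by blast+
    show ?thesis
      by (simp add: C_def \<iota>_comb vec_derivative_add[OF vT sm] vec_derivative_scaleR_const[OF vT \<iota>_smooth[OF s]]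
          vec_derivative_scaleR_const[OF vT \<iota>_smooth[OF t']] matrix_vector_right_distrib scaleR_matrix_vector
          scaleR_add_right sum.distrib scaleR_sum_right mult.commute)
  qed
  have C_Leibniz: "C V (\<lambda>q. f q *\<^sub>R s q) q = (V q f * w q) *\<^sub>R s q + f q *\<^sub>R C V s q"
    if V: "V \<in> vector_fields M" and s: "s \<in> smooth_sections M E" and f: "f \<in> smooth_functions M" for V s f q
  proof -
    note vT = vector_field_tangent[OF V, of q]
    have "C V (\<lambda>q. f q *\<^sub>R s q) q = V q f *\<^sub>R (\<Sum>p\<in>P. \<beta> p q *\<^sub>R (conj_transpose (\<tau> p q) *v \<iota> p s q)) + f q *\<^sub>R C V s q"
      by (simp add: C_def \<iota>_scale vec_derivative_scaleR[OF vT f \<iota>_smooth[OF s]] matrix_vector_right_distrib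
          scaleR_matrix_vector scaleR_add_right sum.distrib scaleR_sum_right mult.commute)
    then show ?thesis by (simp add: pull)
  qed
  have C_vscale: "C V (\<lambda>q. c *s s q) q = c *s C V s q"
    if V: "V \<in> vector_fields M" and s: "s \<in> smooth_sections M E" for V s c q
  proof -
    note vT = vector_field_tangent[OF V, of q]
    have "c *s (\<Sum>p\<in>P. F p) = (\<Sum>p\<in>P. c *s F p)" for F :: "'a \<Rightarrow> complex^2"
      by (simp add: vec_eq_iff sum_distrib_left)
    moreover have "b *\<^sub>R (c *s u) = c *s (b *\<^sub>R u)" for b and u :: "complex^2"
      by (simp add: vec_eq_iff)
    ultimately show ?thesis
      by (simp add: C_def \<iota>_vscale vec_derivative_vec_scale[OF vT \<iota>_smooth[OF s]] vec_scale_matrix_vector)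
  qed
  have "su2_connection M E D"
    unfolding su2_connection_def su2_connection_along_def
  proof (intro conjI ballI allI)
    fix V s assume V: "V \<in> vector_fields M" and s: "s \<in> smooth_sections M E"
    show "D V s \<in> smooth_sections M E" by (rule D_section[OF V s])
    show "D (vf_add V W) s = (\<lambda>p. D V s p + D W s p)" if "W \<in> vector_fields M" for W
    proof -
      have "vf_add V W q w = V q w + W q w" for q by (simp add: vf_add_def)
      then show ?thesis by (simp add: D_def C_add fun_eq_iff algebra_simps add_divide_distrib)
    qed
    show "D (vf_scale f V) s = (\<lambda>p. f p *\<^sub>R D V s p)" if "f \<in> smooth_functions M" for f
    proof -
      have "vf_scale f V q w = f q * V q w" for q by (simp add: vf_scale_def)
      then show ?thesis by (simp add: D_def C_scale fun_eq_iff algebra_simps)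
    qed
    show "D V (\<lambda>p. a *\<^sub>R s p + b *\<^sub>R t p) = (\<lambda>p. a *\<^sub>R D V s p + b *\<^sub>R D V t p)" if "t \<in> smooth_sections M E" for t a b
      by (simp add: D_def C_comb[OF V s that] fun_eq_iff algebra_simps)
    show "D V (\<lambda>p. f p *\<^sub>R s p) = (\<lambda>p. V p f *\<^sub>R s p + f p *\<^sub>R D V s p)" if "f \<in> smooth_functions M" for f
    proof
      fix q
      have "inverse (w q) * (V q f * w q) = V q f" using w_pos[of q] by simp
      then have "inverse (w q) *\<^sub>R ((V q f * w q) *\<^sub>R s q) = V q f *\<^sub>R s q" by simp
      then show "D V (\<lambda>p. f p *\<^sub>R s p) q = V q f *\<^sub>R s q + f q *\<^sub>R D V s q"
        by (simp add: D_def C_Leibniz[OF V s that] scaleR_add_right scaleR_diff_right mult.commute)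
    qed
    show "D V (\<lambda>p. \<i> *s s p) = (\<lambda>p. \<i> *s D V s p)"
      by (simp add: D_def C_vscale[OF V s] fun_eq_iff vec_eq_iff algebra_simps)
    fix t p assume t': "t \<in> smooth_sections M E"
    show "complex_derivative (V p) (\<lambda>q. hermitian (s q) (t q)) = hermitian (D V s p) (t p) + hermitian (s p) (D V t p)"
      by (rule form[OF V s t' invariant_form_hermitian complex_derivative_hermitian])
    show "complex_derivative (V p) (\<lambda>q. complex_volume (s q) (t q)) =
        complex_volume (D V s p) (t p) + complex_volume (s p) (D V t p)"
      by (rule form[OF V s t' invariant_form_complex_volume complex_derivative_complex_volume])
  qed
  then show ?thesis by blast
qed

end

section \<open>Residue and curvature\<close>

lemma matrix_mult_bounded_bilinear: "bounded_bilinear (\<lambda>A B :: complex^2^2. A ** B)"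
  unfolding bilinear_conv_bounded_bilinear[symmetric] bilinear_def
  by (auto intro!: linearI simp: matrix_matrix_mult_def vec_eq_iff sum_2 algebra_simps)

interpretation mm: bounded_bilinear "\<lambda>A B :: complex^2^2. A ** B"
  by (rule matrix_mult_bounded_bilinear)

lemma matrix_vector_bounded_bilinear: "bounded_bilinear (\<lambda>(A :: complex^2^2) u. A *v u)"
  unfolding bilinear_conv_bounded_bilinear[symmetric] bilinear_def
  by (auto intro!: linearI simp: matrix_vector_mult_def vec_eq_iff sum_2 algebra_simps)

interpretation mv: bounded_bilinear "\<lambda>(A :: complex^2^2) u. A *v u"
  by (rule matrix_vector_bounded_bilinear)

lemma norm_matrix_trace: "(norm M)\<^sup>2 = Re (trace (conj_transpose M ** M))" for M :: "complex^2^2"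
proof -
  have n: "(norm v)\<^sup>2 = (\<Sum>i\<in>UNIV. (norm (v $ i))\<^sup>2)" for v :: "'b::real_normed_vector^'n::finite"
    by (simp add: norm_vec_def L2_set_def sum_nonneg)
  show ?thesis
    by (simp add: n sum_2 trace_def matrix_matrix_mult_def conj_transpose_def cmod_power2)
      (simp add: power2_eq_square)
qed

text \<open>The residue is a matrix in fibre coordinates that need not vary continuously with the
  point. A trivialisation conjugates it by a special unitary matrix, so its norm is nevertheless a
  meaningful function along the boundary.\<close>

lemma norm_SU2_conj:
  assumes "T \<in> SU2"
  shows "norm (T ** M ** conj_transpose T) = norm M"
proof -
  have c: "conj_transpose (conj_transpose T) = T" by (simp add: conj_transpose_def vec_eq_iff)
  have "conj_transpose (T ** M ** conj_transpose T) ** (T ** M ** conj_transpose T) =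
      T ** (conj_transpose M ** ((conj_transpose T ** T) ** (M ** conj_transpose T)))"
    by (simp add: conj_transpose_mult c matrix_mul_assoc)
  also have "\<dots> = T ** (conj_transpose M ** M ** conj_transpose T)"
    by (simp add: SU2_left[OF assms] matrix_mul_assoc)
  finally have "trace (conj_transpose (T ** M ** conj_transpose T) ** (T ** M ** conj_transpose T)) =
      trace ((conj_transpose M ** M ** conj_transpose T) ** T)"
    by (simp only: trace_mul_sym[of T])
  also have "\<dots> = trace (conj_transpose M ** M)"
    by (simp add: SU2_left[OF assms] flip: matrix_mul_assoc)
  finally have "(norm (T ** M ** conj_transpose T))\<^sup>2 = (norm M)\<^sup>2"
    by (simp add: norm_matrix_trace)
  then show ?thesis by simp
qed

context compact_manifold begin

lemma vector_field_sum:
  assumes "\<And>i. e i \<in> vector_fields M"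
  shows "(\<lambda>q f. \<Sum>i\<in>I. c i * e i q f) \<in> vector_fields M"
  unfolding vector_fields_def
proof (intro CollectI conjI allI ballI)
  show "(\<lambda>f. \<Sum>i\<in>I. c i * e i q f) \<in> tangent_space M q" for q
    by (rule tangent_space_sum[OF vector_field_tangent[OF assms]])
  show "(\<lambda>q. \<Sum>i\<in>I. c i * e i q f) \<in> smooth_functions M" if "f \<in> smooth_functions M" for f
    by (rule smooth_functions_sum[OF smooth_functions_mult[OF smooth_functions_const vector_field_smooth[OF assms that]]])
qed

lemma zero_vector_field_sum:
  assumes "\<And>i. e i \<in> zero_vector_fields M"
  shows "(\<lambda>q f. \<Sum>i\<in>I. c i * e i q f) \<in> zero_vector_fields M"
  using vector_field_sum[OF zero_vector_field_vector_field[OF assms]] zero_vector_field_at_boundary[OF assms]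
  unfolding zero_vector_fields_def by simp

end

section \<open>The residue and the curvature at boundary points\<close>

locale su2_zero_connection_manifold =
  asymptotically_hyperbolic_manifold M g x h + su2_bundle_manifold M E
  for M :: "'a::t2_space chart set" and g x h E +
  fixes A :: "'a connection"
  assumes connection: "su2_zero_connection M E A"
begin

lemma A_section: "V \<in> zero_vector_fields M \<Longrightarrow> s \<in> smooth_sections M E \<Longrightarrow> A V s \<in> smooth_sections M E"
  and A_add: "V \<in> zero_vector_fields M \<Longrightarrow> W \<in> zero_vector_fields M \<Longrightarrow> s \<in> smooth_sections M E \<Longrightarrow>
    A (vf_add V W) s p = A V s p + A W s p"
  and A_scale: "V \<in> zero_vector_fields M \<Longrightarrow> f \<in> smooth_functions M \<Longrightarrow> s \<in> smooth_sections M E \<Longrightarrow>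
    A (vf_scale f V) s p = f p *\<^sub>R A V s p"
  and A_linear: "V \<in> zero_vector_fields M \<Longrightarrow> s \<in> smooth_sections M E \<Longrightarrow> t \<in> smooth_sections M E \<Longrightarrow>
    A V (\<lambda>p. a *\<^sub>R s p + b *\<^sub>R t p) p = a *\<^sub>R A V s p + b *\<^sub>R A V t p"
  and A_Leibniz: "V \<in> zero_vector_fields M \<Longrightarrow> f \<in> smooth_functions M \<Longrightarrow> s \<in> smooth_sections M E \<Longrightarrow>
    A V (\<lambda>p. f p *\<^sub>R s p) p = V p f *\<^sub>R s p + f p *\<^sub>R A V s p"
  and A_imaginary: "V \<in> zero_vector_fields M \<Longrightarrow> s \<in> smooth_sections M E \<Longrightarrow>
    A V (\<lambda>p. \<i> *s s p) p = \<i> *s A V s p"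
  and A_hermitian: "V \<in> zero_vector_fields M \<Longrightarrow> s \<in> smooth_sections M E \<Longrightarrow> t \<in> smooth_sections M E \<Longrightarrow>
    complex_derivative (V p) (\<lambda>q. hermitian (s q) (t q)) = hermitian (A V s p) (t p) + hermitian (s p) (A V t p)"
  and A_volume: "V \<in> zero_vector_fields M \<Longrightarrow> s \<in> smooth_sections M E \<Longrightarrow> t \<in> smooth_sections M E \<Longrightarrow>
    complex_derivative (V p) (\<lambda>q. complex_volume (s q) (t q)) = complex_volume (A V s p) (t p) + complex_volume (s p) (A V t p)"
  using connection unfolding su2_zero_connection_def su2_connection_along_def by simp_all

text \<open>A 0-vector field vanishes at \<open>p\<close>, and with it the derivative term of the
  Leibniz rule. So \<open>A V\<close> is linear over functions at \<open>p\<close>, and it suffices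
  to express a section near \<open>p\<close> through two local ones.\<close>

lemma A_boundary_tensor:
  assumes p: "p \<in> bdry M" and V: "V \<in> zero_vector_fields M"
  shows "\<exists>T. \<forall>s\<in>smooth_sections M E. A V s p = T *v s p"
proof -
  obtain U \<tau> N \<sigma> where t: "(U, \<tau>) \<in> E" and N: "open N" "p \<in> N" "N \<subseteq> U"
    and \<sigma>: "\<And>i::2. \<sigma> i \<in> smooth_sections M E" "\<And>i q. q \<in> N \<Longrightarrow> \<tau> q *v \<sigma> i q = axis i 1"
    by (rule local_sections) (rule that, assumption+)
  obtain \<beta> K where \<beta>: "\<beta> \<in> smooth_functions M" "\<And>q. 0 \<le> \<beta> q" "closed K" "K \<subseteq> N"
    "\<And>q. q \<notin> K \<Longrightarrow> \<beta> q = 0" "\<forall>\<^sub>F q in nhds p. \<beta> q = 1"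
    using bump_exists[OF N(1,2)] by metis
  have \<beta>p: "\<beta> p = 1" using eventually_nhds_x_imp_x[OF \<beta>(6)] .
  have V0: "V p f = 0" for f using zero_vector_field_at_boundary[OF V p] .
  have "A V s p = ((\<chi> k j. A V (\<sigma> j) p $ k) ** \<tau> p) *v s p" if s: "s \<in> smooth_sections M E" for s
  proof -
    define a where "a = (\<lambda>i::2. \<lambda>q. \<beta> q * Re ((\<tau> q *v s q) $ i))"
    define b where "b = (\<lambda>i::2. \<lambda>q. \<beta> q * Im ((\<tau> q *v s q) $ i))"
    have c: "smooth_at M (\<lambda>q. (\<tau> q *v s q) $ i) q" if "q \<in> K" for i q
      using section_smooth_at[OF s t] that \<beta>(4) N(3) smooth_at_vec_iff[of "\<lambda>q. \<tau> q *v s q" q] by blast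
    have "smooth_at M (\<lambda>q. \<beta> q *\<^sub>R Re ((\<tau> q *v s q) $ i)) q" for i q
      by (rule smooth_at_bump_scaleR[OF \<beta>(1,3,5) smooth_at_bounded_linear[OF bounded_linear_Re c] open_UNIV UNIV_I])
    then have a_smooth: "a i \<in> smooth_functions M" for i by (simp add: a_def smooth_functions_iff)
    have "smooth_at M (\<lambda>q. \<beta> q *\<^sub>R Im ((\<tau> q *v s q) $ i)) q" for i q
      by (rule smooth_at_bump_scaleR[OF \<beta>(1,3,5) smooth_at_bounded_linear[OF bounded_linear_Im c] open_UNIV UNIV_I])
    then have b_smooth: "b i \<in> smooth_functions M" for i by (simp add: b_def smooth_functions_iff)
    \<comment> \<open>The coefficients are complex but the Leibniz rule is stated for real
      functions; they are split into real and imaginary parts, and multiplication by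
      \<open>\<i>\<close> is passed through separately.\<close>
    define S where "S = (\<lambda>i q. a i q *\<^sub>R \<sigma> i q + b i q *\<^sub>R (\<i> *s \<sigma> i q))"
    have i\<sigma>: "(\<lambda>q. \<i> *s \<sigma> i q) \<in> smooth_sections M E" for i by (rule section_vec_scale[OF \<sigma>(1)])
    have Ssec: "S i \<in> smooth_sections M E" for i
      unfolding S_def by (rule section_scaleR_add[OF \<sigma>(1) i\<sigma> a_smooth b_smooth])
    have Sq: "\<beta> q *\<^sub>R s q = S 1 q + S 2 q" for q
    proof (cases "q \<in> N")
      case True
      then have U: "q \<in> U" using N by blast
      have "\<tau> q *v (S 1 q + S 2 q) = \<beta> q *\<^sub>R (\<tau> q *v s q)"
        by (simp add: S_def mv.add_right mv.scaleR_right vec_scale_matrix_vector \<sigma>(2)[OF True] vec_eq_iff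
            forall_2 axis_def a_def b_def complex_eq_iff)
      then have "conj_transpose (\<tau> q) *v (\<tau> q *v (S 1 q + S 2 q)) = conj_transpose (\<tau> q) *v (\<tau> q *v (\<beta> q *\<^sub>R s q))"
        by (simp add: mv.scaleR_right)
      then show ?thesis using triv_inverse(1)[OF t U] by simp
    next
      case False
      then have "\<beta> q = 0" using \<beta> by blast
      then show ?thesis by (simp add: S_def a_def b_def)
    qed
    have AS: "A V (S i) p = ((\<tau> p *v s p) $ i) *s A V (\<sigma> i) p" for i
    proof -
      have "A V (S i) p = A V (\<lambda>q. a i q *\<^sub>R \<sigma> i q) p + A V (\<lambda>q. b i q *\<^sub>R (\<i> *s \<sigma> i q)) p"
        using A_linear[OF V section_scaleR[OF \<sigma>(1) a_smooth] section_scaleR[OF i\<sigma> b_smooth], of 1 i i 1 i i] by (simp add: S_def)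
      also have "\<dots> = a i p *\<^sub>R A V (\<sigma> i) p + b i p *\<^sub>R (\<i> *s A V (\<sigma> i) p)"
        using A_Leibniz[OF V a_smooth \<sigma>(1)] A_Leibniz[OF V b_smooth i\<sigma>] A_imaginary[OF V \<sigma>(1)] V0 by simp
      also have "\<dots> = ((\<tau> p *v s p) $ i) *s A V (\<sigma> i) p"
        by (simp add: a_def b_def \<beta>p vec_eq_iff complex_eq_iff)
      finally show ?thesis .
    qed
    have "A V s p = A V (\<lambda>q. \<beta> q *\<^sub>R s q) p" using A_Leibniz[OF V \<beta>(1) s] V0 \<beta>p by simp
    also have "\<dots> = A V (S 1) p + A V (S 2) p"
      using A_linear[OF V Ssec Ssec, of 1 1 1 2] by (simp add: Sq)
    also have "\<dots> = (\<chi> k j. A V (\<sigma> j) p $ k) *v (\<tau> p *v s p)"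
      by (simp add: AS vec_eq_iff matrix_vector_mult_def[of "\<chi> k j. A V (\<sigma> j) p $ k"] sum_2 mult.commute)
    finally show ?thesis by (simp add: matrix_vector_mul_assoc)
  qed
  then show ?thesis by blast
qed

text \<open>For the chosen ordinary connection, \<open>D V s = x D V' s\<close> vanishes at
  \<open>p\<close>. So whatever the choice, the residue is the value of \<open>A V\<close>
  itself.\<close>

lemma residue_eqI:
  assumes p: "p \<in> bdry M" and V: "V \<in> zero_vector_fields M"
    and T: "\<And>s. s \<in> smooth_sections M E \<Longrightarrow> A V s p = T *v s p"
  shows "residue M E A V p = T"
  unfolding residue_def Let_def
proof (rule endo_at_eq)
  fix s assume s: "s \<in> smooth_sections M E"
  define D where "D = (SOME D. su2_connection M E D)"
  have D: "su2_connection M E D" unfolding D_def using su2_connection_exists by (rule someI_ex)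
  have "D (vf_scale x (rs V)) s = (\<lambda>p. x p *\<^sub>R D (rs V) s p)"
    using D s bdf_smooth[OF x_bdf] rs_vector_field[OF V]
    unfolding su2_connection_def su2_connection_along_def by blast
  then have "D V s p = 0"
    using vf_scale_rescale[OF x_bdf V] bdf_zero_iff[OF x_bdf, of p] p by simp
  then show "A V s p - (SOME D. su2_connection M E D) V s p = T *v s p"
    using T[OF s] by (simp add: D_def)
qed

lemma residue_apply:
  assumes "p \<in> bdry M" "V \<in> zero_vector_fields M" "s \<in> smooth_sections M E"
  shows "A V s p = residue M E A V p *v s p"
  using A_boundary_tensor[OF assms(1,2)] residue_eqI[OF assms(1,2)] assms(3) by metis

text \<open>The derivatives of the two pairings along \<open>V\<close> vanish at \<open>p\<close>.
  Preserving the Hermitian form then says that the residue is skew-Hermitian, and preserving the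
  volume form that its trace is zero.\<close>

lemma residue_su2:
  assumes p: "p \<in> bdry M" and V: "V \<in> zero_vector_fields M"
  shows "residue M E A V p \<in> su2"
proof -
  let ?T = "residue M E A V p"
  have "V p = (\<lambda>f. 0)" using zero_vector_field_at_boundary[OF V p] by blast
  then have 0: "complex_derivative (V p) F = 0" for F by (simp add: complex_derivative_def complex_eq_iff)
  have H: "hermitian (?T *v u) w + hermitian u (?T *v w) = 0" "complex_volume (?T *v u) w + complex_volume u (?T *v w) = 0" for u w
  proof -
    obtain s t where s: "s \<in> smooth_sections M E" "s p = u" and t: "t \<in> smooth_sections M E" "t p = w"
      using sections_through by metis
    show "hermitian (?T *v u) w + hermitian u (?T *v w) = 0" "complex_volume (?T *v u) w + complex_volume u (?T *v w) = 0"
      using A_hermitian[OF V s(1) t(1), of p] A_volume[OF V s(1) t(1), of p] s t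
      by (simp_all add: 0 residue_apply[OF p V])
  qed
  have "?T $ j $ i + cnj (?T $ i $ j) = 0" for i j
    using H(1)[of "axis i 1" "axis j 1"] exhaust_2[of i] exhaust_2[of j]
    by (auto simp: hermitian_def sum_2 matrix_vector_mult_def axis_def)
  then have c: "cnj (?T $ j $ i) = - ?T $ i $ j" for i j
    by (metis add_eq_0_iff add.commute)
  have "?T $ 1 $ 1 + ?T $ 2 $ 2 = 0"
    using H(2)[of "axis 1 1" "axis 2 1"] by (simp add: complex_volume_def matrix_vector_mult_def sum_2 axis_def)
  then show ?thesis using c by (simp add: su2_def conj_transpose_def vec_eq_iff trace_def sum_2)
qed

lemma residue_add:
  assumes p: "p \<in> bdry M" and V: "V \<in> zero_vector_fields M" and W: "W \<in> zero_vector_fields M"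
  shows "residue M E A (vf_add V W) p = residue M E A V p + residue M E A W p"
  by (rule residue_eqI[OF p zero_vector_field_add[OF V W]])
    (simp add: A_add[OF V W] residue_apply[OF p V] residue_apply[OF p W] mv.add_left)

lemma residue_scale:
  assumes p: "p \<in> bdry M" and V: "V \<in> zero_vector_fields M" and f: "f \<in> smooth_functions M"
  shows "residue M E A (vf_scale f V) p = f p *\<^sub>R residue M E A V p"
  by (rule residue_eqI[OF p zero_vector_field_scale[OF V f]])
    (simp add: A_scale[OF V f] residue_apply[OF p V] mv.scaleR_left)

lemma residue_sum_smooth:
  assumes p: "p \<in> bdry M" and I: "finite I" and f: "\<And>i. i \<in> I \<Longrightarrow> f i \<in> smooth_functions M"
    and W: "\<And>i. i \<in> I \<Longrightarrow> W i \<in> zero_vector_fields M"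
  shows "(\<lambda>q k. \<Sum>i\<in>I. f i q * W i q k) \<in> zero_vector_fields M \<and>
    residue M E A (\<lambda>q k. \<Sum>i\<in>I. f i q * W i q k) p = (\<Sum>i\<in>I. f i p *\<^sub>R residue M E A (W i) p)"
  using I f W
proof (induction I)
  case empty
  obtain V where V: "V \<in> vector_fields M"
    using tangent_extension[OF tangent_space_zero, of p] by blast
  have e: "(\<lambda>q k. 0) = vf_scale (\<lambda>q. 0) (vf_scale x V)" by (simp add: vf_scale_def)
  note z = bdf_scale_zero_vector_field[OF x_bdf V]
  show ?case
    using residue_scale[OF p z smooth_functions_const, of 0] zero_vector_field_scale[OF z smooth_functions_const, of 0]
    by (simp flip: e)
next
  case (insert j I)
  have IH: "(\<lambda>q k. \<Sum>i\<in>I. f i q * W i q k) \<in> zero_vector_fields M"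
    "residue M E A (\<lambda>q k. \<Sum>i\<in>I. f i q * W i q k) p = (\<Sum>i\<in>I. f i p *\<^sub>R residue M E A (W i) p)"
    using insert by auto
  have j: "f j \<in> smooth_functions M" "W j \<in> zero_vector_fields M" using insert by auto
  have e: "(\<lambda>q k. \<Sum>i\<in>insert j I. f i q * W i q k) = vf_add (vf_scale (f j) (W j)) (\<lambda>q k. \<Sum>i\<in>I. f i q * W i q k)"
    using insert by (simp add: vf_add_def vf_scale_def)
  note z = zero_vector_field_scale[OF j(2,1)]
  show ?case
    unfolding e using residue_add[OF p z IH(1)] residue_scale[OF p j(2,1)] zero_vector_field_add[OF z IH(1)] IH(2) insert(1,2)
    by simp
qed

lemma residue_zero_null:
  assumes p: "p \<in> bdry M" and V: "V \<in> zero_null M p"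
  shows "residue M E A V p = 0"
proof -
  obtain n f W where V: "V = (\<lambda>q k. \<Sum>i<(n::nat). f i q * W i q k)"
    and *: "\<And>i. i < n \<Longrightarrow> f i \<in> smooth_functions M" "\<And>i. i < n \<Longrightarrow> f i p = 0" "\<And>i. i < n \<Longrightarrow> W i \<in> zero_vector_fields M"
    using V unfolding zero_null_def by blast
  show ?thesis
    using residue_sum_smooth[OF p, of "{..<n}" f W] * by (simp add: V)
qed

text \<open>The residue depends only on the rescaled vector at \<open>p\<close>: the difference of
  \<open>V\<close> and the corresponding combination rescales to zero there, hence lies in
  \<open>zero_null\<close>, on which the residue vanishes.\<close>

lemma residue_combination:
  assumes p: "p \<in> bdry M" and V: "V \<in> zero_vector_fields M" and e: "\<And>i::'i::finite. e i \<in> zero_vector_fields M"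
    and eq: "rs V p = (\<lambda>f. \<Sum>i\<in>UNIV. c i * rs (e i) p f)"
  shows "residue M E A V p = (\<Sum>i\<in>UNIV. c i *\<^sub>R residue M E A (e i) p)"
proof -
  define S where "S = (\<lambda>q k. \<Sum>i\<in>UNIV. c i * e i q k)"
  have S: "S \<in> zero_vector_fields M" unfolding S_def by (rule zero_vector_field_sum[OF e])
  have "S = vf_scale x (\<lambda>q f. \<Sum>i\<in>UNIV. c i * rs (e i) q f)"
    unfolding S_def vf_scale_def using zero_vector_field_apply[OF x_bdf e]
    by (simp add: sum_distrib_left mult_ac fun_eq_iff)
  then have rsS: "rs S = (\<lambda>q f. \<Sum>i\<in>UNIV. c i * rs (e i) q f)"
    using rescale_unique[OF x_bdf vector_field_sum[OF rs_vector_field[OF e]]] by simp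
  have m: "vf_scale (\<lambda>q. -1) S \<in> zero_vector_fields M" by (rule zero_vector_field_scale[OF S smooth_functions_const])
  define Z where "Z = vf_add V (vf_scale (\<lambda>q. -1) S)"
  have Z: "Z \<in> zero_vector_fields M" unfolding Z_def by (rule zero_vector_field_add[OF V m])
  have "rs Z p = (\<lambda>f. 0)"
    unfolding Z_def rescale_add[OF x_bdf V m] rescale_scale[OF x_bdf S smooth_functions_const]
    by (simp add: vf_add_def vf_scale_def eq rsS)
  then have "residue M E A Z p = 0" by (intro residue_zero_null[OF p] zero_nullI[OF x_bdf Z])
  then have "residue M E A V p = residue M E A S p"
    unfolding Z_def residue_add[OF p V m] residue_scale[OF p S smooth_functions_const] by simp
  also have "\<dots> = (\<Sum>i\<in>UNIV. c i *\<^sub>R residue M E A (e i) p)"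
    using residue_sum_smooth[OF p, of UNIV "\<lambda>i q. c i" e] e smooth_functions_const by (simp add: S_def)
  finally show ?thesis .
qed

text \<open>The product rule for \<open>[x V', x W']\<close>. The remainder is
  \<open>x^2 [V', W']\<close>, that is, \<open>x\<close> times a 0-vector field; mere vanishing at
  the boundary as an ordinary field, which all 0-vector fields share, would not make its residue
  zero.\<close>

lemma lie_bracket_zero:
  assumes V: "V \<in> zero_vector_fields M" and W: "W \<in> zero_vector_fields M"
  shows "lie_bracket M V W = vf_add (vf_scale (\<lambda>q. rs V q x) W)
    (vf_add (vf_scale (\<lambda>q. - rs W q x) V) (vf_scale x (vf_scale x (lie_bracket M (rs V) (rs W)))))"
proof (intro ext)
  fix q f
  note V' = rs_vector_field[OF V] and W' = rs_vector_field[OF W] and xs = bdf_smooth[OF x_bdf]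
  show "lie_bracket M V W q f = vf_add (vf_scale (\<lambda>q. rs V q x) W)
    (vf_add (vf_scale (\<lambda>q. - rs W q x) V) (vf_scale x (vf_scale x (lie_bracket M (rs V) (rs W))))) q f"
  proof (cases "f \<in> smooth_functions M")
    case True
    have 1: "V q (\<lambda>r. W r f) = x q * (x q * rs V q (\<lambda>r. rs W r f) + rs W q f * rs V q x)"
      using zero_vector_field_apply[OF x_bdf V, of q "\<lambda>r. W r f"] zero_vector_field_apply[OF x_bdf W, of _ f]
        vector_field_linear(2)[OF V' xs vector_field_smooth[OF W' True], of q] by simp
    have 2: "W q (\<lambda>r. V r f) = x q * (x q * rs W q (\<lambda>r. rs V r f) + rs V q f * rs W q x)"
      using zero_vector_field_apply[OF x_bdf W, of q "\<lambda>r. V r f"] zero_vector_field_apply[OF x_bdf V, of _ f]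
        vector_field_linear(2)[OF W' xs vector_field_smooth[OF V' True], of q] by simp
    show ?thesis
      using True zero_vector_field_apply[OF x_bdf W, of q f] zero_vector_field_apply[OF x_bdf V, of q f]
      by (simp add: lie_bracket_def vf_add_def vf_scale_def 1 2 algebra_simps)
  next
    case False
    have "V q f = 0" "W q f = 0"
      using tangent_nonsmooth[OF vector_field_tangent[OF zero_vector_field_vector_field[OF V]] False]
        tangent_nonsmooth[OF vector_field_tangent[OF zero_vector_field_vector_field[OF W]] False] by auto
    then show ?thesis using False by (simp add: lie_bracket_def vf_add_def vf_scale_def)
  qed
qed

lemma residue_lie_bracket:
  assumes p: "p \<in> bdry M" and V: "V \<in> zero_vector_fields M" and W: "W \<in> zero_vector_fields M"
  shows "lie_bracket M V W \<in> zero_vector_fields M"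
    "residue M E A (lie_bracket M V W) p = rs V p x *\<^sub>R residue M E A W p - rs W p x *\<^sub>R residue M E A V p"
proof -
  note V' = rs_vector_field[OF V] and W' = rs_vector_field[OF W] and xs = bdf_smooth[OF x_bdf]
  note b = bdf_scale_zero_vector_field[OF x_bdf lie_bracket_vector_field[OF V' W']]
  note sV = vector_field_smooth[OF V' xs] and sW = smooth_functions_diff[OF smooth_functions_const vector_field_smooth[OF W' xs], of 0, simplified]
  note z1 = zero_vector_field_scale[OF W sV] and z2 = zero_vector_field_scale[OF V sW] and z3 = zero_vector_field_scale[OF b xs]
  note z23 = zero_vector_field_add[OF z2 z3]
  show "lie_bracket M V W \<in> zero_vector_fields M"
    unfolding lie_bracket_zero[OF V W] by (rule zero_vector_field_add[OF z1 z23])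
  show "residue M E A (lie_bracket M V W) p = rs V p x *\<^sub>R residue M E A W p - rs W p x *\<^sub>R residue M E A V p"
    unfolding lie_bracket_zero[OF V W] residue_add[OF p z1 z23] residue_add[OF p z2 z3]
      residue_scale[OF p W sV] residue_scale[OF p V sW] residue_scale[OF p b xs]
    using bdf_zero_iff[OF x_bdf, of p] p by simp
qed

lemma curvature_eq:
  assumes p: "p \<in> bdry M" and V: "V \<in> zero_vector_fields M" and W: "W \<in> zero_vector_fields M"
  defines "R \<equiv> \<lambda>V. residue M E A V p"
  shows "curvature M E A p V W = R V ** R W - R W ** R V - rs V p x *\<^sub>R R W + rs W p x *\<^sub>R R V"
  unfolding curvature_def
proof (rule endo_at_eq)
  fix s assume s: "s \<in> smooth_sections M E"
  note L = residue_lie_bracket[OF p V W]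
  show "A V (A W s) p - A W (A V s) p - A (lie_bracket M V W) s p =
      (R V ** R W - R W ** R V - rs V p x *\<^sub>R R W + rs W p x *\<^sub>R R V) *v s p"
    unfolding residue_apply[OF p V A_section[OF W s]] residue_apply[OF p W A_section[OF V s]]
      residue_apply[OF p L(1) s] residue_apply[OF p V s] residue_apply[OF p W s] L(2) R_def
    by (simp add: mv.diff_left mv.add_left mv.scaleR_left matrix_vector_mul_assoc)
qed

text \<open>\<open>Q\<close> is the matrix of \<open>A V\<close> in a trivialisation, obtained by
  applying \<open>A V\<close> to two fixed local sections. It is smooth also off the boundary, where
  \<open>A V\<close> is not tensorial, and is conjugate to the residue on the boundary.\<close>

lemma residue_norm_continuous:
  assumes p: "p \<in> bdry M" and V: "V \<in> zero_vector_fields M"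
  obtains \<theta> where "isCont \<theta> p" "\<forall>\<^sub>F q in nhds p. q \<in> bdry M \<longrightarrow> \<theta> q = norm (residue M E A V q)"
proof -
  obtain U \<tau> N \<sigma> where t: "(U, \<tau>) \<in> E" and N: "open N" "p \<in> N" "N \<subseteq> U"
    and \<sigma>: "\<And>i::2. \<sigma> i \<in> smooth_sections M E" "\<And>i q. q \<in> N \<Longrightarrow> \<tau> q *v \<sigma> i q = axis i 1"
    by (rule local_sections) (rule that, assumption+)
  define Q where "Q = (\<lambda>q. (\<chi> k j. (\<tau> q *v A V (\<sigma> j) q) $ k) :: complex^2^2)"
  have "smooth_at M (\<lambda>q. \<tau> q *v A V (\<sigma> j) q) p" for j
    using section_smooth_at[OF A_section[OF V \<sigma>(1)] t] N by blast
  then have "smooth_at M (\<lambda>q. (\<tau> q *v A V (\<sigma> j) q) $ k) p" for j k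
    using smooth_at_vec_iff[of "\<lambda>q. \<tau> q *v A V (\<sigma> j) q" p] by blast
  then have "smooth_at M Q p"
    unfolding Q_def by (subst smooth_at_vec_iff, intro allI, subst smooth_at_vec_iff) simp
  then have c: "isCont (\<lambda>q. norm (Q q)) p" by (intro continuous_norm smooth_at_isCont)
  have "\<forall>\<^sub>F q in nhds p. q \<in> N" using N by (intro eventually_nhds_in_open)
  then have "\<forall>\<^sub>F q in nhds p. q \<in> bdry M \<longrightarrow> norm (Q q) = norm (residue M E A V q)"
  proof eventually_elim
    case (elim q)
    show ?case
    proof
      assume q: "q \<in> bdry M"
      have U: "q \<in> U" using elim N by blast
      have \<sigma>q: "\<sigma> j q = conj_transpose (\<tau> q) *v axis j 1" for j
        using \<sigma>(2)[OF elim, of j] triv_inverse(1)[OF t U, of "\<sigma> j q"] by simp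
      have "Q q *v axis j 1 = (\<tau> q ** residue M E A V q ** conj_transpose (\<tau> q)) *v axis j 1" for j
      proof -
        have "Q q *v axis j 1 = \<tau> q *v A V (\<sigma> j) q"
          by (simp add: Q_def matrix_vector_mult_def[of "\<chi> k j. (\<tau> q *v A V (\<sigma> j) q) $ k"] vec_eq_iff axis_def if_distrib cong: if_cong)
        then show ?thesis
          by (simp add: residue_apply[OF q V \<sigma>(1)] \<sigma>q matrix_vector_mul_assoc matrix_mul_assoc)
      qed
      moreover have "(B *v axis j 1) $ i = B $ i $ j" for B :: "complex^2^2" and i j
        by (simp add: matrix_vector_mult_def axis_def if_distrib cong: if_cong)
      ultimately have "Q q $ i $ j = (\<tau> q ** residue M E A V q ** conj_transpose (\<tau> q)) $ i $ j" for i j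
        by metis
      then have "Q q = \<tau> q ** residue M E A V q ** conj_transpose (\<tau> q)" by (simp add: vec_eq_iff)
      then show "norm (Q q) = norm (residue M E A V q)" using norm_SU2_conj[OF triv_SU2[OF t U]] by simp
    qed
  qed
  with c show ?thesis by (rule that)
qed

end

section \<open>Self-duality at the boundary\<close>

lemma bounded_bilinear_combinations:
  assumes "bounded_bilinear B"
  shows "B (\<Sum>i\<in>I. k i *\<^sub>R u i) (\<Sum>j\<in>J. l j *\<^sub>R v j) = (\<Sum>i\<in>I. \<Sum>j\<in>J. (k i * l j) *\<^sub>R B (u i) (v j))"
proof -
  interpret bounded_bilinear B by fact
  have "B (\<Sum>i\<in>I. k i *\<^sub>R u i) (\<Sum>j\<in>J. l j *\<^sub>R v j) = (\<Sum>i\<in>I. B (k i *\<^sub>R u i) (\<Sum>j\<in>J. l j *\<^sub>R v j))"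
    by (rule sum_left)
  also have "\<dots> = (\<Sum>i\<in>I. \<Sum>j\<in>J. (k i * l j) *\<^sub>R B (u i) (v j))"
    by (intro sum.cong refl) (simp add: sum_right scaleR_left scaleR_right scaleR_sum_right mult.commute)
  finally show ?thesis .
qed

context su2_zero_connection_manifold begin

abbreviation res :: "'a vfield \<Rightarrow> 'a \<Rightarrow> complex^2^2" where "res \<equiv> residue M E A"

text \<open>At a boundary point each term of the curvature formula is bilinear in the residues and
  the normal derivatives, both of which are linear in the rescaled vectors.\<close>

lemma curvature_expansion:
  fixes e :: "4 \<Rightarrow> 'a vfield"
  assumes p: "p \<in> bdry M" and V: "V \<in> zero_vector_fields M" and W: "W \<in> zero_vector_fields M"
    and e: "\<And>i. e i \<in> zero_vector_fields M"
    and k: "rs V p = (\<lambda>f. \<Sum>i\<in>UNIV. k i * rs (e i) p f)" and l: "rs W p = (\<lambda>f. \<Sum>i\<in>UNIV. l i * rs (e i) p f)"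
  shows "curvature M E A p V W = (\<Sum>i\<in>UNIV. \<Sum>j\<in>UNIV. (k i * l j) *\<^sub>R curvature M E A p (e i) (e j))"
proof -
  define R where "R = (\<lambda>i. res (e i) p)"
  define a where "a = (\<lambda>i. rs (e i) p x)"
  have RV: "res V p = (\<Sum>i\<in>UNIV. k i *\<^sub>R R i)" unfolding R_def by (rule residue_combination[OF p V e k])
  have RW: "res W p = (\<Sum>i\<in>UNIV. l i *\<^sub>R R i)" unfolding R_def by (rule residue_combination[OF p W e l])
  have aV: "rs V p x = (\<Sum>i\<in>UNIV. k i *\<^sub>R a i)" unfolding k a_def by simp
  have aW: "rs W p x = (\<Sum>i\<in>UNIV. l i *\<^sub>R a i)" unfolding l a_def by simp
  have 1: "res V p ** res W p = (\<Sum>i\<in>UNIV. \<Sum>j\<in>UNIV. (k i * l j) *\<^sub>R (R i ** R j))"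
    unfolding RV RW by (rule bounded_bilinear_combinations[OF matrix_mult_bounded_bilinear])
  have 2: "res W p ** res V p = (\<Sum>i\<in>UNIV. \<Sum>j\<in>UNIV. (k i * l j) *\<^sub>R (R j ** R i))"
    unfolding RV RW bounded_bilinear_combinations[OF matrix_mult_bounded_bilinear]
    by (subst sum.swap) (simp add: mult.commute)
  have 3: "rs V p x *\<^sub>R res W p = (\<Sum>i\<in>UNIV. \<Sum>j\<in>UNIV. (k i * l j) *\<^sub>R (a i *\<^sub>R R j))"
    unfolding aV RW by (rule bounded_bilinear_combinations[OF bounded_bilinear_scaleR])
  have 4: "rs W p x *\<^sub>R res V p = (\<Sum>i\<in>UNIV. \<Sum>j\<in>UNIV. (k i * l j) *\<^sub>R (a j *\<^sub>R R i))"
    unfolding aW RV bounded_bilinear_combinations[OF bounded_bilinear_scaleR]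
    by (subst sum.swap) (simp add: mult.commute)
  show ?thesis
    unfolding curvature_eq[OF p V W] curvature_eq[OF p e e] 1 2 3 4 R_def a_def
    by (simp only: scaleR_add_right scaleR_diff_right sum.distrib sum_subtractf)
qed

definition asd_at :: "'a \<Rightarrow> bool" where
  "asd_at p \<longleftrightarrow> (\<forall>V\<in>zero_vector_fields M. \<forall>W\<in>zero_vector_fields M. curvature_minus M g E A p V W = 0)"

text \<open>The frame produced is the one selected inside \<open>hodge_star\<close>. Nothing is
  known about it beyond \<open>zero_frame\<close>, so it is handed on rather than quantified
  over.\<close>

lemma asd_at_iff:
  assumes p: "p \<in> bdry M"
  obtains e where "zero_frame M g p e"
    "asd_at p \<longleftrightarrow> curvature M E A p (e 1) (e 2) = curvature M E A p (e 3) (e 4) \<and>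
      curvature M E A p (e 1) (e 3) = curvature M E A p (e 4) (e 2) \<and>
      curvature M E A p (e 1) (e 4) = curvature M E A p (e 2) (e 3)"
proof
  define e where "e = (SOME e. zero_frame M g p e)"
  obtain e' where "zero_frame M g p e'" by (rule zero_frame_exists[OF p])
  then show z: "zero_frame M g p e" unfolding e_def by (rule someI[of "zero_frame M g p"])
  have e: "e i \<in> zero_vector_fields M" and b: "orthonormal p (\<lambda>i. rs (e i) p)" for i
    using z zero_frame_iff[OF p] by auto
  define F where "F = (\<lambda>i j. curvature M E A p (e i) (e j))"
  define k where "k = (\<lambda>V i. zero_metric M g (e i) V p)"
  have F: "F j i = - F i j" for i j
    unfolding F_def curvature_eq[OF p e e] by simp
  have k_rs: "rs V p = (\<lambda>f. \<Sum>i\<in>UNIV. k V i * rs (e i) p f)" if V: "V \<in> zero_vector_fields M" for V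
  proof -
    have "k V i = h p (rs V p) (rs (e i) p)" for i
      unfolding k_def zero_metric_eq(1)[OF e V] by (rule h_sym[OF rs_tangent[OF e] rs_tangent[OF V]])
    then show ?thesis using orthonormal_expansion[OF b rs_tangent[OF V]] by simp
  qed
  have ke: "k (e j) i = (if i = j then 1 else 0)" for i j
    unfolding k_def zero_metric_eq(1)[OF e e] using orthonormal_metric[OF b] by simp
  have cm: "curvature_minus M g E A p V W = (1/2) *\<^sub>R (
      (k V 1 * k W 2 - k V 2 * k W 1 - (k V 3 * k W 4 - k V 4 * k W 3)) *\<^sub>R (F 1 2 - F 3 4) +
      (k V 1 * k W 3 - k V 3 * k W 1 - (k V 4 * k W 2 - k V 2 * k W 4)) *\<^sub>R (F 1 3 - F 4 2) +
      (k V 1 * k W 4 - k V 4 * k W 1 - (k V 2 * k W 3 - k V 3 * k W 2)) *\<^sub>R (F 1 4 - F 2 3))"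
    if V: "V \<in> zero_vector_fields M" and W: "W \<in> zero_vector_fields M" for V W
    unfolding curvature_minus_def hodge_star_def Let_def e_def[symmetric]
      curvature_expansion[OF p V W e k_rs[OF V] k_rs[OF W]] hodge_4[of F "k V" "k W", OF F, symmetric]
    by (simp only: F_def k_def)
  show "asd_at p \<longleftrightarrow> curvature M E A p (e 1) (e 2) = curvature M E A p (e 3) (e 4) \<and>
      curvature M E A p (e 1) (e 3) = curvature M E A p (e 4) (e 2) \<and>
      curvature M E A p (e 1) (e 4) = curvature M E A p (e 2) (e 3)"
    unfolding F_def[THEN fun_cong, THEN fun_cong, symmetric]
  proof
    \<comment> \<open>Pairing \<open>e 1\<close> with each of the other three vectors isolates one
      anti-self-dual coordinate at a time.\<close>
    assume *: "asd_at p"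
    have "curvature_minus M g E A p (e 1) (e 2) = 0" "curvature_minus M g E A p (e 1) (e 3) = 0"
      "curvature_minus M g E A p (e 1) (e 4) = 0"
      using * e unfolding asd_at_def by blast+
    then show "F 1 2 = F 3 4 \<and> F 1 3 = F 4 2 \<and> F 1 4 = F 2 3"
      unfolding cm[OF e e] ke by simp
  next
    assume "F 1 2 = F 3 4 \<and> F 1 3 = F 4 2 \<and> F 1 4 = F 2 3"
    then show "asd_at p" unfolding asd_at_def using cm by simp
  qed
qed

text \<open>Reduces everything at \<open>p\<close> to the three matrices \<open>res (e i) p\<close>:
  the residue of any field is the combination of them given by its coordinates along the boundary,
  and self-duality becomes the relations of \<open>su2_triple\<close>.\<close>

lemma boundary_model:
  assumes p: "p \<in> bdry M" and adapted: "adapted_at_infinity M g E A"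
  obtains b e where "boundary_adapted p b" "\<And>i::3. e i \<in> zero_vector_fields M" "\<And>i. rs (e i) p = b (sh i)"
    "\<And>V. V \<in> zero_vector_fields M \<Longrightarrow> res V p = (\<Sum>j\<in>UNIV. boundary_coords p b (rs V p) $ j *\<^sub>R res (e j) p)"
    "asd_at p \<longleftrightarrow> res (e 1) p = res (e 2) p ** res (e 3) p - res (e 3) p ** res (e 2) p \<and>
      res (e 2) p = res (e 3) p ** res (e 1) p - res (e 1) p ** res (e 3) p \<and>
      res (e 3) p = res (e 1) p ** res (e 2) p - res (e 2) p ** res (e 1) p"
proof -
  obtain e where z: "zero_frame M g p e" and asd: "asd_at p \<longleftrightarrow> curvature M E A p (e 1) (e 2) = curvature M E A p (e 3) (e 4) \<and>
      curvature M E A p (e 1) (e 3) = curvature M E A p (e 4) (e 2) \<and>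
      curvature M E A p (e 1) (e 4) = curvature M E A p (e 2) (e 3)"
    by (rule asd_at_iff[OF p])
  have e: "e i \<in> zero_vector_fields M" and b: "orthonormal p (\<lambda>i. rs (e i) p)" for i
    using z zero_frame_iff[OF p] by auto
  define n :: "real^4" where "n = (\<chi> i. - rs (e i) p x)"
  define b' where "b' = (\<lambda>i f. \<Sum>j\<in>UNIV. iso_frame n i j * rs (e j) p f)"
  have n: "norm n = 1" and b': "boundary_adapted p b'"
    using iso_frame_boundary_adapted[OF p b] unfolding n_def b'_def by auto
  note b'T = b_tangent[OF p b'] and b'x = b_x[OF p b']
  obtain e' where e': "\<And>i. e' i \<in> zero_vector_fields M" "\<And>i. rs (e' i) p = b' i"
    by (rule realize_frame[of b' p, OF b'T]) blast
  define F where "F = (\<lambda>i j. curvature M E A p (e i) (e j))"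
  have F: "F j i = - F i j" for i j
    unfolding F_def curvature_eq[OF p e e] by simp
  have F': "curvature M E A p (e' i) (e' j) = (\<Sum>a\<in>UNIV. \<Sum>b\<in>UNIV. (iso_frame n i a * iso_frame n j b) *\<^sub>R F a b)" for i j
    unfolding F_def by (rule curvature_expansion[OF p e'(1) e'(1) e]) (simp_all only: e'(2) b'_def)
  define R where "R = (\<lambda>i. res (e' i) p)"
  \<comment> \<open>The normal vector is orthogonal to \<open>K\<close>, so adaptedness kills its
    residue; then \<open>F(n, k)\<close> has no commutator term.\<close>
  have "e' 1 \<in> K_perp M g p"
    unfolding K_perp_def
  proof (intro CollectI conjI ballI e')
    fix W assume "W \<in> K_fibre M p"
    then have W: "W \<in> zero_vector_fields M" "rs W p x = 0" using K_fibre_iff[OF x_bdf p] by auto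
    have "zero_metric M g (e' 1) W p = h p (rs W p) (b' 1)"
      using zero_metric_eq(1)[OF e'(1) W(1), of 1] h_sym[OF b'T rs_tangent[OF W(1)]] by (simp add: e'(2))
    then show "zero_metric M g (e' 1) W p = 0"
      using normal_component[OF p b' rs_tangent[OF W(1)]] W(2) by simp
  qed
  then have R1: "R 1 = 0" using adapted p unfolding adapted_at_infinity_def R_def by blast
  have Rd: "res (e' i) p = R i" for i by (simp add: R_def)
  have C1: "curvature M E A p (e' 1) (e' (sh i)) = R (sh i)" for i
    unfolding curvature_eq[OF p e'(1) e'(1)] e'(2) Rd by (simp add: R1 b'x)
  have C2: "curvature M E A p (e' (sh i)) (e' (sh j)) = R (sh i) ** R (sh j) - R (sh j) ** R (sh i)" for i j
    unfolding curvature_eq[OF p e'(1) e'(1)] e'(2) Rd by (simp add: b'x)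
  \<comment> \<open>The anti-self-dual coordinates in the frame of the Hodge star equal those in the
    adapted frame, so the equations transfer unchanged.\<close>
  note d = iso_frame_asd[of F n, OF F n, folded F']
  have "asd_at p \<longleftrightarrow> F 1 2 - F 3 4 = 0 \<and> F 1 3 - F 4 2 = 0 \<and> F 1 4 - F 2 3 = 0"
    unfolding asd F_def by simp
  also have "\<dots> \<longleftrightarrow> R (sh 1) = R (sh 2) ** R (sh 3) - R (sh 3) ** R (sh 2) \<and>
      R (sh 2) = R (sh 3) ** R (sh 1) - R (sh 1) ** R (sh 3) \<and>
      R (sh 3) = R (sh 1) ** R (sh 2) - R (sh 2) ** R (sh 1)"
    unfolding d[symmetric] using C1[of 1] C1[of 2] C1[of 3] C2[of 2 3] C2[of 3 1] C2[of 1 2] by simp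
  finally have asd': "asd_at p \<longleftrightarrow> R (sh 1) = R (sh 2) ** R (sh 3) - R (sh 3) ** R (sh 2) \<and>
      R (sh 2) = R (sh 3) ** R (sh 1) - R (sh 1) ** R (sh 3) \<and>
      R (sh 3) = R (sh 1) ** R (sh 2) - R (sh 2) ** R (sh 1)" .
  show ?thesis
  proof (rule that[of b' "\<lambda>i. e' (sh i)", OF b' e'(1) e'(2)])
    fix V assume V: "V \<in> zero_vector_fields M"
    have "rs V p = (\<lambda>f. \<Sum>i\<in>UNIV. h p (rs V p) (b' i) * rs (e' i) p f)"
      using orthonormal_expansion[OF b_orthonormal[OF p b'] rs_tangent[OF V]] by (simp add: e'(2))
    from residue_combination[OF p V e'(1) this]
    show "res V p = (\<Sum>j\<in>UNIV. boundary_coords p b' (rs V p) $ j *\<^sub>R res (e' (sh j)) p)"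
      using R1 by (simp add: sum_4_sh boundary_coords_def R_def)
  qed (use asd' in \<open>simp add: R_def\<close>)
qed

definition nahm_at :: "'a \<Rightarrow> bool" where
  "nahm_at p \<longleftrightarrow> (\<lambda>V. res V p) ` K_fibre M p = su2 \<and>
    (\<forall>V\<in>K_fibre M p. res V p = 0 \<longrightarrow> V \<in> zero_null M p) \<and>
    (\<forall>V W U. K_cross M g p V W U \<longrightarrow> res U p = res V p ** res W p - res W p ** res V p)"

text \<open>The homomorphism property is applied to the three cross products of an adapted
  frame.\<close>

lemma nahm_at_imp_asd_at:
  assumes p: "p \<in> bdry M" and adapted: "adapted_at_infinity M g E A" and nahm: "nahm_at p"
  shows "asd_at p"
proof -
  obtain b e where b: "boundary_adapted p b" and e: "\<And>i::3. e i \<in> zero_vector_fields M" "\<And>i. rs (e i) p = b (sh i)"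
    and asd: "asd_at p \<longleftrightarrow> res (e 1) p = res (e 2) p ** res (e 3) p - res (e 3) p ** res (e 2) p \<and>
      res (e 2) p = res (e 3) p ** res (e 1) p - res (e 1) p ** res (e 3) p \<and>
      res (e 3) p = res (e 1) p ** res (e 2) p - res (e 2) p ** res (e 1) p"
    by (rule boundary_model[OF p adapted]) (rule that, assumption+)
  show ?thesis
    unfolding asd using K_cross_adapted[OF p b e] nahm unfolding nahm_at_def by blast
qed

text \<open>The relations and one nonzero residue put the three matrices into the nonzero case of
  \<open>su2_triple\<close>. In the second claim the bracket on the right is the squared length of
  the component of \<open>rs V p\<close> in \<open>K\<close>. It is stated without a frame, so that
  the right side varies continuously with the point.\<close>

lemma asd_at_imp_nahm_at:
  assumes p: "p \<in> bdry M" and adapted: "adapted_at_infinity M g E A" and asd_p: "asd_at p"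
    and ne: "\<exists>V\<in>zero_vector_fields M. res V p \<noteq> 0"
  shows "nahm_at p"
    and "V \<in> zero_vector_fields M \<Longrightarrow> (norm (res V p))\<^sup>2 = (h p (rs V p) (rs V p) - (rs V p x)\<^sup>2) / 2"
proof -
  obtain b e where b: "boundary_adapted p b" and e: "\<And>i::3. e i \<in> zero_vector_fields M" "\<And>i. rs (e i) p = b (sh i)"
    and res: "\<And>V. V \<in> zero_vector_fields M \<Longrightarrow> res V p = (\<Sum>j\<in>UNIV. boundary_coords p b (rs V p) $ j *\<^sub>R res (e j) p)"
    and asd: "asd_at p \<longleftrightarrow> res (e 1) p = res (e 2) p ** res (e 3) p - res (e 3) p ** res (e 2) p \<and>
      res (e 2) p = res (e 3) p ** res (e 1) p - res (e 1) p ** res (e 3) p \<and>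
      res (e 3) p = res (e 1) p ** res (e 2) p - res (e 2) p ** res (e 1) p"
    by (rule boundary_model[OF p adapted]) (rule that, assumption+)
  define T where "T = (\<lambda>i. res (e i) p)"
  have c: "T 1 = T 2 ** T 3 - T 3 ** T 2" "T 2 = T 3 ** T 1 - T 1 ** T 3" "T 3 = T 1 ** T 2 - T 2 ** T 1"
    using asd asd_p unfolding T_def by blast+
  have T: "T i \<in> su2" for i unfolding T_def by (rule residue_su2[OF p e(1)])
  have resT: "res V p = (\<Sum>j\<in>UNIV. boundary_coords p b (rs V p) $ j *\<^sub>R T j)" if "V \<in> zero_vector_fields M" for V
    unfolding T_def by (rule res[OF that])
  have "\<exists>i. T i \<noteq> 0"
  proof (rule ccontr)
    assume "\<not> (\<exists>i. T i \<noteq> 0)"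
    then have "res V p = 0" if "V \<in> zero_vector_fields M" for V using resT[OF that] by simp
    then show False using ne by blast
  qed
  note triple = su2_triple[of T, OF T T T c this]
  have K: "V \<in> zero_vector_fields M" "rs V p x = 0" if "V \<in> K_fibre M p" for V
    using that K_fibre_iff[OF x_bdf p] by auto
  show "nahm_at p"
    unfolding nahm_at_def
  proof (intro conjI ballI allI impI)
    show "(\<lambda>V. res V p) ` K_fibre M p = su2"
    proof
      show "(\<lambda>V. res V p) ` K_fibre M p \<subseteq> su2" using residue_su2[OF p] K by blast
      show "su2 \<subseteq> (\<lambda>V. res V p) ` K_fibre M p"
      proof
        fix S assume "S \<in> su2"
        then obtain c where c: "S = (\<Sum>i\<in>UNIV. (c$i) *\<^sub>R T i)" using triple(2) by blast
        \<comment> \<open>The coordinates of \<open>S\<close> in the triple are used as coordinates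
          of a vector tangent to the boundary, whose residue is then \<open>S\<close>.\<close>
        define v where "v = (\<lambda>f. \<Sum>i\<in>UNIV. c $ i * b (sh i) f)"
        have vT: "v \<in> tangent_space M p" unfolding v_def by (intro tangent_space_sum b_tangent[OF p b])
        obtain V where V: "V \<in> zero_vector_fields M" "rs V p = v"
          using realize_frame[of "\<lambda>_::unit. v" p, OF vT] by metis
        have "v x = 0" by (simp add: v_def b_x[OF p b])
        then have VK: "V \<in> K_fibre M p" using V K_fibre_iff[OF x_bdf p] by simp
        have "res V p = S"
          using residue_combination[OF p V(1) e(1), of "\<lambda>i. c $ i"] by (simp add: V(2) v_def e(2) c T_def)
        then show "S \<in> (\<lambda>V. res V p) ` K_fibre M p" using VK by blast
      qed
    qed
    show "V \<in> zero_null M p" if V: "V \<in> K_fibre M p" and 0: "res V p = 0" for V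
    proof -
      \<comment> \<open>Injectivity on \<open>K\<close> comes from the norm formula: the residue is
        zero only if the coordinates are.\<close>
      have "boundary_coords p b (rs V p) = 0"
        using triple(1)[of "boundary_coords p b (rs V p)"] resT[OF K(1)[OF V]] 0 by simp
      then have "rs V p = (\<lambda>f. 0)"
        using K_expansion[OF p b rs_tangent[OF K(1)[OF V]] K(2)[OF V]] by simp
      then show ?thesis by (rule zero_nullI[OF x_bdf K(1)[OF V]])
    qed
    fix V W U assume cr: "K_cross M g p V W U"
    then have z: "V \<in> zero_vector_fields M" "W \<in> zero_vector_fields M" "U \<in> zero_vector_fields M"
      using K(1) unfolding K_cross_def by auto
    define u w where "u = boundary_coords p b (rs V p)" and "w = boundary_coords p b (rs W p)"
    have RU: "res U p = (\<Sum>j\<in>UNIV. cross3 u w $ j *\<^sub>R T j)"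
      unfolding resT[OF z(3)] K_cross_coords[OF p b cr] u_def w_def ..
    have 1: "res V p ** res W p = (\<Sum>i\<in>UNIV. \<Sum>j\<in>UNIV. (u $ i * w $ j) *\<^sub>R (T i ** T j))"
      unfolding resT[OF z(1)] resT[OF z(2)] u_def w_def by (rule bounded_bilinear_combinations[OF matrix_mult_bounded_bilinear])
    have 2: "res W p ** res V p = (\<Sum>i\<in>UNIV. \<Sum>j\<in>UNIV. (w $ i * u $ j) *\<^sub>R (T i ** T j))"
      unfolding resT[OF z(1)] resT[OF z(2)] u_def w_def by (rule bounded_bilinear_combinations[OF matrix_mult_bounded_bilinear])
    have "(\<Sum>j\<in>UNIV. cross3 u w $ j *\<^sub>R T j) =
      (u$2 * w$3 - u$3 * w$2) *\<^sub>R (T 2 ** T 3 - T 3 ** T 2) +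
      (u$3 * w$1 - u$1 * w$3) *\<^sub>R (T 3 ** T 1 - T 1 ** T 3) +
      (u$1 * w$2 - u$2 * w$1) *\<^sub>R (T 1 ** T 2 - T 2 ** T 1)"
      by (simp add: c[symmetric] sum_3 cross3_def)
    then show "res U p = res V p ** res W p - res W p ** res V p"
      unfolding RU 1 2 by (simp add: sum_3 algebra_simps)
  qed
  assume V: "V \<in> zero_vector_fields M"
  let ?v = "rs V p"
  have "h p ?v ?v = (\<Sum>i\<in>UNIV. h p ?v (b i) * h p (b i) ?v)"
    by (subst (1) orthonormal_expansion[OF b_orthonormal[OF p b] rs_tangent[OF V]])
      (rule h_sum[OF rs_tangent[OF V] b_tangent[OF p b]])
  also have "\<dots> = (\<Sum>i\<in>UNIV. (h p ?v (b i))\<^sup>2)"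
    using h_sym[OF b_tangent[OF p b] rs_tangent[OF V]] by (simp add: power2_eq_square)
  also have "\<dots> = (?v x)\<^sup>2 + (norm (boundary_coords p b ?v))\<^sup>2"
    unfolding power2_norm_eq_inner
    by (simp add: sum_4_sh normal_component[OF p b rs_tangent[OF V]] inner_vec_def boundary_coords_def power2_eq_square)
  finally show "(norm (res V p))\<^sup>2 = (h p ?v ?v - (?v x)\<^sup>2) / 2"
    unfolding resT[OF V] triple(1) by simp
qed

section \<open>Propagation along the components of the boundary\<close>

lemma residue_nonzero_open:
  assumes p: "p \<in> bdry M" and V: "V \<in> zero_vector_fields M" and ne: "res V p \<noteq> 0"
  shows "\<forall>\<^sub>F q in nhds p. q \<in> bdry M \<longrightarrow> (\<exists>V\<in>zero_vector_fields M. res V q \<noteq> 0)"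
proof -
  obtain \<theta> where \<theta>: "isCont \<theta> p" "\<forall>\<^sub>F q in nhds p. q \<in> bdry M \<longrightarrow> \<theta> q = norm (res V q)"
    by (rule residue_norm_continuous[OF p V])
  have "\<theta> p \<noteq> 0" using eventually_nhds_x_imp_x[OF \<theta>(2)] p ne by simp
  then have "\<forall>\<^sub>F q in nhds p. \<theta> q \<noteq> 0"
    by (rule tendsto_imp_eventually_ne[OF isCont_tendsto_nhds[OF \<theta>(1)]])
  with \<theta>(2) show ?thesis by eventually_elim (use V in auto)
qed

text \<open>Where the residue does not vanish, its norm on the field \<open>V\<close> is determined by the metric, hence
  bounded away from zero near \<open>p\<close> if \<open>V\<close> is a unit element of \<open>K\<close> at \<open>p\<close>.\<close>

lemma residue_zero_open:
  assumes p: "p \<in> bdry M" and adapted: "adapted_at_infinity M g E A" and asd: "\<And>q. q \<in> bdry M \<Longrightarrow> asd_at q"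
    and 0: "\<forall>V\<in>zero_vector_fields M. res V p = 0"
  shows "\<forall>\<^sub>F q in nhds p. q \<in> bdry M \<longrightarrow> (\<forall>V\<in>zero_vector_fields M. res V q = 0)"
proof -
  obtain b e where b: "boundary_adapted p b" and e: "\<And>i::3. e i \<in> zero_vector_fields M" "\<And>i. rs (e i) p = b (sh i)"
    by (rule boundary_model[OF p adapted]) (rule that, assumption+)
  define V where "V = e 1"
  have V: "V \<in> zero_vector_fields M" "rs V p = b 2" using e by (auto simp: V_def)
  \<comment> \<open>The squared length of the component of \<open>rs V\<close> in \<open>K\<close>
    at boundary points; it is continuous, and equals 1 at \<open>p\<close> because
    \<open>b 2\<close> is a unit vector tangent to the boundary.\<close>
  define m where "m = (\<lambda>q. h q (rs V q) (rs V q) - (rs V q x)\<^sup>2)"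
  have "(\<lambda>q. h q (rs V q) (rs V q) - rs V q x * rs V q x) \<in> smooth_functions M"
    by (intro smooth_functions_diff smooth_functions_mult zero_metric_eq(2)[OF V(1) V(1)]
        vector_field_smooth[OF rs_vector_field[OF V(1)] bdf_smooth[OF x_bdf]])
  then have "smooth_at M m p" by (simp add: m_def power2_eq_square smooth_functions_iff)
  then have m_cont: "isCont m p" by (rule smooth_at_isCont)
  have "m p = 1"
    using orthonormal_metric[OF b_orthonormal[OF p b], of 2 2] b_x[OF p b, of 2] by (simp add: m_def V(2))
  then have m: "\<forall>\<^sub>F q in nhds p. m q > 1 / 2"
    using order_tendstoD(1)[OF isCont_tendsto_nhds[OF m_cont], of "1 / 2"] by simp
  obtain \<theta> where \<theta>: "isCont \<theta> p" "\<forall>\<^sub>F q in nhds p. q \<in> bdry M \<longrightarrow> \<theta> q = norm (res V q)"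
    by (rule residue_norm_continuous[OF p V(1)])
  have "\<theta> p = 0" using eventually_nhds_x_imp_x[OF \<theta>(2)] p 0 V(1) by simp
  then have "\<forall>\<^sub>F q in nhds p. \<theta> q < 1 / 2"
    using order_tendstoD(2)[OF isCont_tendsto_nhds[OF \<theta>(1)], of "1 / 2"] by simp
  with m \<theta>(2) show ?thesis
  proof eventually_elim
    case (elim q)
    show ?case
    proof (rule impI, rule ccontr)
      assume q: "q \<in> bdry M" and "\<not> (\<forall>V\<in>zero_vector_fields M. res V q = 0)"
      \<comment> \<open>A nonzero residue at \<open>q\<close> would have squared norm
        \<open>m q / 2 > 1/4\<close> on \<open>V\<close>, whereas continuity of the norm from its
        value 0 at \<open>p\<close> gives less than 1/4.\<close>
      then have "(norm (res V q))\<^sup>2 = m q / 2"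
        using asd_at_imp_nahm_at(2)[OF q adapted asd[OF q] _ V(1)] by (auto simp: m_def)
      moreover have "(norm (res V q))\<^sup>2 < (1 / 2)\<^sup>2"
        using elim q by (intro power_strict_mono) auto
      ultimately show False using elim(1) by (simp add: power2_eq_square)
    qed
  qed
qed

text \<open>Vanishing of the residue is a locally constant property of boundary points, so on a
  connected component the one point where it fails decides for all.\<close>

lemma residue_nonzero_everywhere:
  assumes adapted: "adapted_at_infinity M g E A" and asd: "\<And>q. q \<in> bdry M \<Longrightarrow> asd_at q"
    and ne: "\<forall>C\<in>components (bdry M). \<exists>p\<in>C. \<exists>V\<in>zero_vector_fields M. res V p \<noteq> 0"
    and p: "p \<in> bdry M"
  shows "\<exists>V\<in>zero_vector_fields M. res V p \<noteq> 0"
proof (rule ccontr)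
  assume *: "\<not> (\<exists>V\<in>zero_vector_fields M. res V p \<noteq> 0)"
  obtain C where C: "C \<in> components (bdry M)" "p \<in> C" using p Union_components by blast
  then have CB: "C \<subseteq> bdry M" "connected C" using in_components_subset in_components_connected by blast+
  define Z where "Z = (\<lambda>q. \<forall>V\<in>zero_vector_fields M. res V q = 0)"
  obtain p' where p': "p' \<in> C" "\<not> Z p'" using ne C(1) unfolding Z_def by blast
  have "\<exists>N. open N \<and> q \<in> N \<and> (\<forall>r\<in>N. r \<in> bdry M \<longrightarrow> Z r = Z q)" if "q \<in> bdry M" for q
  proof (cases "Z q")
    case True
    then have "\<forall>\<^sub>F r in nhds q. r \<in> bdry M \<longrightarrow> Z r"
      using residue_zero_open[OF that adapted asd] unfolding Z_def by simp
    then show ?thesis using True unfolding eventually_nhds by blast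
  next
    case False
    then obtain V where "V \<in> zero_vector_fields M" "res V q \<noteq> 0" unfolding Z_def by blast
    then have "\<forall>\<^sub>F r in nhds q. r \<in> bdry M \<longrightarrow> \<not> Z r"
      using residue_nonzero_open[OF that] unfolding Z_def by simp
    then show ?thesis using False unfolding eventually_nhds by blast
  qed
  then obtain N where N: "\<And>q. q \<in> bdry M \<Longrightarrow> open (N q)" "\<And>q. q \<in> bdry M \<Longrightarrow> q \<in> N q"
    "\<And>q r. q \<in> bdry M \<Longrightarrow> r \<in> N q \<Longrightarrow> r \<in> bdry M \<Longrightarrow> Z r = Z q" by metis
  define G where "G = (\<Union>q\<in>{q \<in> bdry M. Z q}. N q)"
  define H where "H = (\<Union>q\<in>{q \<in> bdry M. \<not> Z q}. N q)"
  have "open G" "open H" unfolding G_def H_def using N(1) by auto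
  moreover have "C \<subseteq> G \<union> H" using CB(1) N(2) unfolding G_def H_def by blast
  moreover have "G \<inter> H \<inter> C = {}" using CB(1) N(3) unfolding G_def H_def by blast
  moreover have "p \<in> G" using p N(2) * unfolding G_def Z_def by blast
  moreover have "p' \<in> H" using p' CB(1) N(2) unfolding H_def by blast
  ultimately show False using CB(2) C(2) p'(1) unfolding connected_def by blast
qed

lemma nahm_pole_iff_asymptotically_self_dual:
  assumes adapted: "adapted_at_infinity M g E A"
    and ne: "\<forall>C\<in>components (bdry M). \<exists>p\<in>C. \<exists>V\<in>zero_vector_fields M. res V p \<noteq> 0"
  shows "nahm_pole M g E A \<longleftrightarrow> asymptotically_self_dual M g E A"
proof -
  have "nahm_pole M g E A \<longleftrightarrow> (\<forall>p\<in>bdry M. nahm_at p)"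
    using adapted by (simp add: nahm_pole_def nahm_at_def)
  moreover have "asymptotically_self_dual M g E A \<longleftrightarrow> (\<forall>p\<in>bdry M. asd_at p)"
    by (simp add: asymptotically_self_dual_def asd_at_def)
  ultimately show ?thesis
    using nahm_at_imp_asd_at[OF _ adapted] asd_at_imp_nahm_at(1)[OF _ adapted]
      residue_nonzero_everywhere[OF adapted _ ne] by blast
qed

end

theorem proposition4p5:
  fixes M :: "'a::t2_space chart set"
    and g :: "'a metric_field"
    and E :: "'a trivialisations"
    and A :: "'a connection"
  assumes "compact (UNIV :: 'a set)"
    and "oriented_manifold_with_boundary M"
    and "asymptotically_hyperbolic M g"
    and "su2_bundle M E"
    and "su2_zero_connection M E A"
    and "adapted_at_infinity M g E A"
    and "\<forall>C\<in>components (bdry M). \<exists>p\<in>C. \<exists>V\<in>zero_vector_fields M. residue M E A V p \<noteq> 0"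
  shows "nahm_pole M g E A \<longleftrightarrow> asymptotically_self_dual M g E A"
proof -
  \<comment> \<open>The pair is taken from the clause on \<open>|dx|\<close>, so that the unit
    condition and the compactification refer to the same \<open>x\<close> and
    \<open>h\<close>.\<close>
  obtain x h where "compactification M g x h" "\<forall>p\<in>bdry M. differential_norm_sq M h p x = 1"
    "riemannian_metric_on M (- bdry M) g"
    using assms(3) unfolding asymptotically_hyperbolic_def conformally_compact_def by blast
  then interpret su2_zero_connection_manifold M g x h E A
    using assms(1,2,4,5) by unfold_locales auto
  show ?thesis by (rule nahm_pole_iff_asymptotically_self_dual[OF assms(6,7)])
qed

end
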